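(* Let $A$, $B$, $C$ be finite alphabets, let $k$ be a positive integer, let $\tau : A^* \to B^*$ be a rational relation with finite image, and let $\theta : B^* \to C^*$ be a monoid morphism such that the composition $\tau\theta$ (first $\tau$, then $\theta$) is $k$-valued. Then every transducer $\mathcal{S}$ realising $\tau$ can be effectively decomposed into $k$ transducers whose compositions with $\theta$ are functions. That is, one can effectively construct from $\mathcal{S}$ transducers $\mathcal{S}^{(0)},\dots,\mathcal{S}^{(k-1)}$ realising relations $\tau_0,\dots,\tau_{k-1}$ from $A^*$ to $B^*$ such that $\tau = \tau_0\cup\dots\cup\tau_{k-1}$ and, for each $j$, the relation $\tau_j\theta$ from $A^*$ to $C^*$ is a (partial) function.
   Context: A transducer from $A^*$ to $B^*$ is a finite automaton over the monoid $A^*\times B^*$: a finite set $Q$ of states, a finite set of transitions, each with an origin in $Q$, a label $(u,x)\in A^*\times B^*$ (written $u|x$, with input $u$ and output $x$) and an end in $Q$, and subsets $I,T\subseteq Q$ of initial and final states. A computation is a path; its label is the (componentwise) product of the labels of its transitions; it is successful if it starts in $I$ and ends in $T$. The relation realised by the transducer is the set of labels of its successful computations, a subset of $A^*\times B^*$ viewed as a relation from $A^*$ to $B^*$. The relations realised by (finite) transducers are the rational relations. For a relation $\tau$ from $A^*$ to $B^*$ and $u\in A^*$, $u\tau\subseteq B^*$ denotes the image of $u$. The relation $\tau$ has finite image if $u\tau$ is finite for every $u$; it is $k$-valued if $u\tau$ has at most $k$ elements for every $u\in A^*$; a (partial) function is a $1$-valued relation. Relations and functions are written in postfix notation, so $u(\tau\theta)=\{y\theta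 : y\in u\tau\}$. A transducer $\mathcal{S}$ is decomposed into transducers $\mathcal{S}^{(0)},\dots,\mathcal{S}^{(k-1)}$ if the relation realised by $\mathcal{S}$ equals the union of the relations realised by the $\mathcal{S}^{(j)}$. *)

theory Defs
  imports Main "HOL-Library.Nat_Bijection"
begin

section \<open>Transducers and the relations they realise\<close>

text \<open>The free monoid over an alphabet \<open>A\<close> is \<open>lists A\<close> with concatenation.\<close>

record ('q, 'a, 'b) transducer =
  states :: "'q set"
  transitions :: "('q \<times> ('a list \<times> 'b list) \<times> 'q) set"
  initial :: "'q set"
  final :: "'q set"

definition transducer :: "'a set \<Rightarrow> 'b set \<Rightarrow> ('q, 'a, 'b) transducer \<Rightarrow> bool" where
  "transducer A B S \<longleftrightarrow>
     finite (states S) \<and> finite (transitions S) \<and>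
     transitions S \<subseteq> states S \<times> (lists A \<times> lists B) \<times> states S \<and>
     initial S \<subseteq> states S \<and> final S \<subseteq> states S"

inductive computation ::
    "('q, 'a, 'b) transducer \<Rightarrow> 'q \<Rightarrow> 'a list \<times> 'b list \<Rightarrow> 'q \<Rightarrow> bool"
  for S :: "('q, 'a, 'b) transducer" where
  empty: "p \<in> states S \<Longrightarrow> computation S p ([], []) p"
| step: "(p, (u, x), q) \<in> transitions S \<Longrightarrow> computation S q (v, y) r \<Longrightarrow>
         computation S p (u @ v, x @ y) r"

definition realised :: "('q, 'a, 'b) transducer \<Rightarrow> ('a list \<times> 'b list) set" where
  "realised S = {w. \<exists>p \<in> initial S. \<exists>q \<in> final S. computation S p w q}"

text \<open>Since state sets are finite, letting the states be natural numbers is no restriction.\<close>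

definition rational :: "'a set \<Rightarrow> 'b set \<Rightarrow> ('a list \<times> 'b list) set \<Rightarrow> bool" where
  "rational A B \<tau> \<longleftrightarrow> (\<exists>S :: (nat, 'a, 'b) transducer. transducer A B S \<and> realised S = \<tau>)"

definition finite_image :: "('x \<times> 'y) set \<Rightarrow> bool" where
  "finite_image \<tau> \<longleftrightarrow> (\<forall>u. finite (\<tau> `` {u}))"

definition valued :: "nat \<Rightarrow> ('x \<times> 'y) set \<Rightarrow> bool" where
  "valued k \<tau> \<longleftrightarrow> (\<forall>u. finite (\<tau> `` {u}) \<and> card (\<tau> `` {u}) \<le> k)"

abbreviation functional :: "('x \<times> 'y) set \<Rightarrow> bool" where
  "functional \<tau> \<equiv> valued 1 \<tau>"

definition morphism :: "'b set \<Rightarrow> 'c set \<Rightarrow> ('b list \<Rightarrow> 'c list) \<Rightarrow> bool" where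
  "morphism B C \<theta> \<longleftrightarrow>
     (\<forall>x \<in> lists B. \<theta> x \<in> lists C) \<and> \<theta> [] = [] \<and>
     (\<forall>x \<in> lists B. \<forall>y \<in> lists B. \<theta> (x @ y) = \<theta> x @ \<theta> y)"

text \<open>Relations and functions compose from left to right: first \<open>\<tau>\<close>, then \<open>\<theta>\<close>.\<close>

definition then_apply :: "('x \<times> 'y) set \<Rightarrow> ('y \<Rightarrow> 'z) \<Rightarrow> ('x \<times> 'z) set" where
  "then_apply \<tau> \<theta> = {(u, \<theta> y) | u y. (u, y) \<in> \<tau>}"

definition decomposed ::
    "('q, 'a, 'b) transducer \<Rightarrow> ('r, 'a, 'b) transducer list \<Rightarrow> bool" where
  "decomposed S Ss \<longleftrightarrow> realised S = (\<Union>j < length Ss. realised (Ss ! j))"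


section \<open>Effectivity: partial recursive functions\<close>

text \<open>
  \<open>computes f xs y\<close> says that the partial recursive function denoted by \<open>f\<close> is defined at the
  arguments \<open>xs\<close>, with value \<open>y\<close>. Terms carry no arities: \<open>Zero\<close> and \<open>Proj i\<close> accept
  argument lists of any (sufficient) length.
\<close>

datatype recf =
    Zero
  | Succ
  | Proj nat
  | Comp recf "recf list"
  | PrimRec recf recf
  | Mu recf

inductive computes :: "recf \<Rightarrow> nat list \<Rightarrow> nat \<Rightarrow> bool" where
  Zero: "computes Zero xs 0"
| Succ: "computes Succ [x] (Suc x)"
| Proj: "i < length xs \<Longrightarrow> computes (Proj i) xs (xs ! i)"
| Comp: "list_all2 (\<lambda>g y. computes g xs y) gs ys \<Longrightarrow> computes f ys z \<Longrightarrow>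
         computes (Comp f gs) xs z"
| PrimRec_0: "computes f xs y \<Longrightarrow> computes (PrimRec f g) (0 # xs) y"
| PrimRec_Suc: "computes (PrimRec f g) (n # xs) y \<Longrightarrow> computes g (n # y # xs) z \<Longrightarrow>
         computes (PrimRec f g) (Suc n # xs) z"
| Mu: "computes f (n # xs) 0 \<Longrightarrow> (\<forall>m < n. \<exists>y. computes f (m # xs) (Suc y)) \<Longrightarrow>
         computes (Mu f) xs n"

inductive_cases computes_ZeroE: "computes Zero xs y"
inductive_cases computes_SuccE: "computes Succ xs y"
inductive_cases computes_ProjE: "computes (Proj i) xs y"
inductive_cases computes_CompE: "computes (Comp f gs) xs y"
inductive_cases computes_PrimRec_0E: "computes (PrimRec f g) (0 # xs) y"
inductive_cases computes_PrimRec_SucE: "computes (PrimRec f g) (Suc n # xs) y"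
inductive_cases computes_MuE: "computes (Mu f) xs y"

lemma computes_deterministic: "computes f xs y \<Longrightarrow> computes f xs z \<Longrightarrow> y = z"
proof (induction arbitrary: z rule: computes.induct)
  case (Zero xs)
  then show ?case by (rule computes_ZeroE) simp
next
  case (Succ x)
  then show ?case by (rule computes_SuccE) simp
next
  case (Proj i xs)
  from Proj.prems show ?case by (rule computes_ProjE) simp
next
  case (Comp xs gs ys f y)
  from Comp.prems obtain ys' where ys': "list_all2 (\<lambda>g y. computes g xs y) gs ys'"
    and z: "computes f ys' z"
    by (rule computes_CompE)
  have "ys = ys'"
  proof (rule nth_equalityI)
    show "length ys = length ys'"
      using list_all2_lengthD[OF Comp.IH(1)] list_all2_lengthD[OF ys'] by simp
    show "ys ! i = ys' ! i" if "i < length ys" for i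
      using list_all2_nthD2[OF Comp.IH(1) that] list_all2_nthD[OF ys', of i] that
        list_all2_lengthD[OF Comp.IH(1)] by simp
  qed
  with z Comp.IH(2) show ?case by blast
next
  case (PrimRec_0 f xs y g)
  from PrimRec_0.prems have "computes f xs z" by (rule computes_PrimRec_0E)
  then show ?case by (rule PrimRec_0.IH)
next
  case (PrimRec_Suc f g n xs y w)
  from PrimRec_Suc.prems obtain y' where y': "computes (PrimRec f g) (n # xs) y'"
    and z: "computes g (n # y' # xs) z"
    by (rule computes_PrimRec_SucE)
  from PrimRec_Suc.IH(1)[OF y'] z show ?case by (intro PrimRec_Suc.IH(2)) simp
next
  case (Mu f n xs)
  from Mu.prems have z: "computes f (z # xs) 0"
    by (rule computes_MuE)
  from Mu.prems have below: "\<forall>m < z. \<exists>y. computes f (m # xs) (Suc y)"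
    by (rule computes_MuE)
  have "\<not> z < n" using Mu.IH(2) z by blast
  moreover have "\<not> n < z" using Mu.IH(1) below by blast
  ultimately show ?case by simp
qed


section \<open>Codes of the data\<close>

text \<open>
  Letters and states are made available to an algorithm through injective numberings
  \<open>\<nu>\<close>; words are then coded by \<^const>\<open>list_encode\<close> and finite sets by \<^const>\<open>set_encode\<close>.
\<close>

definition word_code :: "('a \<Rightarrow> nat) \<Rightarrow> 'a list \<Rightarrow> nat" where
  "word_code \<nu> u = list_encode (map \<nu> u)"

definition finset_code :: "('x \<Rightarrow> nat) \<Rightarrow> 'x set \<Rightarrow> nat" where
  "finset_code \<nu> X = set_encode (\<nu> ` X)"

definition transition_code ::
    "('q \<Rightarrow> nat) \<Rightarrow> ('a \<Rightarrow> nat) \<Rightarrow> ('b \<Rightarrow> nat) \<Rightarrow> 'q \<times> ('a list \<times> 'b list) \<times> 'q \<Rightarrow> nat" where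
  "transition_code \<nu>Q \<nu>A \<nu>B =
     (\<lambda>(p, (u, x), q). list_encode [\<nu>Q p, word_code \<nu>A u, word_code \<nu>B x, \<nu>Q q])"

definition transducer_code ::
    "('q \<Rightarrow> nat) \<Rightarrow> ('a \<Rightarrow> nat) \<Rightarrow> ('b \<Rightarrow> nat) \<Rightarrow> ('q, 'a, 'b) transducer \<Rightarrow> nat" where
  "transducer_code \<nu>Q \<nu>A \<nu>B S = list_encode
     [finset_code \<nu>Q (states S), finset_code (transition_code \<nu>Q \<nu>A \<nu>B) (transitions S),
      finset_code \<nu>Q (initial S), finset_code \<nu>Q (final S)]"

text \<open>A morphism is given to an algorithm by the finite table of its values on the letters.\<close>

definition morphism_code ::
    "('b \<Rightarrow> nat) \<Rightarrow> ('c \<Rightarrow> nat) \<Rightarrow> 'b set \<Rightarrow> ('b list \<Rightarrow> 'c list) \<Rightarrow> nat" where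
  "morphism_code \<nu>B \<nu>C B \<theta> =
     finset_code (\<lambda>b. prod_encode (\<nu>B b, word_code \<nu>C (\<theta> [b]))) B"

definition input_code ::
    "('q \<Rightarrow> nat) \<Rightarrow> ('a \<Rightarrow> nat) \<Rightarrow> ('b \<Rightarrow> nat) \<Rightarrow> ('c \<Rightarrow> nat) \<Rightarrow>
     'a set \<Rightarrow> 'b set \<Rightarrow> 'c set \<Rightarrow> nat \<Rightarrow> ('b list \<Rightarrow> 'c list) \<Rightarrow> ('q, 'a, 'b) transducer \<Rightarrow> nat" where
  "input_code \<nu>Q \<nu>A \<nu>B \<nu>C A B C k \<theta> S = list_encode
     [finset_code \<nu>A A, finset_code \<nu>B B, finset_code \<nu>C C, k,
      morphism_code \<nu>B \<nu>C B \<theta>, transducer_code \<nu>Q \<nu>A \<nu>B S]"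

text \<open>The transducers produced by an algorithm have natural numbers as states.\<close>

definition output_code ::
    "('a \<Rightarrow> nat) \<Rightarrow> ('b \<Rightarrow> nat) \<Rightarrow> (nat, 'a, 'b) transducer list \<Rightarrow> nat" where
  "output_code \<nu>A \<nu>B Ss = list_encode (map (transducer_code id \<nu>A \<nu>B) Ss)"

end

theory Submission
  imports Defs "HOL-Library.Sublist" "HOL-Library.Countable"
begin

text \<open>
  By pumping, among any \<open>k + 1\<close> successful computations over one input there are two whose
  \<open>\<theta>\<close>-outputs are equal and whose output lengths stay within a bounded distance at all positions of
  the input. So for every input there are \<open>k\<close> output schedules, each saying what is emitted at
  each input letter, such that every successful computation stays close to one of them. The choices
  of \<open>k\<close> such schedules form a regular language, from which the lexicographically least word is
  selected for each input. The computations that are close to the \<open>j\<close>-th selected schedule form a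
  regular set on which \<open>\<theta>\<close> of the output is a function of the input; multiplying the transducer by
  an automaton for these sets gives the decomposition.

  No explicit bounds are needed for effectivity. That the computations lift to given transducers,
  and that the compositions of these with \<open>\<theta>\<close> are functions, is witnessed by finite certificates
  that are checked locally, so an unbounded search finds a decomposition as soon as one exists.
\<close>

section \<open>Total recursive functions\<close>

text \<open>The obstacle is that two computations over one input may have equal outputs and yet emit
  them with unbounded delay, so a single output value can require several schedules. That k
  schedules suffice in total is seen as follows. Take k + 1 computations over one input, any two of
  them different in output or far apart, with as many pairs of different outputs as possible. Some
  pair has equal outputs, so it is far apart, and a loop common to all k + 1 computations changes
  its delay. Two pumped words agree for all exponents or for at most one; so some exponent separates
  this pair and keeps every existing difference, while pairs that still agree stay far apart. This
  contradicts maximality. Schedules are tied to input letters so that two choices over one input are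
  words of equal length and can be compared letter by letter. In the certificates, pairs of
  computations that can no longer be completed over a common input are split off: only for the
  others does functionality confine the output delay to finitely many values.\<close>

definition tot :: "(nat \<Rightarrow> nat) \<Rightarrow> bool" where
  "tot f \<longleftrightarrow> (\<exists>F. \<forall>x. computes F [x] (f x))"

definition tot2 :: "(nat \<Rightarrow> nat \<Rightarrow> nat) \<Rightarrow> bool" where
  "tot2 f \<longleftrightarrow> (\<exists>F. \<forall>x y. computes F [x, y] (f x y))"

definition tot3 :: "(nat \<Rightarrow> nat \<Rightarrow> nat \<Rightarrow> nat) \<Rightarrow> bool" where
  "tot3 f \<longleftrightarrow> (\<exists>F. \<forall>x y z. computes F [x, y, z] (f x y z))"

lemma computes_Proj_eq: "i < length xs \<Longrightarrow> y = xs ! i \<Longrightarrow> computes (Proj i) xs y"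
  using computes.Proj by simp

lemma tot_id: "tot (\<lambda>x. x)"
  unfolding tot_def by (rule exI[of _ "Proj 0"]) (simp add: computes_Proj_eq)

lemma tot2_fst: "tot2 (\<lambda>x y. x)"
  unfolding tot2_def by (rule exI[of _ "Proj 0"]) (simp add: computes_Proj_eq)

lemma tot2_snd: "tot2 (\<lambda>x y. y)"
  unfolding tot2_def by (rule exI[of _ "Proj 1"]) (simp add: computes_Proj_eq)

lemma tot3_1: "tot3 (\<lambda>x y z. x)"
  unfolding tot3_def by (rule exI[of _ "Proj 0"]) (simp add: computes_Proj_eq)

lemma tot3_2: "tot3 (\<lambda>x y z. y)"
  unfolding tot3_def by (rule exI[of _ "Proj 1"]) (simp add: computes_Proj_eq)

lemma tot3_3: "tot3 (\<lambda>x y z. z)"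
  unfolding tot3_def by (rule exI[of _ "Proj 2"]) (simp add: computes_Proj_eq)

lemma tot_Suc: "tot Suc"
  unfolding tot_def by (rule exI[of _ Succ]) (simp add: computes.Succ)

lemma tot_comp: "tot f \<Longrightarrow> tot g \<Longrightarrow> tot (\<lambda>x. f (g x))"
  unfolding tot_def
proof (elim exE)
  fix F G assume "\<forall>x. computes F [x] (f x)" "\<forall>x. computes G [x] (g x)"
  then have "\<forall>x. computes (Comp F [G]) [x] (f (g x))"
    by (auto intro!: computes.Comp[where ys = "[g _]"])
  then show "\<exists>H. \<forall>x. computes H [x] (f (g x))" by blast
qed

lemma tot_subst: "tot f \<Longrightarrow> tot g \<Longrightarrow> (\<And>x. h x = f (g x)) \<Longrightarrow> tot h"
  using tot_comp[of f g] by presburger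

lemma tot2_comp1: "tot f \<Longrightarrow> tot2 g \<Longrightarrow> tot2 (\<lambda>x y. f (g x y))"
  unfolding tot_def tot2_def
proof (elim exE)
  fix F G assume "\<forall>x. computes F [x] (f x)" "\<forall>x y. computes G [x, y] (g x y)"
  then have "\<forall>x y. computes (Comp F [G]) [x, y] (f (g x y))"
    by (auto intro!: computes.Comp[where ys = "[g _ _]"])
  then show "\<exists>H. \<forall>x y. computes H [x, y] (f (g x y))" by blast
qed

lemma tot3_comp1: "tot f \<Longrightarrow> tot3 g \<Longrightarrow> tot3 (\<lambda>x y z. f (g x y z))"
  unfolding tot_def tot3_def
proof (elim exE)
  fix F G assume "\<forall>x. computes F [x] (f x)" "\<forall>x y z. computes G [x, y, z] (g x y z)"
  then have "\<forall>x y z. computes (Comp F [G]) [x, y, z] (f (g x y z))"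
    by (auto intro!: computes.Comp[where ys = "[g _ _ _]"])
  then show "\<exists>H. \<forall>x y z. computes H [x, y, z] (f (g x y z))" by blast
qed

lemma tot_comp2: "tot2 f \<Longrightarrow> tot g \<Longrightarrow> tot h \<Longrightarrow> tot (\<lambda>x. f (g x) (h x))"
  unfolding tot_def tot2_def
proof (elim exE)
  fix F G H assume "\<forall>x y. computes F [x, y] (f x y)" "\<forall>x. computes G [x] (g x)"
    "\<forall>x. computes H [x] (h x)"
  then have "\<forall>x. computes (Comp F [G, H]) [x] (f (g x) (h x))"
    by (auto intro!: computes.Comp[where ys = "[g _, h _]"])
  then show "\<exists>H. \<forall>x. computes H [x] (f (g x) (h x))" by blast
qed

lemma tot2_comp2: "tot2 f \<Longrightarrow> tot2 g \<Longrightarrow> tot2 h \<Longrightarrow> tot2 (\<lambda>x y. f (g x y) (h x y))"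
  unfolding tot2_def
proof (elim exE)
  fix F G H assume "\<forall>x y. computes F [x, y] (f x y)" "\<forall>x y. computes G [x, y] (g x y)"
    "\<forall>x y. computes H [x, y] (h x y)"
  then have "\<forall>x y. computes (Comp F [G, H]) [x, y] (f (g x y) (h x y))"
    by (auto intro!: computes.Comp[where ys = "[g _ _, h _ _]"])
  then show "\<exists>H. \<forall>x y. computes H [x, y] (f (g x y) (h x y))" by blast
qed

lemma tot3_comp2: "tot2 f \<Longrightarrow> tot3 g \<Longrightarrow> tot3 h \<Longrightarrow> tot3 (\<lambda>x y z. f (g x y z) (h x y z))"
  unfolding tot2_def tot3_def
proof (elim exE)
  fix F G H assume "\<forall>x y. computes F [x, y] (f x y)" "\<forall>x y z. computes G [x, y, z] (g x y z)"
    "\<forall>x y z. computes H [x, y, z] (h x y z)"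
  then have "\<forall>x y z. computes (Comp F [G, H]) [x, y, z] (f (g x y z) (h x y z))"
    by (auto intro!: computes.Comp[where ys = "[g _ _ _, h _ _ _]"])
  then show "\<exists>H. \<forall>x y z. computes H [x, y, z] (f (g x y z) (h x y z))" by blast
qed

lemma tot2_rec:
  assumes "tot f" "tot3 g"
  shows "tot2 (\<lambda>n x. rec_nat (f x) (\<lambda>m y. g m y x) n)"
proof -
  from assms obtain F G where F: "\<And>x. computes F [x] (f x)"
    and G: "\<And>x y z. computes G [x, y, z] (g x y z)"
    unfolding tot_def tot3_def by blast
  have "computes (PrimRec F G) [n, x] (rec_nat (f x) (\<lambda>m y. g m y x) n)" for n x
    by (induction n) (auto intro: computes.PrimRec_0 computes.PrimRec_Suc F G)
  then show ?thesis unfolding tot2_def by blast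
qed

lemma tot_const: "tot (\<lambda>x. c)"
proof (induction c)
  case 0
  show ?case unfolding tot_def by (rule exI[of _ Zero]) (simp add: computes.Zero)
qed (rule tot_comp[OF tot_Suc])

section \<open>Arithmetic and pairing\<close>

lemma tot2_add: "tot2 (+)"
proof -
  have "rec_nat x (\<lambda>m y. Suc y) n = n + x" for n x :: nat
    by (induction n) auto
  then show ?thesis
    using tot2_rec[OF tot_id tot3_comp1[OF tot_Suc tot3_2]] by simp
qed

lemma tot_pred: "tot (\<lambda>n. n - 1)"
proof -
  have "rec_nat 0 (\<lambda>m y. m) n = n - 1" for n :: nat
    by (cases n) auto
  then show ?thesis
    using tot_comp2[OF tot2_rec[OF tot_const[of 0] tot3_1] tot_id tot_id] by simp
qed

lemma tot2_diff: "tot2 (-)"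
proof -
  have "rec_nat x (\<lambda>m y. y - 1) n = x - n" for n x :: nat
    by (induction n) auto
  then have "tot2 (\<lambda>n x. x - n)"
    using tot2_rec[OF tot_id tot3_comp1[OF tot_pred tot3_2]] by simp
  then show ?thesis using tot2_comp2[OF _ tot2_snd tot2_fst, of "\<lambda>n x. x - n"] by simp
qed

lemma tot2_mult: "tot2 (*)"
proof -
  have "rec_nat 0 (\<lambda>m y. y + x) n = n * x" for n x :: nat
    by (induction n) auto
  then show ?thesis
    using tot2_rec[OF tot_const[of 0] tot3_comp2[OF tot2_add tot3_2 tot3_3]]
    by simp
qed

lemma tot_triangle: "tot triangle"
proof -
  have "rec_nat 0 (\<lambda>m y. y + Suc m) n = triangle n" for n :: nat
    by (induction n) auto
  then show ?thesis
    using tot_comp2[OF tot2_rec[OF tot_const[of 0]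
        tot3_comp2[OF tot2_add tot3_2 tot3_comp1[OF tot_Suc tot3_1]]] tot_id tot_id]
    by simp
qed

lemma tot2_prod_encode: "tot2 (\<lambda>x y. prod_encode (x, y))"
  unfolding prod_encode_def
  using tot2_comp2[OF tot2_add tot2_comp1[OF tot_triangle tot2_add] tot2_fst] by simp

abbreviation pfst :: "nat \<Rightarrow> nat" where "pfst n \<equiv> fst (prod_decode n)"
abbreviation psnd :: "nat \<Rightarrow> nat" where "psnd n \<equiv> snd (prod_decode n)"

lemma triangle_mono: "m \<le> n \<Longrightarrow> triangle m \<le> triangle n"
  by (rule lift_Suc_mono_le[of triangle]) auto

lemma tot_Mu:
  assumes "tot2 f" and "\<And>x. \<exists>n. f n x = 0"
  shows "tot (\<lambda>x. LEAST n. f n x = 0)"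
proof -
  from assms(1) obtain F where F: "\<And>n x. computes F [n, x] (f n x)"
    unfolding tot2_def by blast
  have "computes (Mu F) [x] (LEAST n. f n x = 0)" for x
  proof (rule computes.Mu)
    have "f (LEAST n. f n x = 0) x = 0" using LeastI_ex[OF assms(2)] .
    then show "computes F [LEAST n. f n x = 0, x] 0" using F by metis
    show "\<forall>m < (LEAST n. f n x = 0). \<exists>y. computes F [m, x] (Suc y)"
      using F not_less_Least by (metis not0_implies_Suc)
  qed
  then show ?thesis unfolding tot_def by blast
qed

text \<open>The code of (a, b) is \<open>triangle (a + b) + a\<close>, so the diagonal a + b is the
  least r with z below \<open>triangle (Suc r)\<close>. Truncated subtraction turns this inequality
  into an equation with 0, the form that minimisation can test.\<close>

lemma tot_psum: "tot (\<lambda>z. pfst z + psnd z)"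
proof -
  have eq: "(LEAST r. Suc z - triangle (Suc r) = 0) = pfst z + psnd z" for z
  proof -
    obtain a b where z: "z = prod_encode (a, b)" by (metis prod_decode_inverse surj_pair)
    have "(LEAST r. Suc z - triangle (Suc r) = 0) = a + b"
    proof (rule Least_equality)
      show "Suc z - triangle (Suc (a + b)) = 0" unfolding z prod_encode_def by simp
      fix r assume r: "Suc z - triangle (Suc r) = 0"
      show "a + b \<le> r"
      proof (rule ccontr)
        assume "\<not> a + b \<le> r"
        then have "triangle (Suc r) \<le> triangle (a + b)" by (intro triangle_mono) simp
        with r show False unfolding z prod_encode_def by simp
      qed
    qed
    with z show ?thesis by simp
  qed
  have "tot2 (\<lambda>r z. Suc z - triangle (Suc r))"
    by (intro tot2_comp2[OF tot2_diff] tot2_comp1[OF tot_Suc] tot2_comp1[OF tot_triangle]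
        tot2_fst tot2_snd)
  moreover have "\<exists>r. Suc z - triangle (Suc r) = 0" for z
    by (rule exI[of _ z]) (induction z, auto)
  ultimately have "tot (\<lambda>z. LEAST r. Suc z - triangle (Suc r) = 0)"
    by (rule tot_Mu)
  then show ?thesis unfolding eq .
qed

lemma tot_pfst: "tot pfst"
proof -
  have "z - triangle (pfst z + psnd z) = pfst z" for z
  proof -
    obtain a b where z: "z = prod_encode (a, b)" by (metis prod_decode_inverse surj_pair)
    have "z = triangle (a + b) + a" unfolding z prod_encode_def by simp
    moreover have "prod_decode z = (a, b)" unfolding z by simp
    ultimately show ?thesis by simp
  qed
  then show ?thesis
    using tot_comp2[OF tot2_diff tot_id tot_comp[OF tot_triangle tot_psum]] by simp
qed

lemma tot_psnd: "tot psnd"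
  using tot_comp2[OF tot2_diff tot_psum tot_pfst] by simp

section \<open>Closure rules for functions of one coded argument\<close>

named_theorems tot_intros

lemmas [tot_intros] = tot_id tot_const

lemma tot_pfst_comp [tot_intros]: "tot f \<Longrightarrow> tot (\<lambda>x. pfst (f x))"
  by (rule tot_comp[OF tot_pfst])

lemma tot_psnd_comp [tot_intros]: "tot f \<Longrightarrow> tot (\<lambda>x. psnd (f x))"
  by (rule tot_comp[OF tot_psnd])

lemma tot_Suc_comp [tot_intros]: "tot f \<Longrightarrow> tot (\<lambda>x. Suc (f x))"
  by (rule tot_comp[OF tot_Suc])

lemma tot_add_comp [tot_intros]: "tot f \<Longrightarrow> tot g \<Longrightarrow> tot (\<lambda>x. f x + g x)"
  by (rule tot_comp2[OF tot2_add])

lemma tot_mult_comp [tot_intros]: "tot f \<Longrightarrow> tot g \<Longrightarrow> tot (\<lambda>x. f x * g x)"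
  by (rule tot_comp2[OF tot2_mult])

lemma tot_diff_comp [tot_intros]: "tot f \<Longrightarrow> tot g \<Longrightarrow> tot (\<lambda>x. f x - g x)"
  by (rule tot_comp2[OF tot2_diff])

lemma tot_pair [tot_intros]: "tot f \<Longrightarrow> tot g \<Longrightarrow> tot (\<lambda>x. prod_encode (f x, g x))"
  by (rule tot_comp2[OF tot2_prod_encode])

text \<open>Reduces binary functions to unary ones on codes of pairs, so that the rules in
  \<open>tot_intros\<close> only have to treat unary functions.\<close>

lemma tot2_uncurry: "tot (\<lambda>z. f (pfst z) (psnd z)) \<Longrightarrow> tot2 f"
  using tot2_comp1[OF _ tot2_prod_encode, of "\<lambda>z. f (pfst z) (psnd z)"] by simp

lemma tot3_uncurry: "tot (\<lambda>z. f (pfst (pfst z)) (psnd (pfst z)) (psnd z)) \<Longrightarrow> tot3 f"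
  using tot3_comp1[OF _ tot3_comp2[OF tot2_prod_encode tot3_comp2[OF tot2_prod_encode tot3_1 tot3_2] tot3_3],
      of "\<lambda>z. f (pfst (pfst z)) (psnd (pfst z)) (psnd z)"] by simp

text \<open>The whole environment x is the parameter of the recursion; the step function sees
  counter, previous value and environment as the code of ((m, y), x).\<close>

lemma tot_rec [tot_intros]:
  assumes "tot n" "tot f" "tot (\<lambda>z. g (psnd z) (pfst (pfst z)) (psnd (pfst z)))"
  shows "tot (\<lambda>x. rec_nat (f x) (\<lambda>m y. g x m y) (n x))"
  using tot_comp2[OF tot2_rec[OF assms(2) tot3_uncurry[OF assms(3)]] assms(1) tot_id] .

section \<open>Decidable predicates\<close>

definition dec :: "(nat \<Rightarrow> bool) \<Rightarrow> bool" where
  "dec P \<longleftrightarrow> tot (\<lambda>x. of_bool (P x))"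

lemma dec_not [tot_intros]: "dec P \<Longrightarrow> dec (\<lambda>x. \<not> P x)"
proof -
  have "of_bool (\<not> P x) = 1 - (of_bool (P x) :: nat)" for x by simp
  then show "dec P \<Longrightarrow> dec (\<lambda>x. \<not> P x)"
    unfolding dec_def by (simp only:) (intro tot_intros)
qed

lemma dec_conj [tot_intros]: "dec P \<Longrightarrow> dec Q \<Longrightarrow> dec (\<lambda>x. P x \<and> Q x)"
  unfolding dec_def of_bool_conj by (intro tot_intros)

lemma dec_imp [tot_intros]: "dec P \<Longrightarrow> dec Q \<Longrightarrow> dec (\<lambda>x. P x \<longrightarrow> Q x)"
  using dec_not[OF dec_conj[OF _ dec_not], of P Q] by simp

lemma dec_disj [tot_intros]: "dec P \<Longrightarrow> dec Q \<Longrightarrow> dec (\<lambda>x. P x \<or> Q x)"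
  using dec_not[OF dec_conj[OF dec_not dec_not], of P Q] by simp

lemma dec_le [tot_intros]: "tot f \<Longrightarrow> tot g \<Longrightarrow> dec (\<lambda>x. f x \<le> g x)"
proof -
  have "of_bool (f x \<le> g x) = 1 - (f x - g x)" for x by auto
  then show "tot f \<Longrightarrow> tot g \<Longrightarrow> dec (\<lambda>x. f x \<le> g x)"
    unfolding dec_def by (simp only:) (intro tot_intros)
qed

lemma dec_eq [tot_intros]: "tot f \<Longrightarrow> tot g \<Longrightarrow> dec (\<lambda>x. f x = g x)"
  using dec_conj[OF dec_le dec_le, of f g g f] by (simp add: eq_iff)

lemma tot_if [tot_intros]:
  assumes "dec P" "tot f" "tot g" shows "tot (\<lambda>x. if P x then f x else g x)"
proof -
  have eq: "(if P x then f x else g x) = of_bool (P x) * f x + of_bool (\<not> P x) * g x" for x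
    by simp
  have "tot (\<lambda>x. of_bool (P x))" "tot (\<lambda>x. of_bool (\<not> P x))"
    using assms dec_not unfolding dec_def by blast+
  then show ?thesis unfolding eq by (intro tot_intros assms)
qed

text \<open>The argument codes the environment of a formula: under a quantifier, the bound variable is its
  first component and the enclosing environment the second.\<close>

lemma dec_all_less [tot_intros]:
  assumes "tot n" "dec (\<lambda>z. P (psnd z) (pfst z))"
  shows "dec (\<lambda>x. \<forall>m<n x. P x m)"
proof -
  have eq: "of_bool (\<forall>m<n x. P x m) = rec_nat 1 (\<lambda>m y. if P x m then y else 0) (n x)" for x
  proof (induction "n x" arbitrary: n)
    case (Suc k)
    from Suc(1)[of "\<lambda>_. k"] show ?case unfolding Suc(2)[symmetric]
      by (auto simp: less_Suc_eq)
  qed simp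
  have d: "tot (\<lambda>x. of_bool (P (psnd x) (pfst x)))" using assms(2) unfolding dec_def .
  have d2: "dec (\<lambda>z. P (psnd z) (pfst (pfst z)))"
    unfolding dec_def
    by (rule tot_subst[OF d, of "\<lambda>z. prod_encode (pfst (pfst z), psnd z)"]) (intro tot_intros, simp)
  show ?thesis unfolding dec_def eq
    by (intro tot_intros assms d2)
qed

lemma dec_ex_less [tot_intros]:
  assumes "tot n" "dec (\<lambda>z. P (psnd z) (pfst z))"
  shows "dec (\<lambda>x. \<exists>m<n x. P x m)"
  using dec_not[OF dec_all_less[OF assms(1) dec_not[OF assms(2)]]] by simp

text \<open>Rests on \<open>Suc m div 2 = m - m div 2\<close>, which makes halving a recursion
  without case distinction.\<close>

lemma rec_half: "rec_nat 0 (\<lambda>m y. m - y) n = n div 2"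
  by (induction n) auto

lemma tot_half [tot_intros]: "tot f \<Longrightarrow> tot (\<lambda>x. f x div 2)"
  unfolding rec_half[symmetric] by (intro tot_intros)

lemma dec_odd [tot_intros]:
  assumes "tot f" shows "dec (\<lambda>x. odd (f x))"
proof -
  have eq: "odd n \<longleftrightarrow> n \<noteq> n div 2 + n div 2" for n :: nat by presburger
  show ?thesis unfolding eq by (intro tot_intros assms)
qed

lemma rec_div_power: "rec_nat n (\<lambda>m y. y div 2) k = n div 2 ^ k" for n :: nat
  by (induction k) (simp_all flip: div_mult2_eq, simp add: mult.commute)

lemma dec_mem [tot_intros]: "tot f \<Longrightarrow> tot g \<Longrightarrow> dec (\<lambda>x. f x \<in> set_decode (g x))"
  unfolding set_decode_def mem_Collect_eq rec_div_power[symmetric] by (intro tot_intros)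

text \<open>Turns quantifiers over the elements of a coded set into bounded ones, which are
  decidable.\<close>

lemma mem_set_decode_less: "x \<in> set_decode n \<Longrightarrow> x < n"
proof -
  assume "x \<in> set_decode n"
  then have "n div 2 ^ x \<noteq> 0" unfolding set_decode_def by (auto intro: ccontr)
  then have "2 ^ x \<le> n" by (simp add: div_eq_0_iff)
  then show "x < n" by (rule less_le_trans[OF less_exp])
qed

lemma dec_all_mem [tot_intros]:
  assumes "tot n" "dec (\<lambda>z. P (psnd z) (pfst z))"
  shows "dec (\<lambda>x. \<forall>m\<in>set_decode (n x). P x m)"
proof -
  have eq: "(\<forall>m\<in>set_decode (n x). P x m) \<longleftrightarrow> (\<forall>m<n x. m \<in> set_decode (n x) \<longrightarrow> P x m)" for x
    using mem_set_decode_less by blast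
  show ?thesis unfolding eq by (intro tot_intros assms tot_comp[OF assms(1) tot_psnd])
qed

lemma dec_ex_mem [tot_intros]:
  assumes "tot n" "dec (\<lambda>z. P (psnd z) (pfst z))"
  shows "dec (\<lambda>x. \<exists>m\<in>set_decode (n x). P x m)"
  using dec_not[OF dec_all_mem[OF assms(1) dec_not[OF assms(2)]]] by simp

section \<open>Functions on coded lists\<close>

lemma tot_list_encode_Nil [tot_intros]: "tot (\<lambda>x. list_encode [])"
  by (rule tot_const)

lemma tot_list_encode_Cons [tot_intros]:
  "tot f \<Longrightarrow> tot (\<lambda>x. list_encode (g x)) \<Longrightarrow> tot (\<lambda>x. list_encode (f x # g x))"
  by (simp, intro tot_intros)

text \<open>The state s is the pair of the code of the remaining list and the accumulator. The empty
  list has code 0, and there the state is a fixed point, so iterating too often does no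
  harm.\<close>

definition fold_step :: "(nat \<Rightarrow> nat \<Rightarrow> nat) \<Rightarrow> nat \<Rightarrow> nat" where
  "fold_step f s = (if pfst s = 0 then s
     else prod_encode (psnd (pfst s - 1), f (pfst (pfst s - 1)) (psnd s)))"

lemma fold_step_Nil: "rec_nat (prod_encode (0, a)) (\<lambda>m. fold_step f) n = prod_encode (0, a)"
  by (induction n) (auto simp: fold_step_def)

lemma rec_nat_step_shift:
  "rec_nat (h a) (\<lambda>m. h) n = h (rec_nat a (\<lambda>m. h) n)"
  by (induction n) auto

lemma length_le_list_encode: "length xs \<le> list_encode xs"
  by (induction xs) (auto intro: le_trans le_prod_encode_2)

lemma fold_step_list:
  "length xs \<le> n \<Longrightarrow> psnd (rec_nat (prod_encode (list_encode xs, a)) (\<lambda>m. fold_step f) n) = fold f xs a"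
proof (induction xs arbitrary: a n)
  case Nil
  then show ?case using fold_step_Nil by simp
next
  case (Cons x xs)
  then obtain m where n: "n = Suc m" by (cases n) auto
  have "rec_nat (prod_encode (list_encode (x # xs), a)) (\<lambda>m. fold_step f) n
      = rec_nat (fold_step f (prod_encode (list_encode (x # xs), a))) (\<lambda>m. fold_step f) m"
    unfolding n rec_nat_step_shift by simp
  also have "fold_step f (prod_encode (list_encode (x # xs), a)) = prod_encode (list_encode xs, f x a)"
    by (simp add: fold_step_def)
  finally show ?case using Cons n by simp
qed

text \<open>A list is no longer than its code, so iterating \<open>fold_step\<close> as often as the
  code says exhausts the list.\<close>

lemma tot_fold [tot_intros]:
  assumes "tot l" "tot a" "tot (\<lambda>z. f (psnd z) (pfst (pfst z)) (psnd (pfst z)))"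
  shows "tot (\<lambda>x. fold (f x) (list_decode (l x)) (a x))"
proof -
  have eq: "fold (f x) (list_decode (l x)) (a x) =
     psnd (rec_nat (prod_encode (l x, a x)) (\<lambda>m y. fold_step (f x) y) (l x))" for x
    using fold_step_list[of "list_decode (l x)" "l x" "a x" "f x"]
      length_le_list_encode[of "list_decode (l x)"] by simp
  have d2: "tot (\<lambda>z. f (psnd z) (pfst (pfst (psnd (pfst z)) - 1)) (psnd (psnd (pfst z))))"
    by (rule tot_subst[OF assms(3), of "\<lambda>z. prod_encode (prod_encode (pfst (pfst (psnd (pfst z)) - 1), psnd (psnd (pfst z))), psnd z)"]) (intro tot_intros, simp)
  show ?thesis unfolding eq fold_step_def by (intro tot_intros assms d2)
qed

lemma dec_all_list [tot_intros]:
  assumes "tot l" "dec (\<lambda>z. P (psnd z) (pfst z))"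
  shows "dec (\<lambda>x. \<forall>y\<in>set (list_decode (l x)). P x y)"
proof -
  have "fold (\<lambda>y b. if P x y then b else 0) ys b = (if \<forall>y\<in>set ys. P x y then b else 0)" for x ys and b :: nat
    by (induction ys arbitrary: b) auto
  then have eq: "of_bool (\<forall>y\<in>set (list_decode (l x)). P x y) =
      fold (\<lambda>y b. if P x y then b else 0) (list_decode (l x)) (1::nat)" for x by simp
  have d2: "dec (\<lambda>z. P (psnd z) (pfst (pfst z)))"
    unfolding dec_def by (rule tot_subst[OF assms(2)[unfolded dec_def], of "\<lambda>z. prod_encode (pfst (pfst z), psnd z)"]) (intro tot_intros, simp)
  show ?thesis unfolding dec_def eq by (intro tot_intros assms d2)
qed

lemma dec_ex_list [tot_intros]:
  assumes "tot l" "dec (\<lambda>z. P (psnd z) (pfst z))"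
  shows "dec (\<lambda>x. \<exists>y\<in>set (list_decode (l x)). P x y)"
  using dec_not[OF dec_all_list[OF assms(1) dec_not[OF assms(2)]]] by simp

definition code_append :: "nat \<Rightarrow> nat \<Rightarrow> nat" where
  "code_append m n = list_encode (list_decode m @ list_decode n)"

lemma fold_code_Cons:
  "fold (\<lambda>x y. Suc (prod_encode (x, y))) xs (list_encode ys) = list_encode (rev xs @ ys)"
  by (induction xs arbitrary: ys) (simp_all flip: list_encode.simps(2))

text \<open>Folding with the code of cons reverses; so the first list is reversed once and then
  folded onto the second.\<close>

lemma tot_code_append [tot_intros]:
  assumes "tot f" "tot g" shows "tot (\<lambda>x. code_append (f x) (g x))"
proof -
  have eq: "code_append m n = fold (\<lambda>x y. Suc (prod_encode (x, y)))
     (list_decode (fold (\<lambda>x y. Suc (prod_encode (x, y))) (list_decode m) 0)) n" for m n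
    using fold_code_Cons[of "list_decode m" "[]"] fold_code_Cons[of "rev (list_decode m)" "list_decode n"]
    by (simp add: code_append_def)
  show ?thesis unfolding eq by (intro tot_intros assms)
qed

text \<open>Minimisation followed by the total function f. The search converges wherever a witness
  exists, so no bound on w has to be computed.\<close>

lemma search_recf:
  assumes "dec (\<lambda>z. P (pfst z) (psnd z))" "tot f"
  shows "\<exists>F. \<forall>x. (\<exists>w. P w x) \<longrightarrow> computes F [x] (f (LEAST w. P w x))"
proof -
  have "tot2 (\<lambda>w x. of_bool (\<not> P w x))"
    by (rule tot2_uncurry) (rule dec_not[OF assms(1), unfolded dec_def])
  then obtain G where G: "\<And>w x. computes G [w, x] (of_bool (\<not> P w x))"
    unfolding tot2_def by blast
  from assms(2) obtain H where H: "\<And>x. computes H [x] (f x)" unfolding tot_def by blast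
  have "computes (Mu G) [x] (LEAST w. P w x)" if "\<exists>w. P w x" for x
  proof (rule computes.Mu)
    have "P (LEAST w. P w x) x" using that by (rule LeastI_ex)
    then show "computes G [LEAST w. P w x, x] 0" using G[of "LEAST w. P w x" x] by simp
    show "\<forall>m < (LEAST w. P w x). \<exists>y. computes G [m, x] (Suc y)"
    proof (intro allI impI)
      fix m assume "m < (LEAST w. P w x)"
      then have "\<not> P m x" by (rule not_less_Least)
      then show "\<exists>y. computes G [m, x] (Suc y)" using G[of m x] by auto
    qed
  qed
  then have "\<forall>x. (\<exists>w. P w x) \<longrightarrow> computes (Comp H [Mu G]) [x] (f (LEAST w. P w x))"
    using H by (auto intro!: computes.Comp[where ys = "[LEAST w. P w _]"])
  then show ?thesis by blast
qed

section \<open>Languages with finitely many left quotients\<close>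

definition lq :: "'x list \<Rightarrow> 'x list set \<Rightarrow> 'x list set" where
  "lq w L = {v. w @ v \<in> L}"

text \<open>The criterion of Myhill and Nerode, with the left quotients as the states of an
  automaton. It makes sense over an infinite alphabet, which is essential here: annotations are
  arbitrary natural numbers.\<close>

definition reg :: "'x list set \<Rightarrow> bool" where
  "reg L \<longleftrightarrow> finite (range (\<lambda>w. lq w L))"

lemma mem_lq [simp]: "v \<in> lq w L \<longleftrightarrow> w @ v \<in> L"
  by (simp add: lq_def)

lemma lq_append: "lq (u @ v) L = lq v (lq u L)"
  by (auto simp: lq_def)

text \<open>The value \<open>f w\<close> plays the role of the state reached after w: it determines
  the quotient by w, so there are no more quotients than values.\<close>

lemma reg_stateI:
  assumes "finite (range f)" and "\<And>w w' v. f w = f w' \<Longrightarrow> w @ v \<in> L \<Longrightarrow> w' @ v \<in> L"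
  shows "reg L"
proof -
  have "lq w L = lq (inv f (f w)) L" for w
    using assms(2)[of w "inv f (f w)"] assms(2)[of "inv f (f w)" w] by (auto simp: f_inv_into_f)
  then have "range (\<lambda>w. lq w L) \<subseteq> (\<lambda>s. lq (inv f s) L) ` range f" by blast
  then show ?thesis unfolding reg_def by (rule finite_surj[OF assms(1)])
qed

text \<open>Every quotient is the union of the members of F that it contains, so there are only
  finitely many. This is the subset construction, with F in place of the states of a
  nondeterministic automaton.\<close>

lemma reg_coverI:
  assumes "finite F" and "\<And>w v. w @ v \<in> L \<Longrightarrow> \<exists>X\<in>F. v \<in> X \<and> (\<forall>v'\<in>X. w @ v' \<in> L)"
  shows "reg L"
proof (rule reg_stateI)
  let ?f = "\<lambda>w. {X \<in> F. X \<subseteq> lq w L}"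
  show "finite (range ?f)"
    by (rule finite_subset[of _ "Pow F"]) (use assms(1) in auto)
  show "w' @ v \<in> L" if "?f w = ?f w'" "w @ v \<in> L" for w w' v
  proof -
    from assms(2)[OF that(2)] obtain X where "X \<in> F" "v \<in> X" "X \<subseteq> lq w L" unfolding lq_def by blast
    then have "X \<in> ?f w'" using that(1) by blast
    then show ?thesis using \<open>v \<in> X\<close> by auto
  qed
qed

lemma reg_Compl: "reg L \<Longrightarrow> reg (- L)"
proof -
  assume "reg L"
  have "range (\<lambda>w. lq w (- L)) = uminus ` range (\<lambda>w. lq w L)"
    by (auto simp: lq_def)
  with \<open>reg L\<close> show ?thesis unfolding reg_def by simp
qed

lemma reg_Int: "reg L \<Longrightarrow> reg M \<Longrightarrow> reg (L \<inter> M)"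
proof -
  assume a: "reg L" "reg M"
  have "range (\<lambda>w. lq w (L \<inter> M)) \<subseteq> (\<lambda>(X, Y). X \<inter> Y) ` (range (\<lambda>w. lq w L) \<times> range (\<lambda>w. lq w M))"
    by (auto simp: lq_def)
  with a show ?thesis unfolding reg_def by (meson finite_SigmaI finite_surj)
qed

lemma reg_UNIV: "reg UNIV"
  by (rule reg_stateI[of "\<lambda>_. ()"]) auto

lemma reg_INT: "finite J \<Longrightarrow> (\<And>j. j \<in> J \<Longrightarrow> reg (L j)) \<Longrightarrow> reg (\<Inter>j\<in>J. L j)"
  by (induction J rule: finite_induct) (auto intro: reg_Int reg_UNIV)

lemma reg_Cons: "reg L \<Longrightarrow> reg ((#) a ` L)"
proof -
  assume "reg L"
  have "lq w ((#) a ` L) \<in> {(#) a ` L, {}} \<union> range (\<lambda>w. lq w L)" for w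
  proof (cases w)
    case Nil
    then show ?thesis by (auto simp: lq_def)
  next
    case (Cons b w')
    then have "lq w ((#) a ` L) = (if a = b then lq w' L else {})" by (auto simp: lq_def)
    then show ?thesis by auto
  qed
  then have "range (\<lambda>w. lq w ((#) a ` L)) \<subseteq> {(#) a ` L, {}} \<union> range (\<lambda>w. lq w L)" by blast
  with \<open>reg L\<close> show ?thesis unfolding reg_def by (meson finite_UnI finite.intros finite_subset)
qed

section \<open>Images and inverse images under morphisms\<close>

definition hom :: "('x \<Rightarrow> 'y list) \<Rightarrow> 'x list \<Rightarrow> 'y list" where
  "hom h w = concat (map h w)"

lemma hom_simps [simp]:
  "hom h [] = []" "hom h (a # w) = h a @ hom h w" "hom h (u @ v) = hom h u @ hom h v"
  by (simp_all add: hom_def)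

lemma hom_hom: "hom h (hom g w) = hom (\<lambda>a. hom h (g a)) w"
  by (induction w) auto

lemma hom_map: "hom h (map f w) = hom (\<lambda>a. h (f a)) w"
  by (induction w) auto

lemma map_hom: "map f (hom h w) = hom (\<lambda>a. map f (h a)) w"
  by (induction w) auto

lemma hom_singleton: "hom (\<lambda>a. [f a]) w = map f w"
  by (induction w) auto

lemma hom_concat: "hom h (concat ws) = concat (map (hom h) ws)"
  by (induction ws) auto

lemma hom_cong: "(\<And>a. a \<in> set w \<Longrightarrow> h a = g a) \<Longrightarrow> hom h w = hom g w"
  by (induction w) auto

lemma reg_vimage:
  assumes "reg L" shows "reg {w. hom h w \<in> L}"
proof (rule reg_stateI[of "\<lambda>w. lq (hom h w) L"])
  show "finite (range (\<lambda>w. lq (hom h w) L))"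
    by (rule finite_subset[OF _ assms[unfolded reg_def]]) auto
  show "w' @ v \<in> {w. hom h w \<in> L}" if "lq (hom h w) L = lq (hom h w') L" "w @ v \<in> {w. hom h w \<in> L}" for w w' v
  proof -
    have "hom h v \<in> lq (hom h w) L" using that(2) by simp
    then show ?thesis unfolding that(1) by simp
  qed
qed

text \<open>A factorisation of an image cuts the image of at most one letter, and r is the rest of
  that image after the cut. That s is nonempty excludes the rest equal to the whole image;
  \<open>reg_image_alphabetic\<close> relies on this.\<close>

lemma hom_eq_append:
  assumes "hom h c = w @ v"
  shows "\<exists>c1 c2 r. c = c1 @ c2 \<and> hom h c1 = w @ r \<and> v = r @ hom h c2 \<and>
    (r = [] \<or> (\<exists>g\<in>set c. \<exists>s. s \<noteq> [] \<and> h g = s @ r))"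
  using assms
proof (induction c arbitrary: w)
  case Nil
  then show ?case by (intro exI[of _ "[]"]) simp
next
  case (Cons g c)
  show ?case
  proof (cases "w = []")
    case True
    then show ?thesis using Cons.prems by (intro exI[of _ "[]"] exI[of _ "g # c"]) simp
  next
    case False
    from Cons.prems have "h g @ hom h c = w @ v" by simp
    then consider (1) us where "h g = w @ us" "us @ hom h c = v"
      | (2) us where "h g @ us = w" "hom h c = us @ v"
      unfolding append_eq_append_conv2 by blast
    then show ?thesis
    proof cases
      case 1
      then show ?thesis using False
        by (intro exI[of _ "[g]"] exI[of _ c] exI[of _ us]) auto
    next
      case 2
      from Cons.IH[OF 2(2)] obtain c1 c2 r where c: "c = c1 @ c2" "hom h c1 = us @ r"
        "v = r @ hom h c2" and r: "r = [] \<or> (\<exists>g\<in>set c. \<exists>s. s \<noteq> [] \<and> h g = s @ r)" by blast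
      show ?thesis
      proof (intro exI conjI)
        show "g # c = (g # c1) @ c2" using c by simp
        show "hom h (g # c1) = w @ r" using c 2 by simp
        show "v = r @ hom h c2" by fact
        show "r = [] \<or> (\<exists>g\<in>set (g # c). \<exists>s. s \<noteq> [] \<and> h g = s @ r)" using r by auto
      qed
    qed
  qed
qed

text \<open>A quotient of the image is covered by sets made of a rest r followed by the image of a
  quotient of L. Finiteness of the set of rests is all that is required of the letters.\<close>

lemma reg_image:
  assumes "reg L" "L \<subseteq> lists \<Gamma>" "finite {r. \<exists>g\<in>\<Gamma>. \<exists>s. s \<noteq> [] \<and> h g = s @ r}"
  shows "reg (hom h ` L)"
proof (rule reg_coverI)
  let ?R = "insert [] {r. \<exists>g\<in>\<Gamma>. \<exists>s. s \<noteq> [] \<and> h g = s @ r}"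
  let ?F = "(\<lambda>(r, D). (@) r ` hom h ` D) ` (?R \<times> range (\<lambda>w. lq w L))"
  show "finite ?F" using assms(1,3) unfolding reg_def by simp
  fix w v assume "w @ v \<in> hom h ` L"
  then obtain c where c: "c \<in> L" "hom h c = w @ v" by auto
  from hom_eq_append[OF c(2)] obtain c1 c2 r where s: "c = c1 @ c2" "hom h c1 = w @ r"
    "v = r @ hom h c2" "r = [] \<or> (\<exists>g\<in>set c. \<exists>s. s \<noteq> [] \<and> h g = s @ r)" by blast
  let ?X = "(@) r ` hom h ` lq c1 L"
  have "r \<in> ?R" using s(4) c(1) assms(2) by (auto simp: lists_eq_set)
  then have "?X \<in> ?F" by auto
  moreover have "v \<in> ?X" using s c by auto
  moreover have "w @ v' \<in> hom h ` L" if v': "v' \<in> ?X" for v'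
  proof -
    from v' obtain c3 where c3: "v' = r @ hom h c3" "c1 @ c3 \<in> L" by auto
    have "w @ v' = hom h (c1 @ c3)" using c3 s(2) by (metis append_assoc hom_simps(3))
    then show ?thesis using c3 by blast
  qed
  ultimately show "\<exists>X\<in>?F. v \<in> X \<and> (\<forall>v'\<in>X. w @ v' \<in> hom h ` L)"
    by (intro bexI[of _ ?X] conjI ballI)
qed

text \<open>The letter type may be infinite: an image of length at most one leaves no rest behind a
  nonempty part.\<close>

lemma reg_image_alphabetic:
  assumes "reg L" "\<And>a. length (h a) \<le> 1"
  shows "reg (hom h ` L)"
proof (rule reg_image[OF assms(1), of UNIV])
  have "r = []" if "h g = s @ r" "s \<noteq> []" for g s r
    using that assms(2)[of g] by (cases s; cases r) auto
  then have "{r. \<exists>g\<in>UNIV. \<exists>s. s \<noteq> [] \<and> h g = s @ r} \<subseteq> {[]}" by blast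
  then show "finite {r. \<exists>g\<in>UNIV. \<exists>s. s \<noteq> [] \<and> h g = s @ r}" by (rule finite_subset) simp
qed simp

lemma reg_image_map: "reg L \<Longrightarrow> reg (map f ` L)"
  using reg_image_alphabetic[of L "\<lambda>a. [f a]"] by (simp add: hom_singleton)

lemma reg_vimage_map: "reg L \<Longrightarrow> reg {w. map f w \<in> L}"
  using reg_vimage[of L "\<lambda>a. [f a]"] by (simp add: hom_singleton)


section \<open>Delays\<close>

text \<open>The delay of two words: the pair (a, b) for which \<open>a^{-1} b\<close> is the reduced
  form of \<open>x^{-1} y\<close> in the free group.\<close>

fun lag :: "'x list \<Rightarrow> 'x list \<Rightarrow> 'x list \<times> 'x list" where
  "lag (x # xs) (y # ys) = (if x = y then lag xs ys else (x # xs, y # ys))"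
| "lag xs ys = (xs, ys)"

lemma lag_Nil2 [simp]: "lag xs [] = (xs, [])"
  by (cases xs) auto

lemma lag_append_same [simp]: "lag (z @ x) (z @ y) = lag x y"
  by (induction z) auto

lemma lag_decomp: "\<exists>z. x = z @ fst (lag x y) \<and> y = z @ snd (lag x y)"
proof (induction x y rule: lag.induct)
  case (1 x xs y ys)
  show ?case
  proof (cases "x = y")
    case True
    with 1 obtain z where "xs = z @ fst (lag xs ys)" "ys = z @ snd (lag xs ys)" by blast
    with True show ?thesis by (intro exI[of _ "x # z"]) simp
  qed (auto intro: exI[of _ "[]"])
qed auto

text \<open>This is what lets the delay serve as the state of an automaton that reads two outputs in
  parallel.\<close>

lemma lag_append: "lag (x @ a) (y @ b) = lag (fst (lag x y) @ a) (snd (lag x y) @ b)"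
  by (metis append_assoc lag_append_same lag_decomp)

lemma lag_eq_Nil: "lag x y = ([], []) \<longleftrightarrow> x = y"
  by (metis append_Nil2 lag_append_same lag_Nil2 lag_decomp fst_conv snd_conv)

lemma lag_one_Nil: "a = [] \<or> b = [] \<Longrightarrow> lag a b = (a, b)"
  by (cases a; cases b) auto

text \<open>One of x and y is a prefix of the other, so the delay can be read off the completions w
  and w' alone. Truncated subtraction makes one of the two components empty.\<close>

lemma lag_of_common_completion:
  assumes "x @ w = y @ w'"
  shows "lag x y = (take (length w' - length w) w', take (length w - length w') w)"
proof -
  from assms consider (1) us where "x = y @ us" "us @ w = w'" | (2) us where "x @ us = y" "w = us @ w'"
    unfolding append_eq_append_conv2 by blast
  then show ?thesis
  proof cases
    case 1
    then show ?thesis using lag_append_same[of y us "[]"] by auto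
  next
    case 2
    then show ?thesis using lag_append_same[of x "[]" us] by auto
  qed
qed

text \<open>The state is the current delay as long as all delays so far lie in the finite set, and
  the sink \<open>None\<close> afterwards.\<close>

lemma reg_bounded_lag:
  assumes "finite \<L>"
  shows "reg {w. hom f w = hom g w \<and> (\<forall>w1. prefix w1 w \<longrightarrow> lag (hom f w1) (hom g w1) \<in> \<L>)}"
    (is "reg ?L")
proof -
  let ?ok = "\<lambda>w. \<forall>w1. prefix w1 w \<longrightarrow> lag (hom f w1) (hom g w1) \<in> \<L>"
  let ?s = "\<lambda>w. if ?ok w then Some (lag (hom f w) (hom g w)) else None"
  have ok_append: "?ok (w @ v) \<longleftrightarrow> ?ok w \<and>
      (\<forall>v1. prefix v1 v \<longrightarrow> lag (hom f (w @ v1)) (hom g (w @ v1)) \<in> \<L>)" for w v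
    unfolding prefix_append by blast
  show ?thesis
  proof (rule reg_stateI)
    have "range ?s \<subseteq> insert None (Some ` \<L>)" by (rule image_subsetI) simp
    then show "finite (range ?s)" by (rule finite_subset) (use assms in simp)
    show "w' @ v \<in> ?L" if s: "?s w = ?s w'" and "w @ v \<in> ?L" for w w' v
    proof -
      have w: "hom f (w @ v) = hom g (w @ v)" "?ok (w @ v)" using that(2) by simp_all
      from w(2) have okw: "?ok w" unfolding ok_append by (rule conjunct1)
      then have sw: "?s w = Some (lag (hom f w) (hom g w))" by (rule if_P)
      have w': "?ok w'"
      proof (rule ccontr)
        assume "\<not> ?ok w'"
        then have "?s w' = None" by (rule if_not_P)
        with s sw have "None = Some (lag (hom f w) (hom g w))" by (simp only:)
        then show False by simp
      qed
      then have "?s w' = Some (lag (hom f w') (hom g w'))" by (rule if_P)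
      with s sw have lag: "lag (hom f w) (hom g w) = lag (hom f w') (hom g w')" by (metis option.inject)
      have eq: "lag (hom f (w @ v1)) (hom g (w @ v1)) = lag (hom f (w' @ v1)) (hom g (w' @ v1))" for v1
        unfolding hom_simps lag_append[of "hom f w"] lag_append[of "hom f w'"] lag ..
      have "?ok (w' @ v)" using w(2) w' unfolding ok_append eq by blast
      moreover have "hom f (w' @ v) = hom g (w' @ v)" using w(1) eq[of v] by (metis lag_eq_Nil)
      ultimately show ?thesis by simp
    qed
  qed
qed


section \<open>Uniformisation\<close>

text \<open>Two bits form the state: whether a first difference satisfying R has been seen, and
  whether the two projections still agree. When both are false the word is lost.\<close>

lemma reg_first_difference:
  "reg {z. \<exists>z1 e z2. z = z1 @ e # z2 \<and> map f z1 = map g z1 \<and> R (f e) (g e)}" (is "reg ?L")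
proof (rule reg_stateI[of "\<lambda>z. (z \<in> ?L, map f z = map g z)"])
  show "finite (range (\<lambda>z. (z \<in> ?L, map f z = map g z)))" by (rule finite_subset[of _ UNIV]) auto
  have split: "w @ v \<in> ?L \<longleftrightarrow> w \<in> ?L \<or> map f w = map g w \<and> v \<in> ?L" for w v
  proof
    assume "w @ v \<in> ?L"
    then obtain z1 e z2 where z: "w @ v = z1 @ e # z2" "map f z1 = map g z1" "R (f e) (g e)" by blast
    from z(1) consider (1) us where "w = z1 @ us" "us @ v = e # z2" | (2) us where "w @ us = z1" "v = us @ e # z2"
      unfolding append_eq_append_conv2 by blast
    then show "w \<in> ?L \<or> map f w = map g w \<and> v \<in> ?L"
    proof cases
      case 1
      then show ?thesis
      proof (cases us)
        case Nil
        then show ?thesis using 1 z by (auto intro!: exI[of _ "[]"])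
      next
        case (Cons x xs)
        then have "w = z1 @ e # xs" using 1 by simp
        then have "w \<in> ?L" using z(2,3) by blast
        then show ?thesis ..
      qed
    next
      case 2
      then have "map f w = map g w" "map f us = map g us" using z(2) by auto
      then show ?thesis using 2 z by blast
    qed
  next
    assume "w \<in> ?L \<or> map f w = map g w \<and> v \<in> ?L"
    then show "w @ v \<in> ?L"
    proof
      assume "w \<in> ?L"
      then show ?thesis by (smt (verit) append_Cons append_assoc mem_Collect_eq)
    next
      assume "map f w = map g w \<and> v \<in> ?L"
      then obtain z1 e z2 where "v = z1 @ e # z2" "map f z1 = map g z1" "R (f e) (g e)"
        "map f w = map g w" by blast
      then show ?thesis by (auto intro!: exI[of _ "w @ z1"])
    qed
  qed
  show "w' @ v \<in> ?L"
    if "(w \<in> ?L, map f w = map g w) = (w' \<in> ?L, map f w' = map g w')" "w @ v \<in> ?L" for w w' v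
    using that(2) unfolding split using that(1) by blast
qed

definition lexless :: "nat list \<Rightarrow> nat list \<Rightarrow> bool" where
  "lexless xs ys \<longleftrightarrow> (\<exists>zs x xs' y ys'. xs = zs @ x # xs' \<and> ys = zs @ y # ys' \<and> x < y)"

text \<open>The set X may be infinite, because annotations are unbounded; a minimal element comes
  from well-foundedness of the lexicographic order on lists of equal length.\<close>

lemma lexless_least:
  assumes "X \<noteq> {}" "\<And>xs. xs \<in> X \<Longrightarrow> length xs = n"
  shows "\<exists>xs\<in>X. \<forall>ys\<in>X. \<not> lexless ys xs"
proof -
  obtain xs where xs: "xs \<in> X" "\<And>ys. (ys, xs) \<in> lex less_than \<Longrightarrow> ys \<notin> X"
    using wfE_min[OF wf_lex[OF wf_less_than]] assms(1) by (metis all_not_in_conv)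
  have "\<not> lexless ys xs" if "ys \<in> X" for ys
  proof
    assume "lexless ys xs"
    moreover have "length ys = length xs" using assms(2) xs(1) that by simp
    ultimately have "(ys, xs) \<in> lex less_than"
      unfolding lexless_def lex_conv by (auto 0 4)
    then show False using xs(2) that by blast
  qed
  with xs(1) show ?thesis by blast
qed

lemma lexless_total:
  "length xs = length ys \<Longrightarrow> lexless xs ys \<or> xs = ys \<or> lexless ys xs"
proof (induction xs ys rule: list_induct2)
  case (Cons x xs y ys)
  have C: "lexless (z # as) (z # bs)" if "lexless as bs" for z as bs
    using that unfolding lexless_def by (metis append_Cons)
  have L: "lexless (a # as) (b # bs)" if "a < b" for a b as bs
    using that unfolding lexless_def by (metis append_Nil)
  show ?case using Cons.IH C L by (metis linorder_neqE_nat)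
qed simp

text \<open>A third track holds a competitor over the same input. The three-track words whose
  competitor is in L and lexicographically smaller form a regular set; projecting the competitor
  away gives the words of L that are not minimal, and these are removed.\<close>

lemma reg_uniformisation:
  fixes L :: "('a \<times> nat) list set"
  assumes "reg L"
  shows "\<exists>L'\<subseteq>L. reg L' \<and> (\<forall>d\<in>L'. \<forall>d'\<in>L'. map fst d = map fst d' \<longrightarrow> d = d') \<and>
    (\<forall>d\<in>L. \<exists>d'\<in>L'. map fst d' = map fst d)"
proof (intro exI conjI ballI impI)
  let ?f = "\<lambda>(a, n, m). (a, n)" and ?g = "\<lambda>(a, n, m). (a, m)"
  let ?D = "{z. \<exists>z1 e z2. z = z1 @ e # z2 \<and> map (\<lambda>(a, n, m). n) z1 = map (\<lambda>(a, n, m). m) z1 \<and>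
     (\<lambda>(a, n, m). n) e < (\<lambda>(a, n, m). m) e}"
  let ?P = "{z. map ?f z \<in> L} \<inter> {z. map ?g z \<in> L} \<inter> ?D"
  let ?M = "L \<inter> - map ?g ` ?P"
  show "?M \<subseteq> L" by simp
  show "reg ?M"
    by (intro reg_Int reg_Compl reg_image_map assms reg_vimage_map reg_first_difference[where R = "(<)"])
  have M: "d \<in> ?M \<longleftrightarrow> d \<in> L \<and> (\<forall>d'\<in>L. map fst d' = map fst d \<longrightarrow> \<not> lexless (map snd d') (map snd d))" for d
  proof -
    have "d \<in> map ?g ` ?P \<longleftrightarrow> (\<exists>d'\<in>L. d \<in> L \<and> map fst d' = map fst d \<and> lexless (map snd d') (map snd d))"
    proof
      assume "d \<in> map ?g ` ?P"
      then obtain z where z: "map ?f z \<in> L" "z \<in> ?D" "d = map ?g z" "d \<in> L" by blast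
      from z(2) obtain z1 e z2 where e: "z = z1 @ e # z2"
        "map (\<lambda>(a, n, m). n) z1 = map (\<lambda>(a, n, m). m) z1" "(\<lambda>(a, n, m). n) e < (\<lambda>(a, n, m). m) e" by blast
      have "map snd (map ?f z) = map (\<lambda>(a, n, m). n) z" "map snd d = map (\<lambda>(a, n, m). m) z"
        "map fst (map ?f z) = map fst d"
        using z(3) by auto
      moreover have "lexless (map (\<lambda>(a, n, m). n) z) (map (\<lambda>(a, n, m). m) z)"
        unfolding lexless_def e(1) using e(2,3)
        by (intro exI[of _ "map (\<lambda>(a, n, m). n) z1"] exI conjI) auto
      ultimately show "\<exists>d'\<in>L. d \<in> L \<and> map fst d' = map fst d \<and> lexless (map snd d') (map snd d)"
        using z(1,4) by metis
    next
      assume "\<exists>d'\<in>L. d \<in> L \<and> map fst d' = map fst d \<and> lexless (map snd d') (map snd d)"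
      then obtain d' where d': "d' \<in> L" "d \<in> L" "map fst d' = map fst d" "lexless (map snd d') (map snd d)"
        by blast
      \<comment> \<open>The first annotation track is that of the competitor d', the second that of
        d.\<close>
      let ?z = "map2 (\<lambda>(a, n) (b, m). (a, n, m)) d' d"
      have len: "length d' = length d" using d'(3) by (rule map_eq_imp_length_eq)
      have "map ?f (map2 (\<lambda>(a, n) (b, m). (a, n, m)) d' d) = d'"
        using len by (induction d' d rule: list_induct2) auto
      moreover have "map ?g (map2 (\<lambda>(a, n) (b, m). (a, n, m)) d' d) = d"
        using len d'(3) by (induction d' d rule: list_induct2) auto
      moreover have "?z \<in> ?D"
      proof -
        from d'(4) obtain zs x xs y ys where zs: "map snd d' = zs @ x # xs" "map snd d = zs @ y # ys" "x < y"
          unfolding lexless_def by blast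
        from zs(1) obtain d1 e1 d2 where 1: "d' = d1 @ e1 # d2" "map snd d1 = zs" "snd e1 = x"
          by (auto simp: map_eq_append_conv)
        from zs(2) obtain c1 f1 c2 where 2: "d = c1 @ f1 # c2" "map snd c1 = zs" "snd f1 = y"
          by (auto simp: map_eq_append_conv)
        have l: "length d1 = length c1" using 1(2) 2(2) by (metis map_eq_imp_length_eq)
        have "map (\<lambda>(a, n, m). n) (map2 (\<lambda>(a, n) (b, m). (a, n, m)) d1 c1)
            = map (\<lambda>(a, n, m). m) (map2 (\<lambda>(a, n) (b, m). (a, n, m)) d1 c1)"
          using l 1(2)[folded 2(2)] by (induction d1 c1 rule: list_induct2) auto
        moreover have "?z = map2 (\<lambda>(a, n) (b, m). (a, n, m)) d1 c1 @ (fst e1, snd e1, snd f1) # map2 (\<lambda>(a, n) (b, m). (a, n, m)) d2 c2"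
          using l 1(1) 2(1) by (simp split: prod.splits)
        ultimately show ?thesis using zs(3) 1(3) 2(3) by (intro CollectI exI conjI) (assumption+, simp)
      qed
      ultimately show "d \<in> map ?g ` ?P" using d'(1,2) by (intro image_eqI[where x = ?z]) simp_all
    qed
    then show ?thesis by blast
  qed
  show "d = d'" if "d \<in> ?M" "d' \<in> ?M" "map fst d = map fst d'" for d d'
  proof -
    have "length (map snd d) = length (map snd d')" using that(3) map_eq_imp_length_eq by fastforce
    moreover have "\<not> lexless (map snd d') (map snd d)" "\<not> lexless (map snd d) (map snd d')"
      using that(1)[unfolded M] that(2)[unfolded M] that(3) by simp_all
    ultimately have "map snd d = map snd d'" using lexless_total by blast
    then have "zip (map fst d) (map snd d) = zip (map fst d') (map snd d')" using that(3) by simp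
    then show ?thesis by (simp only: zip_map_fst_snd)
  qed
  show "\<exists>d'\<in>?M. map fst d' = map fst d" if "d \<in> L" for d
  proof -
    let ?X = "map snd ` {d'\<in>L. map fst d' = map fst d}"
    have "\<exists>xs\<in>?X. \<forall>ys\<in>?X. \<not> lexless ys xs"
    proof (rule lexless_least)
      show "length xs = length d" if "xs \<in> ?X" for xs
        using that by (auto dest: map_eq_imp_length_eq)
    qed (use that in auto)
    then obtain d' where "d' \<in> L" "map fst d' = map fst d" "\<forall>ys\<in>?X. \<not> lexless ys (map snd d')" by blast
    note d' = this
    have "d' \<in> ?M" unfolding M
    proof (intro conjI ballI impI)
      fix e assume "e \<in> L" "map fst e = map fst d'"
      then have "map snd e \<in> ?X" using d'(2) by auto
      then show "\<not> lexless (map snd e) (map snd d')" using d'(3) by blast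
    qed (rule d'(1))
    then show ?thesis using d'(2) by (rule bexI[rotated])
  qed
qed

section \<open>Pumping\<close>

abbreviation pw :: "nat \<Rightarrow> 'x list \<Rightarrow> 'x list" where
  "pw n y \<equiv> concat (replicate n y)"

lemma pw_add: "pw (m + n) y = pw m y @ pw n y"
  by (simp add: replicate_add)

lemma length_pw: "length (pw n y) = n * length y"
  by (induction n) auto

lemma pw_comm: "pw n y @ y = y @ pw n y"
  by (induction n) auto

text \<open>While s is at least as long as y it begins with y, which can be cut off from s on both
  sides. Once s is shorter it is a prefix of y, and for exponent at least two the prefixes of length
  |y| + |s| give the claim.\<close>

lemma conjugate_root:
  assumes "d > 0" "length y = length y'" "pw d y @ s = s @ pw d y'"
  shows "y @ s = s @ y'"
  using assms(3)
proof (induction "length s" arbitrary: s rule: less_induct)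
  case less
  obtain e where d: "d = Suc e" using assms(1) by (cases d) auto
  show ?case
  proof (cases "y = []")
    case True
    then show ?thesis using assms(2) by simp
  next
    case ne: False
    show ?thesis
    proof (cases "length y \<le> length s")
      case True
      have "y = take (length y) (pw d y @ s)" unfolding d by simp
      also have "\<dots> = take (length y) s" unfolding less.prems using True by simp
      finally obtain s1 where s: "s = y @ s1" by (metis append_take_drop_id)
      have "y @ pw d y @ s1 = y @ s1 @ pw d y'"
        using less.prems unfolding s by (metis append.assoc pw_comm)
      then have "pw d y @ s1 = s1 @ pw d y'" by simp
      moreover have "length s1 < length s" using s ne by simp
      ultimately have "y @ s1 = s1 @ y'" using less.hyps by blast
      then show ?thesis unfolding s by simp
    next
      case False
      show ?thesis
      proof (cases e)
        case 0
        then show ?thesis using less.prems d by simp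
      next
        case (Suc e')
        have "s = take (length s) (pw d y @ s)" unfolding less.prems by simp
        also have "\<dots> = take (length s) y" unfolding d using False by simp
        finally have s: "take (length s) y = s" by simp
        have "y @ s = take (length y + length s) (pw d y @ s)"
          unfolding d Suc using False s by simp
        also have "\<dots> = s @ y'"
          unfolding less.prems using assms(2) unfolding d by simp
        finally show ?thesis .
      qed
    qed
  qed
qed

lemma conjugate_pw: "y @ s = s @ y' \<Longrightarrow> pw n y @ s = s @ pw n y'"
proof (induction n)
  case (Suc n)
  then show ?case by (metis append.assoc concat.simps(2) replicate_Suc)
qed simp

text \<open>Let s be the delay between x and x'. Comparing the two equations shows that s conjugates
  the powers with exponent \<open>n2 - n1\<close>; by \<open>conjugate_root\<close> it conjugates
  the loops, hence all their powers.\<close>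

lemma pumped_eq_aux:
  assumes "n1 < n2" "length y = length y'"
    and 1: "x @ pw n1 y @ z = x' @ pw n1 y' @ z'" and 2: "x @ pw n2 y @ z = x' @ pw n2 y' @ z'"
    and "length x \<le> length x'"
  shows "x @ pw n y @ z = x' @ pw n y' @ z'"
proof -
  from 1 assms(5) obtain s where s: "x' = x @ s"
    unfolding append_eq_append_conv2 by auto
  let ?d = "n2 - n1"
  have n2: "n2 = ?d + n1" using assms(1) by simp
  have e1: "pw n1 y @ z = s @ pw n1 y' @ z'" using 1 unfolding s by simp
  have "pw n2 y @ z = s @ pw n2 y' @ z'" using 2 unfolding s by simp
  then have "pw ?d y @ pw n1 y @ z = s @ pw ?d y' @ pw n1 y' @ z'"
    by (subst (asm) (1 2) n2) (simp only: pw_add append.assoc)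
  then have "(pw ?d y @ s) @ pw n1 y' @ z' = (s @ pw ?d y') @ pw n1 y' @ z'"
    unfolding e1 by simp
  then have "pw ?d y @ s = s @ pw ?d y'" by blast
  with _ assms(2) have c: "y @ s = s @ y'" by (rule conjugate_root) (use assms(1) in simp)
  have "pw n1 y @ z = pw n1 y @ s @ z'" using e1 conjugate_pw[OF c, of n1] by (metis append.assoc)
  then have "z = s @ z'" by simp
  then show ?thesis unfolding s using conjugate_pw[OF c, of n] by (metis append.assoc)
qed

text \<open>Subtracting the two length equations gives (n1 - n2)(|y| - |y'|) = 0, so the loops are
  equally long. Consequently, two pumped words agree for all exponents or for at most one.\<close>

lemma pumped_eq:
  assumes "n1 \<noteq> n2"
    and 1: "x @ pw n1 y @ z = x' @ pw n1 y' @ z'" and 2: "x @ pw n2 y @ z = x' @ pw n2 y' @ z'"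
  shows "length y = length y'" "x @ pw n y @ z = x' @ pw n y' @ z'"
proof -
  have "length x + n1 * length y + length z = length x' + n1 * length y' + length z'"
    "length x + n2 * length y + length z = length x' + n2 * length y' + length z'"
    using arg_cong[OF 1, of length] arg_cong[OF 2, of length] by (simp_all add: length_pw)
  then have "(int n1 - int n2) * (int (length y) - int (length y')) = 0"
    unfolding int_int_eq[symmetric] of_nat_add of_nat_mult by (simp add: algebra_simps)
  then show l: "length y = length y'" using assms(1) by simp
  show "x @ pw n y @ z = x' @ pw n y' @ z'"
  proof (cases "length x \<le> length x'")
    case True
    from assms(1) consider "n1 < n2" | "n2 < n1" by linarith
    then show ?thesis
      by cases (rule pumped_eq_aux[OF _ l 1 2 True] pumped_eq_aux[OF _ l 2 1 True]; assumption)+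
  next
    case False
    then have le: "length x' \<le> length x" by simp
    from assms(1) consider "n1 < n2" | "n2 < n1" by linarith
    then have "x' @ pw n y' @ z' = x @ pw n y @ z"
      by cases (rule pumped_eq_aux[OF _ l[symmetric] 1[symmetric] 2[symmetric] le]
          pumped_eq_aux[OF _ l[symmetric] 2[symmetric] 1[symmetric] le]; assumption)+
    then show ?thesis by (rule sym)
  qed
qed

text \<open>The function may fall, but it rises by at most M per step; so it cannot climb past M
  consecutive values without taking one of them.\<close>

lemma slow_growth:
  fixes f :: "nat \<Rightarrow> nat"
  assumes "f 0 = 0" "\<And>t. t < n \<Longrightarrow> f (Suc t) \<le> f t + M"
  shows "f n \<le> M * card (f ` {..n} \<inter> {0<..f n})"
  using assms(2)
proof (induction n rule: less_induct)
  case (less n)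
  show ?case
  proof (cases "f n = 0")
    case False
    \<comment> \<open>The last time before n with a value below f n: the next step must bridge the
      gap, and f n is a value not yet counted up to t.\<close>
    define t where "t = Max {t. t < n \<and> f t < f n}"
    have fin: "finite {t. t < n \<and> f t < f n}" by simp
    have "n \<noteq> 0" using False assms(1) by (cases n) auto
    then have ne: "{t. t < n \<and> f t < f n} \<noteq> {}" using assms(1) False by auto
    have t: "t < n" "f t < f n" using Max_in[OF fin ne] unfolding t_def by auto
    have "f n \<le> f (Suc t)"
    proof (rule ccontr)
      assume a: "\<not> f n \<le> f (Suc t)"
      then have "Suc t < n" using t(1) by (metis Suc_lessI order_refl)
      then have "Suc t \<in> {t. t < n \<and> f t < f n}" using a by simp
      then have "Suc t \<le> Max {t. t < n \<and> f t < f n}" by (rule Max_ge[OF fin])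
      then show False unfolding t_def[symmetric] by simp
    qed
    then have "f n \<le> f t + M" using less.prems[OF t(1)] by simp
    moreover have "f t \<le> M * card (f ` {..t} \<inter> {0<..f t})" using less t by simp
    moreover have "card (f ` {..t} \<inter> {0<..f t}) < card (f ` {..n} \<inter> {0<..f n})"
    proof (rule psubset_card_mono)
      have "f n \<in> (f ` {..n} \<inter> {0<..f n}) - (f ` {..t} \<inter> {0<..f t})" using t False by auto
      moreover have "f ` {..t} \<inter> {0<..f t} \<subseteq> f ` {..n} \<inter> {0<..f n}" using t by auto
      ultimately show "f ` {..t} \<inter> {0<..f t} \<subset> f ` {..n} \<inter> {0<..f n}" by blast
    qed simp
    then have "M * Suc (card (f ` {..t} \<inter> {0<..f t})) \<le> M * card (f ` {..n} \<inter> {0<..f n})"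
      by (intro mult_le_mono2) simp
    ultimately show ?thesis by simp
  qed simp
qed

text \<open>By the last assumption f factors through the state s and so takes at most
  \<open>card S\<close> values. It is mostly a tool for finding loops: a value beyond the bound
  forces a repeated state with a changed value.\<close>

lemma loop_free_bound:
  fixes f :: "nat \<Rightarrow> nat"
  assumes "f 0 = 0" "\<And>t. t < n \<Longrightarrow> f (Suc t) \<le> f t + M"
    and "finite S" "\<And>t. t \<le> n \<Longrightarrow> s t \<in> S"
    and "\<And>t t'. t < t' \<Longrightarrow> t' \<le> n \<Longrightarrow> s t = s t' \<Longrightarrow> f t = f t'"
  shows "f n \<le> M * card S"
proof -
  have same: "f t = f t'" if "s t = s t'" "t \<le> n" "t' \<le> n" for t t'
    using assms(5)[of t t'] assms(5)[of t' t] that by (metis linorder_neqE_nat)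
  let ?g = "\<lambda>x. f (SOME t. t \<le> n \<and> s t = x)"
  have "f t = ?g (s t)" if "t \<le> n" for t
  proof -
    have "(SOME t'. t' \<le> n \<and> s t' = s t) \<le> n \<and> s (SOME t'. t' \<le> n \<and> s t' = s t) = s t"
      by (rule someI[of "\<lambda>t'. t' \<le> n \<and> s t' = s t" t]) (use that in simp)
    then show ?thesis using same that by metis
  qed
  then have "f ` {..n} \<subseteq> ?g ` S" using assms(4) by blast
  then have "card (f ` {..n} \<inter> {0<..f n}) \<le> card (?g ` S)"
    by (intro card_mono finite_imageI assms(3)) auto
  also have "\<dots> \<le> card S" by (rule card_image_le[OF assms(3)])
  finally show ?thesis using slow_growth[of f n M, OF assms(1,2)] by (meson le_trans mult_le_mono2)
qed

section \<open>Simultaneous pumping of computations\<close>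

lemma hom_pw: "hom h (pw n y) = pw n (hom h y)"
  by (induction n) auto

lemma take_split: "t \<le> t' \<Longrightarrow> take t' b = take t b @ drop t (take t' b)"
  by (metis append_take_drop_id min.absorb1 take_take)

lemma blocks_split: "t \<le> t' \<Longrightarrow> b = take t b @ drop t (take t' b) @ drop t' b"
  by (metis append.assoc append_take_drop_id take_split)

text \<open>P stands for a set of successful computations, with \<open>inp\<close> and
  \<open>out\<close> reading off their labels. No automaton is fixed; the left quotients of P act as
  states, and \<open>nq\<close> is their number.\<close>

locale valued_language =
  fixes P :: "'g list set" and inp :: "'g \<Rightarrow> 'a list" and out :: "'g \<Rightarrow> 'c list" and k :: nat
  assumes reg_P: "reg P"
    and finite_out: "finite (hom out ` {w \<in> P. hom inp w = u})"
    and card_out: "card (hom out ` {w \<in> P. hom inp w = u}) \<le> k"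
begin

definition nq :: nat where "nq = card (range (\<lambda>w. lq w P))"

lemma pump:
  assumes "lq (x @ y) P = lq x P" "x @ y @ z \<in> P"
  shows "x @ pw n y @ z \<in> P"
proof -
  have "lq (x @ pw n y) P = lq x P"
  proof (induction n)
    case (Suc n)
    have "lq (x @ pw (Suc n) y) P = lq (pw n y) (lq (x @ y) P)" by (simp flip: lq_append)
    also have "\<dots> = lq (x @ pw n y) P" unfolding assms(1) by (simp add: lq_append)
    finally show ?case using Suc by simp
  qed simp
  moreover have "z \<in> lq x P" using assms by (metis append.assoc mem_lq)
  ultimately show ?thesis by (metis append.assoc mem_lq)
qed

text \<open>Otherwise pumping the loop would give infinitely many outputs, of different lengths,
  over one input.\<close>

lemma empty_input_loop:
  assumes "lq (x @ y) P = lq x P" "x @ y @ z \<in> P" "hom inp y = []"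
  shows "hom out y = []"
proof (rule ccontr)
  assume ne: "hom out y \<noteq> []"
  let ?u = "hom inp (x @ y @ z)"
  let ?f = "\<lambda>n. hom out (x @ pw n y @ z)"
  have "range ?f \<subseteq> hom out ` {w \<in> P. hom inp w = ?u}"
  proof (rule image_subsetI, rule imageI)
    fix n
    show "x @ pw n y @ z \<in> {w \<in> P. hom inp w = ?u}"
      using pump[OF assms(1,2), of n] assms(3) by (simp add: hom_pw)
  qed
  then have "finite (range ?f)" using finite_out finite_subset by blast
  moreover have "inj ?f"
  proof (rule injI)
    fix m n assume "?f m = ?f n"
    then have "length (?f m) = length (?f n)" by simp
    then show "m = n" using ne by (simp add: hom_pw length_pw)
  qed
  ultimately show False using finite_imageD infinite_UNIV_nat by blast
qed

text \<open>Loops inside y emit nothing, so the length emitted along y is a function of the quotient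
  reached.\<close>

lemma empty_input_bound:
  assumes "x @ y @ z \<in> P" "hom inp y = []" "\<And>g. g \<in> set y \<Longrightarrow> length (out g) \<le> M"
  shows "length (hom out y) \<le> M * nq"
proof -
  let ?f = "\<lambda>t. length (hom out (take t y))" and ?s = "\<lambda>t. lq (x @ take t y) P"
  have "?f (length y) \<le> M * card (range (\<lambda>w. lq w P))"
  proof (rule loop_free_bound[where s = ?s and f = ?f and n = "length y"])
    show "?f (Suc t) \<le> ?f t + M" if "t < length y" for t
      using that assms(3)[of "y ! t"] by (simp add: take_Suc_conv_app_nth)
    show "finite (range (\<lambda>w. lq w P))" using reg_P unfolding reg_def .
    show "?f t = ?f t'" if "t < t'" "t' \<le> length y" "?s t = ?s t'" for t t'
    proof -
      define y1 y2 y3 where "y1 = take t y" and "y2 = drop t (take t' y)" and "y3 = drop t' y"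
      have t': "take t' y = y1 @ y2" unfolding y1_def y2_def using that(1) by (intro take_split) simp
      then have y: "y = y1 @ y2 @ y3" unfolding y3_def by (metis append.assoc append_take_drop_id)
      have "hom out y2 = []"
      proof (rule empty_input_loop)
        show "lq ((x @ y1) @ y2) P = lq (x @ y1) P" using that(3) t' y1_def by simp
        show "(x @ y1) @ y2 @ (y3 @ z) \<in> P" using assms(1) y by simp
        show "hom inp y2 = []" using assms(2) y by simp
      qed
      then show ?thesis unfolding t' y1_def[symmetric] by simp
    qed
  qed auto
  then show ?thesis by (simp add: nq_def)
qed

definition olen :: "'g list list \<Rightarrow> nat \<Rightarrow> nat" where
  "olen b t = length (hom out (concat (take t b)))"

definition dlen :: "'g list list \<Rightarrow> 'g list list \<Rightarrow> nat \<Rightarrow> nat" where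
  "dlen b c t = (olen b t - olen c t) + (olen c t - olen b t)"

text \<open>Comparing lengths is enough: when the total outputs agree, the outputs emitted up to
  block t are prefixes of one word, and their lengths determine the delay.\<close>

definition near :: "nat \<Rightarrow> 'g list list \<Rightarrow> 'g list list \<Rightarrow> bool" where
  "near N b c \<longleftrightarrow> hom out (concat b) = hom out (concat c) \<and> (\<forall>t. dlen b c t \<le> N)"

definition pblocks :: "nat \<Rightarrow> nat \<Rightarrow> nat \<Rightarrow> 'x list \<Rightarrow> 'x list" where
  "pblocks t t' r b = take t b @ pw r (drop t (take t' b)) @ drop t' b"

lemma map_pblocks: "map f (pblocks t t' r b) = pblocks t t' r (map f b)"
  by (simp add: pblocks_def map_concat take_map drop_map)

lemma set_pblocks: "set (pblocks t t' r b) \<subseteq> set b"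
  unfolding pblocks_def by (auto intro: in_set_takeD in_set_dropD in_set_takeD[OF in_set_dropD])

lemma concat_pw: "concat (pw r l) = pw r (concat l)"
  by (induction r) auto

lemma concat_pblocks:
  "concat (pblocks t t' r b) = concat (take t b) @ pw r (concat (drop t (take t' b))) @ concat (drop t' b)"
  by (simp add: pblocks_def concat_pw)

lemma pblocks_1: "t \<le> t' \<Longrightarrow> pblocks t t' 1 b = b"
  using blocks_split[of t t' b] by (simp add: pblocks_def)

lemma olen_pblocks_low:
  assumes "t < t'" "t' \<le> length b" "s \<le> t'" "r \<ge> 1"
  shows "olen (pblocks t t' r b) s = olen b s"
proof -
  obtain r' where r: "r = Suc r'" using assms(4) by (cases r) auto
  have "pblocks t t' r b = take t' b @ pw r' (drop t (take t' b)) @ drop t' b"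
    unfolding pblocks_def r using take_split[of t t' b] assms(1) by simp
  then have "take s (pblocks t t' r b) = take s b" using assms by (simp add: min_def)
  then show ?thesis by (simp add: olen_def)
qed

text \<open>Behind the pumped loop, positions and output lengths are shifted by constants. For two
  computations whose loops emit equally much, these constants cancel in \<open>dlen\<close>.\<close>

lemma olen_pblocks_high:
  assumes "t < t'" "t' \<le> length b" "t' \<le> s" "r \<ge> 1"
  shows "olen (pblocks t t' r b) (s + (r - 1) * (t' - t))
    = olen b s + (r - 1) * length (hom out (concat (drop t (take t' b))))"
proof -
  obtain r' where r: "r = Suc r'" using assms(4) by (cases r) auto
  let ?y = "drop t (take t' b)"
  have p: "pblocks t t' r b = (take t' b @ pw r' ?y) @ drop t' b"
    unfolding pblocks_def r using take_split[of t t' b] assms(1) by simp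
  have "length (take t' b @ pw r' ?y) = t' + r' * (t' - t)"
    using assms by (simp add: length_pw)
  then have "take (s + r' * (t' - t)) (pblocks t t' r b) = take t' b @ pw r' ?y @ take (s - t') (drop t' b)"
    unfolding p take_append using assms by (simp add: length_pw)
  moreover have "take s b = take t' b @ take (s - t') (drop t' b)"
    using assms(3) by (metis append_take_drop_id min.absorb1 take_drop take_take le_add_diff_inverse2)
  ultimately show ?thesis unfolding olen_def r by (simp add: concat_pw hom_pw length_pw)
qed

end

context valued_language begin

lemma olen_Suc:
  assumes "t < length b"
  shows "olen b (Suc t) = olen b t + length (hom out (b ! t))"
  using assms by (simp add: olen_def take_Suc_conv_app_nth)

lemma olen_split:
  assumes "t \<le> t'"
  shows "olen b t' = olen b t + length (hom out (concat (drop t (take t' b))))"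
proof -
  have "concat (take t' b) = concat (take t b) @ concat (drop t (take t' b))"
    using take_split[OF assms, of b] by (metis concat_append)
  then show ?thesis by (simp add: olen_def)
qed

lemma olen_min: "olen b s = olen b (min s (length b))"
  by (cases "s \<le> length b") (simp_all add: olen_def)

text \<open>In the bound, \<open>nq ^ Suc k\<close> counts the tuples of quotients that k + 1
  computations can be in, and B bounds the change of a delay per block. A delay beyond the product
  thus changes along a loop common to all of them.\<close>

lemma near_pair:
  assumes "\<And>i. i \<le> k \<Longrightarrow> concat (c i) \<in> P" "\<And>i. i \<le> k \<Longrightarrow> map (hom inp) (c i) = us"
    and "\<And>i b. i \<le> k \<Longrightarrow> b \<in> set (c i) \<Longrightarrow> length (hom out b) \<le> B"
  shows "\<exists>i j. i < j \<and> j \<le> k \<and> near (B * nq ^ Suc k) (c i) (c j)"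
proof (rule ccontr)
  let ?N = "B * nq ^ Suc k"
  define good where "good c \<longleftrightarrow> (\<exists>us. \<forall>i\<le>k. concat (c i) \<in> P \<and> map (hom inp) (c i) = us \<and>
     (\<forall>b\<in>set (c i). length (hom out b) \<le> B)) \<and> (\<forall>i j. i < j \<and> j \<le> k \<longrightarrow> \<not> near ?N (c i) (c j))" for c
  \<comment> \<open>The quantity to maximise; it is bounded by the number of index pairs.\<close>
  define neq where "neq c = {(i, j). i < j \<and> j \<le> k \<and> hom out (concat (c i)) \<noteq> hom out (concat (c j))}"
    for c :: "nat \<Rightarrow> 'g list list"
  have neq_sub: "neq c \<subseteq> {..k} \<times> {..k}" for c unfolding neq_def by auto
  then have neq_fin: "finite (neq c)" for c by (rule finite_subset) simp
  assume "\<not> (\<exists>i j. i < j \<and> j \<le> k \<and> near ?N (c i) (c j))"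
  then have "good c" unfolding good_def using assms by blast
  moreover have "card (neq c) \<le> card ({..k} \<times> {..k})" for c
    by (rule card_mono[OF _ neq_sub]) simp
  ultimately have "\<exists>c. good c \<and> (\<forall>c'. good c' \<longrightarrow> card (neq c') \<le> card (neq c))"
    by (intro ex_has_greatest_nat[where b = "Suc (card ({..k} \<times> {..k}))"]) (auto simp: less_Suc_eq_le)
  then obtain c where gc: "good c" and max: "\<And>c'. good c' \<Longrightarrow> card (neq c') \<le> card (neq c)" by blast
  from gc obtain us where cP: "\<And>i. i \<le> k \<Longrightarrow> concat (c i) \<in> P"
    and cus: "\<And>i. i \<le> k \<Longrightarrow> map (hom inp) (c i) = us"
    and cB: "\<And>i b. i \<le> k \<Longrightarrow> b \<in> set (c i) \<Longrightarrow> length (hom out b) \<le> B"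
    and cfar: "\<And>i j. i < j \<Longrightarrow> j \<le> k \<Longrightarrow> \<not> near ?N (c i) (c j)" unfolding good_def by blast
  have len: "length (c i) = length us" if "i \<le> k" for i using cus[OF that] by (metis length_map)
  have "\<exists>i j. i < j \<and> j \<le> k \<and> hom out (concat (c i)) = hom out (concat (c j))"
  proof (rule ccontr)
    assume "\<not> ?thesis"
    then have "inj_on (\<lambda>i. hom out (concat (c i))) {..k}"
      by (intro linorder_inj_onI) auto
    then have card: "card ((\<lambda>i. hom out (concat (c i))) ` {..k}) = Suc k" by (simp add: card_image)
    have "(\<lambda>i. hom out (concat (c i))) ` {..k} \<subseteq> hom out ` {w \<in> P. hom inp w = concat us}"
    proof (rule image_subsetI, rule imageI)
      fix i assume "i \<in> {..k}"
      then show "concat (c i) \<in> {w \<in> P. hom inp w = concat us}"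
        using cP[of i] cus[of i] by (simp add: hom_concat[of inp])
    qed
    from card_mono[OF finite_out this] card
    have "Suc k \<le> card (hom out ` {w \<in> P. hom inp w = concat us})" by linarith
    then show False using card_out[of "concat us"] by simp
  qed
  then obtain i j where ij: "i < j" "j \<le> k" "hom out (concat (c i)) = hom out (concat (c j))" by blast
  from cfar[OF ij(1,2)] ij(3) obtain s0 where "dlen (c i) (c j) s0 > ?N"
    unfolding near_def by (meson not_le)
  then have s0: "dlen (c i) (c j) (min s0 (length us)) > ?N"
    unfolding dlen_def using olen_min[of "c i" s0] olen_min[of "c j" s0] len ij(1,2) by simp
  \<comment> \<open>All k + 1 computations are traced together, because the loop has to be pumped in
    all of them to keep their inputs equal.\<close>
  let ?s = "\<lambda>t. map (\<lambda>i. lq (concat (take t (c i))) P) [0..<Suc k]"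
  let ?Q = "range (\<lambda>w. lq w P)"
  let ?S = "{xs. set xs \<subseteq> ?Q \<and> length xs = Suc k}"
  have finQ: "finite ?Q" using reg_P unfolding reg_def .
  have "\<exists>t t'. t < t' \<and> t' \<le> length us \<and> ?s t = ?s t' \<and> dlen (c i) (c j) t \<noteq> dlen (c i) (c j) t'"
  proof (rule ccontr)
    assume a: "\<not> ?thesis"
    have "dlen (c i) (c j) (min s0 (length us)) \<le> B * card ?S"
    proof (rule loop_free_bound[where s = ?s and f = "dlen (c i) (c j)"])
      show "dlen (c i) (c j) 0 = 0" by (simp add: dlen_def olen_def)
      show "dlen (c i) (c j) (Suc t) \<le> dlen (c i) (c j) t + B" if "t < min s0 (length us)" for t
      proof -
        have "length (hom out (c i ! t)) \<le> B" "length (hom out (c j ! t)) \<le> B"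
          using cB[of i "c i ! t"] cB[of j "c j ! t"] that len ij by auto
        moreover have "t < length (c i)" "t < length (c j)" using that len ij by auto
        ultimately show ?thesis unfolding dlen_def by (simp add: olen_Suc)
      qed
      show "finite ?S" using finite_lists_length_eq[OF finQ] by simp
      show "?s t \<in> ?S" for t by auto
      show "dlen (c i) (c j) t = dlen (c i) (c j) t'"
        if "t < t'" "t' \<le> min s0 (length us)" "?s t = ?s t'" for t t'
        using a that by auto
    qed
    then show False using s0 card_lists_length_eq[OF finQ, of "Suc k"] unfolding nq_def by simp
  qed
  then obtain t t' where t: "t < t'" "t' \<le> length us" "?s t = ?s t'"
    "dlen (c i) (c j) t \<noteq> dlen (c i) (c j) t'" by blast
  define X Y Z where "X a = concat (take t (c a))" and "Y a = concat (drop t (take t' (c a)))"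
    and "Z a = concat (drop t' (c a))" for a
  have state: "lq (X a @ Y a) P = lq (X a) P" if "a \<le> k" for a
  proof -
    have "X a @ Y a = concat (take t' (c a))"
      unfolding X_def Y_def using take_split[of t t' "c a"] t(1) by (metis concat_append less_imp_le)
    moreover have "lq (concat (take t (c a))) P = lq (concat (take t' (c a))) P"
      using arg_cong[OF t(3), of "\<lambda>xs. xs ! a"] that by (simp del: upt_Suc)
    ultimately show ?thesis unfolding X_def by simp
  qed
  have XYZ: "concat (pblocks t t' r (c a)) = X a @ pw r (Y a) @ Z a" for r a
    unfolding concat_pblocks X_def Y_def Z_def ..
  have c_XYZ: "concat (c a) = X a @ pw 1 (Y a) @ Z a" for a
    using XYZ[of 1 a] pblocks_1[of t t' "c a"] t(1) by simp
  \<comment> \<open>The exponents for which the outputs of a and b agree after pumping. By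
    \<open>pumped_eq\<close> this is everything or has at most one element.\<close>
  define E where "E a b = {r. hom out (X a) @ pw r (hom out (Y a)) @ hom out (Z a)
      = hom out (X b) @ pw r (hom out (Y b)) @ hom out (Z b)}" for a b
  have E: "r \<in> E a b \<longleftrightarrow> hom out (concat (pblocks t t' r (c a))) = hom out (concat (pblocks t t' r (c b)))" for r a b
    unfolding XYZ E_def by (simp add: hom_pw)
  have E1: "1 \<in> E a b \<longleftrightarrow> hom out (concat (c a)) = hom out (concat (c b))" for a b
    unfolding c_XYZ E_def by simp
  have E_two: "length (hom out (Y a)) = length (hom out (Y b)) \<and> E a b = UNIV"
    if "r1 \<in> E a b" "r2 \<in> E a b" "r1 \<noteq> r2" for a b r1 r2
    using pumped_eq[OF that(3) that(1)[unfolded E_def mem_Collect_eq] that(2)[unfolded E_def mem_Collect_eq]]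
    unfolding E_def by simp
  have "finite (E a b)" if "E a b \<noteq> UNIV" for a b
  proof (cases "E a b = {}")
    case False
    then obtain r where "r \<in> E a b" by blast
    then have "E a b \<subseteq> {r}" using E_two that by blast
    then show ?thesis by (rule finite_subset) simp
  qed simp
  then have "finite (\<Union>(a, b)\<in>{(a, b). a \<le> k \<and> b \<le> k \<and> E a b \<noteq> UNIV}. E a b)"
    by (intro finite_UN_I finite_subset[of "{(a, b). a \<le> k \<and> b \<le> k \<and> E a b \<noteq> UNIV}" "{..k} \<times> {..k}"]) auto
  \<comment> \<open>An exponent outside the finite sets lets two pumped outputs agree only if they
    agree for every exponent, in particular for 1.\<close>
  then have "infinite ({2..} - (\<Union>(a, b)\<in>{(a, b). a \<le> k \<and> b \<le> k \<and> E a b \<noteq> UNIV}. E a b))"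
    by (rule Diff_infinite_finite) (rule infinite_Ici)
  then obtain r where "r \<in> {2..} - (\<Union>(a, b)\<in>{(a, b). a \<le> k \<and> b \<le> k \<and> E a b \<noteq> UNIV}. E a b)"
    using infinite_imp_nonempty by blast
  then have r: "r \<ge> 2" "\<And>a b. a \<le> k \<Longrightarrow> b \<le> k \<Longrightarrow> E a b \<noteq> UNIV \<Longrightarrow> r \<notin> E a b" by auto
  let ?c = "\<lambda>a. pblocks t t' r (c a)"
  have "good ?c" unfolding good_def
  proof (intro conjI exI allI impI ballI)
    fix a assume a: "a \<le> k"
    show "concat (?c a) \<in> P"
      unfolding XYZ using pump[OF state[OF a], of "Z a" r] cP[OF a] unfolding c_XYZ by simp
    show "map (hom inp) (?c a) = pblocks t t' r us" unfolding map_pblocks cus[OF a] ..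
    show "length (hom out b) \<le> B" if "b \<in> set (?c a)" for b
      by (rule cB[OF a subsetD[OF set_pblocks that]])
  next
    fix a b assume ab: "a < b \<and> b \<le> k"
    show "\<not> near ?N (?c a) (?c b)"
    proof
      assume n: "near ?N (?c a) (?c b)"
      then have "r \<in> E a b" unfolding E near_def by simp
      then have U: "E a b = UNIV" using r(2)[of a b] ab by auto
      \<comment> \<open>0 and 1 are two exponents of agreement, so the loops of a and b emit equally
        much and pumping only shifts the positions of their delays.\<close>
      then have Y: "length (hom out (Y a)) = length (hom out (Y b))" using E_two[of 0 a b 1] by simp
      have "hom out (concat (c a)) = hom out (concat (c b))" using U E1 by blast
      then obtain s where s: "dlen (c a) (c b) s > ?N"
        using cfar[of a b] ab unfolding near_def by (meson not_le)
      have l: "t' \<le> length (c a)" "t' \<le> length (c b)" using len t ab by auto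
      show False
      proof (cases "s \<le> t'")
        case True
        then have "dlen (?c a) (?c b) s = dlen (c a) (c b) s"
          unfolding dlen_def using olen_pblocks_low[OF t(1) l(1) True] olen_pblocks_low[OF t(1) l(2) True] r(1) by simp
        then show False using s n unfolding near_def by (metis not_le)
      next
        case False
        then have s': "t' \<le> s" by simp
        have "dlen (?c a) (?c b) (s + (r - 1) * (t' - t)) = dlen (c a) (c b) s"
          unfolding dlen_def using olen_pblocks_high[OF t(1) l(1) s', of r] olen_pblocks_high[OF t(1) l(2) s', of r]
            r(1) Y unfolding Y_def by simp
        then show False using s n unfolding near_def by (metis not_le)
      qed
    qed
  qed
  then have "card (neq ?c) \<le> card (neq c)" by (rule max)
  moreover have "neq c \<subset> neq ?c"
  proof (rule psubsetI)
    show "neq c \<subseteq> neq ?c"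
    proof (rule subrelI)
      fix a b assume ab: "(a, b) \<in> neq c"
      then have "1 \<notin> E a b" unfolding E1 neq_def by simp
      then have "r \<notin> E a b" using r(2)[of a b] ab unfolding neq_def by auto
      then show "(a, b) \<in> neq ?c" using ab unfolding neq_def E by simp
    qed
    \<comment> \<open>The loop was chosen to change the delay of i and j, so it emits different
      lengths; the pumped outputs of this pair differ for the chosen r.\<close>
    have "length (hom out (Y i)) \<noteq> length (hom out (Y j))"
      using t(4) olen_split[of t t' "c i"] olen_split[of t t' "c j"] t(1)
      unfolding dlen_def Y_def by auto
    then have "E i j \<noteq> UNIV" using E_two[of 0 i j 1] by auto
    then have "r \<notin> E i j" using r(2)[of i j] ij by auto
    then have "(i, j) \<in> neq ?c" using ij unfolding neq_def E by simp
    moreover have "(i, j) \<notin> neq c" using ij unfolding neq_def by simp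
    ultimately show "neq c \<noteq> neq ?c" by blast
  qed
  then have "card (neq c) < card (neq ?c)" by (rule psubset_card_mono[OF neq_fin])
  ultimately show False by simp
qed

end

section \<open>Decomposition of valued regular languages\<close>

text \<open>A cut between two blocks is charged to the earlier one, since p is nonempty. So the
  block containing the cut has already read its input letter.\<close>

lemma prefix_concat_cases:
  assumes "prefix w (concat bs)"
  shows "w = [] \<or> (\<exists>bs1 b bs2 p q. bs = bs1 @ b # bs2 \<and> b = p @ q \<and> p \<noteq> [] \<and> w = concat bs1 @ p)"
  using assms
proof (induction bs arbitrary: w)
  case (Cons b bs)
  from Cons.prems have "prefix w (b @ concat bs)" by simp
  then consider "prefix w b" | us where "w = b @ us" "prefix us (concat bs)"
    unfolding prefix_append by blast
  then show ?case
  proof cases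
    case 1
    then obtain q where "b = w @ q" by (auto simp: prefix_def)
    then have "w = [] \<or> (b # bs = [] @ b # bs \<and> b = w @ q \<and> w \<noteq> [] \<and> w = concat [] @ w)" by simp
    then show ?thesis by blast
  next
    case 2
    show ?thesis
    proof (cases "us = []")
      case True
      then have "w = [] \<or> (b # bs = [] @ b # bs \<and> b = b @ [] \<and> b \<noteq> [] \<and> w = concat [] @ b)"
        using 2 by simp
      then show ?thesis by blast
    next
      case False
      with Cons.IH[OF 2(2)] obtain bs1 b' bs2 p q where
        "bs = bs1 @ b' # bs2" "b' = p @ q" "p \<noteq> []" "us = concat bs1 @ p" by blast
      then have "b # bs = (b # bs1) @ b' # bs2 \<and> b' = p @ q \<and> p \<noteq> [] \<and> w = concat (b # bs1) @ p"
        using 2 by simp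
      then show ?thesis by blast
    qed
  qed
qed simp

text \<open>Words split into blocks, each consisting of a letter that reads one input letter and
  silent letters after it; this is why a nonempty word must begin with a reading letter. Outputs are
  words of numbers, so tuples of them are countable and fit into an annotation.\<close>

locale sync_language = valued_language P inp out k
  for P :: "'g list set" and inp :: "'g \<Rightarrow> 'a list" and out :: "'g \<Rightarrow> nat list" and k +
  fixes \<Gamma> :: "'g set"
  assumes inp_le_1: "length (inp g) \<le> 1"
    and finite_\<Gamma>: "finite \<Gamma>" and P_lists: "P \<subseteq> lists \<Gamma>"
    and input_first: "w \<in> P \<Longrightarrow> w = [] \<or> inp (hd w) \<noteq> []"
begin

section \<open>Blocks, annotations and closeness to a schedule\<close>

definition block :: "'g list \<Rightarrow> bool" where
  "block b \<longleftrightarrow> (\<exists>g ys. b = g # ys \<and> inp g \<noteq> [] \<and> hom inp ys = [])"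

lemma hom_inp_takeWhile: "hom inp (takeWhile (\<lambda>g. inp g = []) w) = []"
  by (induction w) auto

lemma blocks_exist:
  "w = [] \<or> inp (hd w) \<noteq> [] \<Longrightarrow> \<exists>bs. concat bs = w \<and> (\<forall>b\<in>set bs. block b)"
proof (induction "length w" arbitrary: w rule: less_induct)
  case less
  show ?case
  proof (cases w)
    case Nil
    then show ?thesis by (intro exI[of _ "[]"]) simp
  next
    case (Cons g v)
    let ?t = "takeWhile (\<lambda>g. inp g = []) v" and ?d = "dropWhile (\<lambda>g. inp g = []) v"
    have "?d = [] \<or> inp (hd ?d) \<noteq> []" using hd_dropWhile by blast
    moreover have "length ?d < length w" using Cons by (simp add: le_imp_less_Suc length_dropWhile_le)
    ultimately obtain bs where "concat bs = ?d" "\<forall>b\<in>set bs. block b" using less.hyps by blast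
    moreover have "block (g # ?t)" unfolding block_def using less.prems Cons hom_inp_takeWhile by auto
    ultimately show ?thesis using Cons by (intro exI[of _ "(g # ?t) # bs"]) simp
  qed
qed

lemma block_inp: "block b \<Longrightarrow> \<exists>a. hom inp b = [a]"
proof -
  assume "block b"
  then obtain g ys where "b = g # ys" "inp g \<noteq> []" "hom inp ys = []" unfolding block_def by blast
  then show ?thesis using inp_le_1[of g] by (cases "inp g") auto
qed

lemma map_inp_blocks:
  "\<forall>b\<in>set bs. block b \<Longrightarrow> map (hom inp) bs = map (\<lambda>a. [a]) (hom inp (concat bs))"
  by (induction bs) (auto dest!: block_inp)

lemma block_prefix_inp:
  assumes "block (p @ q)" "p \<noteq> []"
  shows "hom inp q = []" "length (hom inp p) = 1"
proof -
  from assms obtain g ys where g: "p @ q = g # ys" "inp g \<noteq> []" "hom inp ys = []"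
    unfolding block_def by blast
  then obtain p' where p': "p = g # p'" "ys = p' @ q" using assms(2) by (cases p) auto
  then show "hom inp q = []" "length (hom inp p) = 1"
    using g inp_le_1[of g] by (cases "inp g"; simp)+
qed

definition max_out :: nat where "max_out = Max (insert 0 ((\<lambda>g. length (out g)) ` \<Gamma>))"

text \<open>The reading letter of a block contributes the first summand, the silent rest the second,
  by \<open>empty_input_bound\<close>.\<close>

definition block_bound :: nat where "block_bound = max_out + max_out * nq"

text \<open>The constant of \<open>near_pair\<close> with B = \<open>block_bound\<close>.\<close>

definition near_bound :: nat where "near_bound = block_bound * nq ^ Suc k"

lemma length_out: "g \<in> \<Gamma> \<Longrightarrow> length (out g) \<le> max_out"
  unfolding max_out_def using finite_\<Gamma> by (intro Max_ge) auto

lemma length_block: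
  assumes "concat bs \<in> P" "b \<in> set bs" "block b"
  shows "length (hom out b) \<le> block_bound"
proof -
  from assms(2) obtain bs1 bs2 where bs: "bs = bs1 @ b # bs2" by (meson split_list)
  from assms(3) obtain g ys where b: "b = g # ys" "hom inp ys = []" unfolding block_def by blast
  have w: "concat bs = (concat bs1 @ [g]) @ ys @ concat bs2" unfolding bs b by simp
  have "concat bs \<in> lists \<Gamma>" using assms(1) P_lists by blast
  then have G: "set (concat bs) \<subseteq> \<Gamma>" unfolding in_lists_conv_set by blast
  have "length (hom out ys) \<le> max_out * nq"
    using empty_input_bound[of "concat bs1 @ [g]" ys "concat bs2" max_out] assms(1) b(2) G length_out
    unfolding w by auto
  moreover have "length (out g) \<le> max_out" using G length_out unfolding w by auto
  ultimately show ?thesis unfolding b block_bound_def by simp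
qed

text \<open>An annotation \<open>n\<close> of an input letter codes the words that the \<open>k\<close> schedules emit at that letter.\<close>

definition wit :: "nat \<Rightarrow> nat \<Rightarrow> nat list" where
  "wit n j = (from_nat n :: nat list list) ! j"

text \<open>Every letter of a computation carries a number, but only those on reading letters count;
  this map leaves just the annotated input.\<close>

definition schedule :: "'g \<times> nat \<Rightarrow> ('a \<times> nat) list" where
  "schedule e = map (\<lambda>a. (a, snd e)) (inp (fst e))"

definition wit_out :: "nat \<Rightarrow> 'g \<times> nat \<Rightarrow> nat list" where
  "wit_out j e = hom (\<lambda>(a, n). wit n j) (schedule e)"

text \<open>The bound is \<open>near_bound\<close> for the distance at the ends of blocks plus
  \<open>block_bound\<close> for a position inside a block.\<close>

definition lags :: "(nat list \<times> nat list) set" where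
  "lags = (let W = {x. set x \<subseteq> (\<Union>g\<in>\<Gamma>. set (out g)) \<and> length x \<le> near_bound + block_bound} in W \<times> W)"

definition close :: "nat \<Rightarrow> ('g \<times> nat) list set" where
  "close j = {z. hom (\<lambda>e. out (fst e)) z = hom (wit_out j) z \<and>
     (\<forall>z1. prefix z1 z \<longrightarrow> lag (hom (\<lambda>e. out (fst e)) z1) (hom (wit_out j) z1) \<in> lags)}"

lemma finite_lags: "finite lags"
proof -
  have "finite (\<Union>g\<in>\<Gamma>. set (out g))" using finite_\<Gamma> by simp
  from finite_lists_length_le[OF this] show ?thesis unfolding lags_def Let_def by simp
qed

lemma reg_close: "reg (close j)"
  unfolding close_def by (rule reg_bounded_lag[OF finite_lags])

lemma map_fst_schedule: "map fst (hom schedule z) = hom inp (map fst z)"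
  by (simp add: map_hom hom_map schedule_def comp_def)

lemma annotate:
  "map fst d = hom inp w \<Longrightarrow> \<exists>z. map fst z = w \<and> hom schedule z = d"
proof (induction w arbitrary: d)
  case (Cons g w)
  show ?case
  proof (cases "inp g")
    case Nil
    with Cons obtain z where "map fst z = w" "hom schedule z = d" by auto
    \<comment> \<open>A silent letter may carry any number; 0 is a default.\<close>
    then show ?thesis using Nil by (intro exI[of _ "(g, 0) # z"]) (simp add: schedule_def[of "(g, 0)"])
  next
    case C: (Cons a r)
    then have i: "inp g = [a]" using inp_le_1[of g] by simp
    with Cons.prems obtain n d' where d: "d = (a, n) # d'" "map fst d' = hom inp w" by auto
    from Cons.IH[OF d(2)] obtain z where "map fst z = w" "hom schedule z = d'" by blast
    then show ?thesis using i d by (intro exI[of _ "(g, n) # z"]) (simp add: schedule_def[of "(g, n)"])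
  qed
qed simp

text \<open>Here m may be smaller than k; the schedules with index at least m are then unspecified,
  and \<open>witness_out\<close> claims nothing about them.\<close>

definition witness :: "nat \<Rightarrow> (nat \<Rightarrow> 'g list list) \<Rightarrow> 'a list \<Rightarrow> ('a \<times> nat) list" where
  "witness m e u = zip u (map (\<lambda>t. to_nat (map (\<lambda>j. hom out (e j ! t)) [0..<m])) [0..<length u])"

lemma witness_out:
  assumes "i < m" "length (e i) = length u" "t \<le> length u"
  shows "hom (\<lambda>(a, n). wit n i) (take t (witness m e u)) = hom out (concat (take t (e i)))"
  using assms(3)
proof (induction t)
  case (Suc t)
  have l: "length (witness m e u) = length u" by (simp add: witness_def)
  have "witness m e u ! t = (u ! t, to_nat (map (\<lambda>j. hom out (e j ! t)) [0..<m]))"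
    using Suc.prems by (simp add: witness_def)
  then have "(\<lambda>(a, n). wit n i) (witness m e u ! t) = hom out (e i ! t)"
    using assms(1) by (simp add: wit_def)
  then show ?case using Suc assms(2) l by (simp add: take_Suc_conv_app_nth)
qed simp

text \<open>A schedule emits the word of a whole block at its input letter, whereas the computation
  emits it letter by letter. Hence the prefix read is compared with the end of its current block,
  which costs at most \<open>block_bound\<close>.\<close>

lemma close_to_witness:
  assumes z: "map fst z \<in> P" "hom schedule z = witness m e u" "i < m"
    and bs: "concat bs = map fst z" "\<forall>b\<in>set bs. block b"
    and e: "concat (e i) \<in> P" "length (e i) = length u"
    and near: "near near_bound (e i) bs"
  shows "z \<in> close i"
proof -
  have lw: "length (witness m e u) = length u" by (simp add: witness_def)
  have u: "hom inp (map fst z) = u"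
    using map_fst_schedule[of z] unfolding z(2) by (simp add: witness_def)
  have lbs: "length bs = length u"
    using arg_cong[OF map_inp_blocks[OF bs(2)], of length] unfolding bs(1) u by simp
  have out_fst: "hom (\<lambda>e. out (fst e)) v = hom out (map fst v)" for v by (simp add: hom_map)
  have wo: "hom (wit_out i) v = hom (\<lambda>(a, n). wit n i) (hom schedule v)" for v
    unfolding hom_hom by (rule hom_cong) (simp add: wit_out_def)
  have full: "hom (\<lambda>e. out (fst e)) z = hom (wit_out i) z"
    unfolding out_fst wo z(2) using witness_out[OF z(3), of e u "length u", OF e(2)] near bs(1) e(2) lw
    unfolding near_def by simp
  have "lag (hom (\<lambda>e. out (fst e)) z1) (hom (wit_out i) z1) \<in> lags" if pre: "prefix z1 z" for z1
  proof -
    obtain z2 where z2: "z = z1 @ z2" using pre by (auto simp: prefix_def)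
    let ?w = "map fst z1"
    let ?t = "length (hom inp ?w)"
    let ?x = "hom out ?w" and ?y = "hom (wit_out i) z1"
    have t_le: "?t \<le> length u" using u unfolding z2 by auto
    have "length (hom schedule z1) = ?t" using map_fst_schedule[of z1] by (metis length_map)
    then have sch: "hom schedule z1 = take ?t (witness m e u)"
      using z(2) unfolding z2 by (metis append_eq_conv_conj hom_simps(3))
    then have y: "?y = hom out (concat (take ?t (e i)))"
      unfolding wo using witness_out[OF z(3), of e u, OF e(2) t_le] by simp
    have "?w = [] \<or> (\<exists>bs1 b bs2 p q. bs = bs1 @ b # bs2 \<and> b = p @ q \<and> p \<noteq> [] \<and> ?w = concat bs1 @ p)"
      by (rule prefix_concat_cases) (simp add: bs(1) z2)
    then have d: "olen bs ?t - length ?x \<le> block_bound" "length ?x \<le> olen bs ?t"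
    proof (atomize(full), elim disjE exE conjE)
      assume "?w = []"
      then show "olen bs ?t - length ?x \<le> block_bound \<and> length ?x \<le> olen bs ?t" by (simp add: olen_def)
    next
      fix bs1 b bs2 p q
      assume b: "bs = bs1 @ b # bs2" "b = p @ q" "p \<noteq> []" "?w = concat bs1 @ p"
      have "\<forall>b\<in>set bs1. block b" using bs(2) b(1) by simp
      from arg_cong[OF map_inp_blocks[OF this], of length]
      have "length (hom inp (concat bs1)) = length bs1" by simp
      moreover have "length (hom inp p) = 1"
        using block_prefix_inp(2)[of p q] bs(2) b by simp
      ultimately have "?t = Suc (length bs1)" unfolding b(4) by simp
      then have "olen bs ?t = length ?x + length (hom out q)"
        unfolding olen_def b(1,2,4) by simp
      moreover have "length (hom out b) \<le> block_bound"
        by (rule length_block[of bs]) (use bs z(1) b(1) in auto)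
      ultimately show "olen bs ?t - length ?x \<le> block_bound \<and> length ?x \<le> olen bs ?t"
        using b(2) by simp
    qed
    have "dlen (e i) bs ?t \<le> near_bound" using near unfolding near_def by blast
    moreover have "olen (e i) ?t = length ?y" unfolding y olen_def ..
    ultimately have diff: "length ?x - length ?y \<le> near_bound + block_bound"
      "length ?y - length ?x \<le> near_bound + block_bound"
      using d unfolding dlen_def by simp_all
    \<comment> \<open>The total outputs agree, so both partial outputs have a common completion and
      the lag is the surplus of the longer one.\<close>
    obtain v v' where v: "?x @ v = ?y @ v'" using full unfolding out_fst z2 by auto
    have lag: "lag ?x ?y = (take (length v' - length v) v', take (length v - length v') v)"
      by (rule lag_of_common_completion[OF v])
    have "length ?x + length v = length ?y + length v'" using arg_cong[OF v, of length] by simp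
    then have "length (fst (lag ?x ?y)) \<le> near_bound + block_bound"
      "length (snd (lag ?x ?y)) \<le> near_bound + block_bound"
      unfolding lag using diff by auto
    moreover have "set (hom out v) \<subseteq> (\<Union>g\<in>\<Gamma>. set (out g))" if "set v \<subseteq> \<Gamma>" for v
      using that by (induction v) auto
    then have "set ?x \<subseteq> (\<Union>g\<in>\<Gamma>. set (out g))" "set ?y \<subseteq> (\<Union>g\<in>\<Gamma>. set (out g))"
    proof -
      assume a: "\<And>v. set v \<subseteq> \<Gamma> \<Longrightarrow> set (hom out v) \<subseteq> (\<Union>g\<in>\<Gamma>. set (out g))"
      have "map fst z \<in> lists \<Gamma>" using z(1) P_lists by blast
      then have "set ?w \<subseteq> \<Gamma>" unfolding z2 in_lists_conv_set by auto
      then show "set ?x \<subseteq> (\<Union>g\<in>\<Gamma>. set (out g))" by (rule a)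
      have "concat (e i) \<in> lists \<Gamma>" using e(1) P_lists by blast
      then have "set (concat (take ?t (e i))) \<subseteq> \<Gamma>"
        unfolding in_lists_conv_set by (auto dest: in_set_takeD)
      then show "set ?y \<subseteq> (\<Union>g\<in>\<Gamma>. set (out g))" unfolding y by (rule a)
    qed
    then have "set (fst (lag ?x ?y)) \<subseteq> (\<Union>g\<in>\<Gamma>. set (out g))" "set (snd (lag ?x ?y)) \<subseteq> (\<Union>g\<in>\<Gamma>. set (out g))"
      using lag_decomp[of ?x ?y] by (metis set_append Un_subset_iff)+
    ultimately have "lag ?x ?y \<in> lags" unfolding lags_def Let_def by (simp add: mem_Times_iff)
    then show ?thesis unfolding out_fst .
  qed
  with full show ?thesis unfolding close_def by blast
qed

text \<open>Take a family of pairwise far computations over the input of w that is as large as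
  possible. By \<open>near_pair\<close> it has at most k members, and by maximality every
  computation over that input is near to a member, so the outputs of the members serve as
  schedules.\<close>

lemma witness_exists:
  assumes "k > 0" "w \<in> P"
  shows "\<exists>d. map fst d = hom inp w \<and>
    (\<forall>z. map fst z \<in> P \<longrightarrow> hom schedule z = d \<longrightarrow> (\<exists>j<k. z \<in> close j))"
proof -
  let ?u = "hom inp w"
  define over where "over b \<longleftrightarrow> concat b \<in> P \<and> (\<forall>x\<in>set b. block x) \<and> hom inp (concat b) = ?u" for b
  define far where "far n e \<longleftrightarrow> (\<forall>i<n. over (e i)) \<and> (\<forall>i j. i < j \<and> j < n \<longrightarrow> \<not> near near_bound (e i) (e j))" for n :: nat and e
  have bound: "n \<le> k" if "far n e" for n e
  proof (rule ccontr)
    assume "\<not> n \<le> k"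
    then have ov: "over (e i)" if "i \<le> k" for i using \<open>far n e\<close> that unfolding far_def by simp
    have "\<exists>i j. i < j \<and> j \<le> k \<and> near (block_bound * nq ^ Suc k) (e i) (e j)"
    proof (rule near_pair)
      fix i assume i: "i \<le> k"
      show "concat (e i) \<in> P" using ov[OF i] unfolding over_def by blast
      show "map (hom inp) (e i) = map (\<lambda>a. [a]) ?u"
        using map_inp_blocks[of "e i"] ov[OF i] unfolding over_def by simp
      show "length (hom out b) \<le> block_bound" if "b \<in> set (e i)" for b
        using length_block[of "e i" b] ov[OF i] that unfolding over_def by blast
    qed
    then show False using \<open>far n e\<close> \<open>\<not> n \<le> k\<close> unfolding far_def near_bound_def by (meson le_less_trans not_le)
  qed
  from blocks_exist[OF input_first[OF assms(2)]] obtain b0 where "concat b0 = w" "\<forall>b\<in>set b0. block b" by blast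
  then have "far 1 (\<lambda>_. b0)" unfolding far_def over_def using assms(2) by simp
  then have "\<exists>n. (\<exists>e. far n e) \<and> (\<forall>m. (\<exists>e. far m e) \<longrightarrow> m \<le> n)"
    using Nat.ex_has_greatest_nat[of "\<lambda>n. \<exists>e. far n e" 1 k] bound by blast
  then obtain n e where fe: "far n e" and max: "\<And>m e. far m e \<Longrightarrow> m \<le> n" by blast
  have n: "n \<ge> 1" "n \<le> k" using max[OF \<open>far 1 (\<lambda>_. b0)\<close>] bound[OF fe] .
  have near: "\<exists>i<n. near near_bound (e i) b" if b: "over b" for b
  proof (rule ccontr)
    assume a: "\<not> (\<exists>i<n. near near_bound (e i) b)"
    have "far (Suc n) (e(n := b))"
      using fe b a unfolding far_def by (auto simp: less_Suc_eq)
    then show False using max by fastforce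
  qed
  let ?d = "witness n e ?u"
  have "\<exists>j<k. z \<in> close j" if z: "map fst z \<in> P" "hom schedule z = ?d" for z
  proof -
    from blocks_exist[OF input_first[OF z(1)]] obtain bs where
      bs: "concat bs = map fst z" "\<forall>b\<in>set bs. block b" by blast
    have "hom inp (map fst z) = ?u" using map_fst_schedule[of z] unfolding z(2) by (simp add: witness_def)
    then have "over bs" unfolding over_def using bs z(1) by simp
    from near[OF this] obtain i where i: "i < n" "near near_bound (e i) bs" by blast
    have ov: "over (e i)" using fe i(1) unfolding far_def by blast
    then have "length (e i) = length ?u"
      using arg_cong[OF map_inp_blocks[of "e i"], of length] unfolding over_def by simp
    then have "z \<in> close i"
      using close_to_witness[OF z i(1) bs _ _ i(2)] ov unfolding over_def by blast
    then show ?thesis using i(1) n(2) by (meson less_le_trans)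
  qed
  then show ?thesis by (intro exI[of _ ?d]) (simp add: witness_def)
qed

text \<open>The part K j consists of the computations close to the j-th schedule selected for their
  input. Closeness includes equality of the total outputs, so the output is that of the schedule and
  depends on the input alone.\<close>

theorem decomposition:
  assumes "k > 0"
  shows "\<exists>K. (\<forall>j<k. reg (K j)) \<and> P = (\<Union>j<k. K j) \<and>
    (\<forall>j<k. \<forall>w\<in>K j. \<forall>w'\<in>K j. hom inp w = hom inp w' \<longrightarrow> hom out w = hom out w')"
proof -
  let ?PZ = "{z :: ('g \<times> nat) list. map fst z \<in> P}"
  let ?bad = "?PZ \<inter> (\<Inter>j\<in>{..<k}. - close j)"
  have regPZ: "reg ?PZ" by (rule reg_vimage_map[OF reg_P])
  have len: "length (schedule e) \<le> 1" for e
    using inp_le_1[of "fst e"] by (simp add: schedule_def)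
  \<comment> \<open>These are the annotated inputs for which every computation carrying the
    annotation is close to some schedule; D selects one annotation per input among them.\<close>
  have "reg (- hom schedule ` ?bad)"
    by (intro reg_Compl reg_image_alphabetic reg_Int reg_INT reg_close regPZ len) simp
  from reg_uniformisation[OF this] obtain D where D: "D \<subseteq> - hom schedule ` ?bad" "reg D"
    "\<And>d d'. d \<in> D \<Longrightarrow> d' \<in> D \<Longrightarrow> map fst d = map fst d' \<Longrightarrow> d = d'"
    "\<And>d. d \<in> - hom schedule ` ?bad \<Longrightarrow> \<exists>d'\<in>D. map fst d' = map fst d" by metis
  define K where "K j = map fst ` (close j \<inter> ?PZ \<inter> {z. hom schedule z \<in> D})" for j
  have "reg (K j)" for j
    unfolding K_def by (intro reg_image_map reg_Int reg_close regPZ reg_vimage D(2))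
  moreover have "P = (\<Union>j<k. K j)"
  proof (intro equalityI subsetI)
    fix w assume w: "w \<in> P"
    from witness_exists[OF assms w] obtain d where d: "map fst d = hom inp w"
      "\<And>z. map fst z \<in> P \<Longrightarrow> hom schedule z = d \<Longrightarrow> \<exists>j<k. z \<in> close j" by blast
    have "d \<in> - hom schedule ` ?bad" using d(2) by blast
    from D(4)[OF this] obtain d' where d': "d' \<in> D" "map fst d' = hom inp w" using d(1) by auto
    from annotate[OF d'(2)] obtain z where z: "map fst z = w" "hom schedule z = d'" by blast
    have "z \<notin> ?bad" using D(1) d'(1) z(2) by blast
    then obtain j where "j < k" "z \<in> close j" using z(1) w by auto
    then show "w \<in> (\<Union>j<k. K j)" unfolding K_def using z w d'(1) by blast
  qed (auto simp: K_def)
  moreover have "hom out w = hom out w'" if "w \<in> K j" "w' \<in> K j" "hom inp w = hom inp w'" for j w w'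
  proof -
    have wo: "hom (wit_out j) v = hom (\<lambda>(a, n). wit n j) (hom schedule v)" for v
      unfolding hom_hom by (rule hom_cong) (simp add: wit_out_def)
    have cl: "hom out (map fst z) = hom (\<lambda>(a, n). wit n j) (hom schedule z)" if "z \<in> close j" for z
      using that unfolding close_def wo by (simp add: hom_map)
    from that(1) obtain z where z: "w = map fst z" "z \<in> close j" "hom schedule z \<in> D" unfolding K_def by blast
    from that(2) obtain z' where z': "w' = map fst z'" "z' \<in> close j" "hom schedule z' \<in> D" unfolding K_def by blast
    have "hom schedule z = hom schedule z'"
      using D(3)[OF z(3) z'(3)] that(3) unfolding map_fst_schedule z(1) z'(1) by blast
    then show ?thesis unfolding z(1) z'(1) cl[OF z(2)] cl[OF z'(2)] by simp
  qed
  ultimately show ?thesis by (intro exI[of _ K] conjI allI ballI impI) assumption+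
qed

end

section \<open>Paths\<close>

type_synonym ('q, 'a, 'b) trans = "'q \<times> ('a list \<times> 'b list) \<times> 'q"

definition tin :: "('q, 'a, 'b) trans \<Rightarrow> 'a list" where "tin t = fst (fst (snd t))"
definition tout :: "('q, 'a, 'b) trans \<Rightarrow> 'b list" where "tout t = snd (fst (snd t))"

lemma tin_simp [simp]: "tin (p, l, q) = fst l" and tout_simp [simp]: "tout (p, l, q) = snd l"
  by (simp_all add: tin_def tout_def)

fun tpath :: "('q, 'a, 'b) trans set \<Rightarrow> 'q \<Rightarrow> ('q, 'a, 'b) trans list \<Rightarrow> 'q \<Rightarrow> bool" where
  "tpath E p [] q \<longleftrightarrow> p = q"
| "tpath E p (t # c) q \<longleftrightarrow> t \<in> E \<and> fst t = p \<and> tpath E (snd (snd t)) c q"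

lemma tpath_append: "tpath E p (c @ d) q \<longleftrightarrow> (\<exists>r. tpath E p c r \<and> tpath E r d q)"
  by (induction c arbitrary: p) auto

lemma tpath_in_lists: "tpath E p c q \<Longrightarrow> c \<in> lists E"
  by (induction c arbitrary: p) auto

lemma tpath_closed:
  "tpath E p c q \<Longrightarrow> p \<in> Q \<Longrightarrow> (\<And>t. t \<in> E \<Longrightarrow> snd (snd t) \<in> Q) \<Longrightarrow> q \<in> Q"
  by (induction c arbitrary: p) auto

lemma computation_imp_tpath:
  "computation S p w q \<Longrightarrow> \<exists>c. tpath (transitions S) p c q \<and> hom tin c = fst w \<and> hom tout c = snd w"
proof (induction rule: computation.induct)
  case (empty p)
  then show ?case by (intro exI[of _ "[]"]) simp
next
  case (step p u x q v y r)
  then obtain c where "tpath (transitions S) q c r" "hom tin c = v" "hom tout c = y" by auto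
  then show ?case using step.hyps(1) by (intro exI[of _ "(p, (u, x), q) # c"]) simp
qed

lemma tpath_imp_computation:
  assumes "transducer A B S" "tpath (transitions S) p c q" "p \<in> states S"
  shows "computation S p (hom tin c, hom tout c) q"
  using assms(2,3)
proof (induction c arbitrary: p)
  case Nil
  then show ?case by (auto intro: computation.empty)
next
  case (Cons t c)
  obtain u x r where t: "t = (p, (u, x), r)" using Cons.prems by (cases t) auto
  have "t \<in> transitions S" using Cons.prems by simp
  moreover from this have "r \<in> states S" using assms(1) t unfolding transducer_def by auto
  ultimately show ?case using Cons t by (auto intro: computation.step)
qed

definition accepted :: "('q, 'a, 'b) transducer \<Rightarrow> ('q, 'a, 'b) trans list set" where
  "accepted S = {c. \<exists>p\<in>initial S. \<exists>q\<in>final S. tpath (transitions S) p c q}"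

lemma realised_eq:
  assumes "transducer A B S"
  shows "realised S = (\<lambda>c. (hom tin c, hom tout c)) ` accepted S"
proof (intro equalityI subsetI)
  fix w assume "w \<in> realised S"
  then obtain p q where pq: "p \<in> initial S" "q \<in> final S" "computation S p w q" unfolding realised_def by blast
  from computation_imp_tpath[OF pq(3)] obtain c where
    c: "tpath (transitions S) p c q" "hom tin c = fst w" "hom tout c = snd w" by blast
  have "c \<in> accepted S" unfolding accepted_def using pq c by blast
  then show "w \<in> (\<lambda>c. (hom tin c, hom tout c)) ` accepted S" using c by (intro image_eqI[where x = c]) simp_all
next
  fix w assume "w \<in> (\<lambda>c. (hom tin c, hom tout c)) ` accepted S"
  then obtain c p q where c: "w = (hom tin c, hom tout c)" "p \<in> initial S" "q \<in> final S"
    "tpath (transitions S) p c q" unfolding accepted_def by blast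
  have "p \<in> states S" using assms c(2) unfolding transducer_def by blast
  from tpath_imp_computation[OF assms c(4) this] show "w \<in> realised S" unfolding realised_def using c by blast
qed

lemma reg_accepted:
  assumes "transducer A B S"
  shows "reg (accepted S)"
proof (rule reg_stateI)
  let ?f = "\<lambda>w. {q. \<exists>p\<in>initial S. tpath (transitions S) p w q}"
  have "?f w \<subseteq> states S" for w
  proof
    fix q assume "q \<in> ?f w"
    then obtain p where "p \<in> initial S" "tpath (transitions S) p w q" by blast
    then show "q \<in> states S"
      using assms unfolding transducer_def by (elim tpath_closed) auto
  qed
  then show "finite (range ?f)"
    using assms unfolding transducer_def by (intro finite_subset[of "range ?f" "Pow (states S)"]) auto
  show "w' @ v \<in> accepted S" if "?f w = ?f w'" "w @ v \<in> accepted S" for w w' v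
  proof -
    from that(2) obtain p q where pq: "p \<in> initial S" "q \<in> final S" "tpath (transitions S) p (w @ v) q"
      unfolding accepted_def by blast
    then obtain r where r: "tpath (transitions S) p w r" "tpath (transitions S) r v q"
      unfolding tpath_append by blast
    then have "r \<in> ?f w'" unfolding that(1)[symmetric] using pq(1) by blast
    then obtain p' where "p' \<in> initial S" "tpath (transitions S) p' w' r" by blast
    then have "p' \<in> initial S" "tpath (transitions S) p' (w' @ v) q" using r(2) unfolding tpath_append by blast+
    then show ?thesis unfolding accepted_def using pq(2) by blast
  qed
qed

lemma reg_lq: "reg L \<Longrightarrow> reg (lq w L)"
  unfolding reg_def lq_append[symmetric] by (rule finite_subset[of _ "range (\<lambda>w. lq w L)"]) auto

text \<open>A transition labelled \<open>u|x\<close> is read as a letter without input that emits \<open>x\<close>,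
  followed by the letters of \<open>u\<close>; \<open>None\<close> is a marker for the start of the input.\<close>

definition expand :: "('q, 'a, 'b) trans \<Rightarrow> (('q, 'a, 'b) trans + 'a option) list" where
  "expand t = Inl t # map (\<lambda>a. Inr (Some a)) (tin t)"

definition inp :: "('q, 'a, 'b) trans + 'a option \<Rightarrow> 'a option list" where
  "inp g = (case g of Inl t \<Rightarrow> [] | Inr a \<Rightarrow> [a])"

definition out :: "('b \<Rightarrow> 'c list) \<Rightarrow> ('q, 'a, 'b) trans + 'a option \<Rightarrow> 'c list" where
  "out h g = (case g of Inl t \<Rightarrow> hom h (tout t) | Inr a \<Rightarrow> [])"

lemma inp_expand:
  fixes c :: "('q, 'a, 'b) trans list"
  shows "hom inp (hom expand c) = map Some (hom tin c)"
proof -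
  have "hom inp (expand t) = map Some (tin t)" for t :: "('q, 'a, 'b) trans"
    by (simp add: expand_def inp_def hom_map hom_singleton)
  then show ?thesis by (simp add: hom_hom map_hom)
qed

lemma out_expand:
  fixes c :: "('q, 'a, 'b) trans list" and h :: "'b \<Rightarrow> 'c list"
  shows "hom (out h) (hom expand c) = hom h (hom tout c)"
proof -
  have "hom (\<lambda>a. []) u = ([] :: 'c list)" for u :: "'a list" by (induction u) auto
  then have "hom (out h) (expand t) = hom h (tout t)" for t :: "('q, 'a, 'b) trans"
    by (simp add: expand_def out_def hom_map)
  then show ?thesis by (simp add: hom_hom)
qed

lemma inj_hom_expand: "inj (hom expand :: ('q, 'a, 'b) trans list \<Rightarrow> _)"
proof (rule inj_on_inverseI[where g = "hom (\<lambda>g. case g of Inl t \<Rightarrow> [t] | Inr a \<Rightarrow> [])"])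
  fix c :: "('q, 'a, 'b) trans list"
  have "hom (\<lambda>a. []) u = ([] :: ('q, 'a, 'b) trans list)" for u :: "'a list" by (induction u) auto
  then have "hom (\<lambda>g. case g of Inl t \<Rightarrow> [t] | Inr a \<Rightarrow> []) (expand t) = [t]" for t :: "('q, 'a, 'b) trans"
    by (simp add: expand_def hom_map)
  then show "hom (\<lambda>g. case g of Inl t \<Rightarrow> [t] | Inr a \<Rightarrow> []) (hom expand c) = c"
    by (simp add: hom_hom hom_singleton)
qed

text \<open>The marker in front provides a block for the silent letters that precede all input, as
  \<open>sync_language\<close> demands. The parts are carried back by the left quotient by the
  marker and the inverse image under the injective map \<open>hom expand\<close>.\<close>

lemma accepted_decomposition:
  fixes S :: "('q, 'a, 'b) transducer" and h :: "'b \<Rightarrow> nat list"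
  assumes S: "transducer A B S" and val: "valued k (then_apply (realised S) (hom h))" and "k > 0"
  shows "\<exists>K. (\<forall>j<k. reg (K j)) \<and> accepted S = (\<Union>j<k. K j) \<and>
    (\<forall>j<k. \<forall>c\<in>K j. \<forall>c'\<in>K j. hom tin c = hom tin c' \<longrightarrow> hom h (hom tout c) = hom h (hom tout c'))"
proof -
  let ?E = "transitions S"
  let ?L = "\<Union>t\<in>?E. set (tin t)"
  let ?G = "Inl ` ?E \<union> Inr ` insert None (Some ` ?L)"
  define P where "P = (#) (Inr None) ` hom expand ` accepted S"
  have finE: "finite ?E" using S unfolding transducer_def by simp
  have sub: "accepted S \<subseteq> lists ?E"
  proof
    fix c assume "c \<in> accepted S"
    then obtain p q where "tpath ?E p c q" unfolding accepted_def by blast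
    then show "c \<in> lists ?E" by (rule tpath_in_lists)
  qed
  have suff: "finite {r. \<exists>t\<in>?E. \<exists>s. s \<noteq> [] \<and> expand t = s @ r}"
  proof (rule finite_subset)
    show "{r. \<exists>t\<in>?E. \<exists>s. s \<noteq> [] \<and> expand t = s @ r} \<subseteq> (\<Union>t\<in>?E. set (suffixes (expand t)))"
      by (auto simp: suffix_def)
  qed (use finE in simp)
  \<comment> \<open>\<open>map the (tl u)\<close> strips the marker and the constructor
    \<open>Some\<close>; if u is not of that shape, no word of P has input u.\<close>
  have outs: "hom (out h) ` {w \<in> P. hom inp w = u} \<subseteq> then_apply (realised S) (hom h) `` {map the (tl u)}" for u
  proof (rule image_subsetI)
    fix w assume "w \<in> {w \<in> P. hom inp w = u}"
    then obtain c where c: "c \<in> accepted S" "w = Inr None # hom expand c" "hom inp w = u"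
      unfolding P_def by blast
    have "map the (tl u) = hom tin c"
      using c(3) unfolding c(2) by (auto simp: inp_def inp_expand comp_def)
    moreover have "hom (out h) w = hom h (hom tout c)" unfolding c(2) by (simp add: out_def out_expand)
    ultimately show "hom (out h) w \<in> then_apply (realised S) (hom h) `` {map the (tl u)}"
      using c(1) unfolding then_apply_def realised_eq[OF S] by auto
  qed
  have "expand t \<in> lists ?G" if "t \<in> ?E" for t
  proof -
    have "Inr (Some a) \<in> ?G" if "a \<in> set (tin t)" for a using that \<open>t \<in> ?E\<close> by blast
    then show ?thesis using that unfolding expand_def in_lists_conv_set by auto
  qed
  then have expand_lists: "hom expand c \<in> lists ?G" if "c \<in> lists ?E" for c
    using that by (induction c) (simp_all add: append_in_lists_conv)
  interpret sync_language P inp "out h" k ?G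
  proof
    show "reg P" unfolding P_def by (intro reg_Cons reg_image[OF reg_accepted[OF S] sub suff])
    show "finite (hom (out h) ` {w \<in> P. hom inp w = u})" for u
      by (rule finite_subset[OF outs]) (use val in \<open>simp add: valued_def\<close>)
    show "card (hom (out h) ` {w \<in> P. hom inp w = u}) \<le> k" for u
      using card_mono[OF _ outs[of u]] val unfolding valued_def by (meson le_trans)
    show "length (inp g) \<le> 1" for g :: "('q, 'a, 'b) trans + 'a option"
      by (simp add: inp_def split: sum.split)
    show "finite ?G" using finE by simp
    show "P \<subseteq> lists ?G"
    proof
      fix w assume "w \<in> P"
      then obtain c where "c \<in> accepted S" "w = Inr None # hom expand c" unfolding P_def by blast
      moreover from this(1) sub have "hom expand c \<in> lists ?G" by (intro expand_lists) blast
      ultimately show "w \<in> lists ?G" by simp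
    qed
    show "w = [] \<or> inp (hd w) \<noteq> []" if "w \<in> P" for w
      using that unfolding P_def by (auto simp: inp_def)
  qed
  from decomposition[OF \<open>k > 0\<close>] obtain K where K: "\<And>j. j < k \<Longrightarrow> reg (K j)" "P = (\<Union>j<k. K j)"
    "\<And>j w w'. j < k \<Longrightarrow> w \<in> K j \<Longrightarrow> w' \<in> K j \<Longrightarrow> hom inp w = hom inp w' \<Longrightarrow> hom (out h) w = hom (out h) w'"
    by metis
  define K' where "K' j = {c. hom expand c \<in> lq [Inr None] (K j)}" for j
  have "reg (K' j)" if "j < k" for j unfolding K'_def by (intro reg_vimage reg_lq K(1) that)
  moreover have "accepted S = (\<Union>j<k. K' j)"
  proof (rule set_eqI)
    fix c
    have "c \<in> accepted S \<longleftrightarrow> Inr None # hom expand c \<in> P"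
      unfolding P_def using inj_hom_expand by (auto simp: inj_def)
    also have "\<dots> \<longleftrightarrow> c \<in> (\<Union>j<k. K' j)" unfolding K(2) K'_def by simp
    finally show "c \<in> accepted S \<longleftrightarrow> c \<in> (\<Union>j<k. K' j)" .
  qed
  moreover have "hom h (hom tout c) = hom h (hom tout c')"
    if "j < k" "c \<in> K' j" "c' \<in> K' j" "hom tin c = hom tin c'" for j c c'
    using K(3)[OF that(1), of "Inr None # hom expand c" "Inr None # hom expand c'"] that(2-4)
    unfolding K'_def by (simp add: inp_expand out_expand out_def)
  ultimately show ?thesis by (intro exI[of _ K'] conjI allI ballI impI) assumption+
qed


section \<open>Certificates\<close>

text \<open>A state \<open>p\<close> of the constructed transducers lies over the state \<^term>\<open>pfst p\<close> of \<open>S\<close>.\<close>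

definition lifting ::
  "(nat, 'a, 'b) transducer \<Rightarrow> nat set \<Rightarrow> (nat, 'a, 'b) trans set \<Rightarrow> nat set \<Rightarrow> nat set list \<Rightarrow> bool" where
  "lifting S st tr ini fs \<longleftrightarrow>
     ini \<subseteq> st \<and> (\<forall>f\<in>set fs. f \<subseteq> st) \<and>
     (\<forall>p l q. (p, l, q) \<in> tr \<longrightarrow> p \<in> st \<and> q \<in> st \<and> (pfst p, l, pfst q) \<in> transitions S) \<and>
     (\<forall>p\<in>ini. pfst p \<in> initial S) \<and> (\<forall>f\<in>set fs. \<forall>p\<in>f. pfst p \<in> final S) \<and>
     (\<forall>p\<in>initial S. \<exists>p'\<in>ini. pfst p' = p) \<and>
     (\<forall>p'\<in>st. \<forall>l q. (pfst p', l, q) \<in> transitions S \<longrightarrow> (\<exists>q'. (p', l, q') \<in> tr \<and> pfst q' = q)) \<and>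
     (\<forall>p'\<in>st. pfst p' \<in> final S \<longrightarrow> (\<exists>f\<in>set fs. p' \<in> f))"

lemma liftingD:
  assumes "lifting S st tr ini fs"
  shows "ini \<subseteq> st" and "f \<in> set fs \<Longrightarrow> f \<subseteq> st"
    and "(p, l, q) \<in> tr \<Longrightarrow> p \<in> st" and "(p, l, q) \<in> tr \<Longrightarrow> q \<in> st"
    and "(p, l, q) \<in> tr \<Longrightarrow> (pfst p, l, pfst q) \<in> transitions S"
    and "p \<in> ini \<Longrightarrow> pfst p \<in> initial S" and "f \<in> set fs \<Longrightarrow> p \<in> f \<Longrightarrow> pfst p \<in> final S"
    and "a \<in> initial S \<Longrightarrow> \<exists>p'\<in>ini. pfst p' = a"
    and "p \<in> st \<Longrightarrow> (pfst p, l, b) \<in> transitions S \<Longrightarrow> \<exists>q'. (p, l, q') \<in> tr \<and> pfst q' = b"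
    and "p \<in> st \<Longrightarrow> pfst p \<in> final S \<Longrightarrow> \<exists>f\<in>set fs. p \<in> f"
  using assms unfolding lifting_def by (simp_all del: split_paired_All split_paired_Ex)

definition component ::
  "nat set \<Rightarrow> (nat, 'a, 'b) trans set \<Rightarrow> nat set \<Rightarrow> nat set \<Rightarrow> (nat, 'a, 'b) transducer" where
  "component st tr ini f = \<lparr>states = st, transitions = tr, initial = ini, final = f\<rparr>"

lemma component_simps [simp]:
  "states (component st tr ini f) = st" "transitions (component st tr ini f) = tr"
  "initial (component st tr ini f) = ini" "final (component st tr ini f) = f"
  by (simp_all add: component_def)

lemma transducer_component:
  assumes "transducer A B S" "lifting S st tr ini fs" "finite st" "finite tr" "f \<in> set fs"
  shows "transducer A B (component st tr ini f)"
proof -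
  have "transitions S \<subseteq> states S \<times> (lists A \<times> lists B) \<times> states S"
    using assms(1) unfolding transducer_def by simp
  then have "l \<in> lists A \<times> lists B" if "(p, l, q) \<in> tr" for p l q
    using liftingD(5)[OF assms(2) that] by blast
  then have "tr \<subseteq> st \<times> (lists A \<times> lists B) \<times> st"
    using liftingD(3,4)[OF assms(2)] by (intro subrelI) (metis (no_types, lifting) SigmaI prod.exhaust_sel)
  then show ?thesis
    using assms(3,4) liftingD(1)[OF assms(2)] liftingD(2)[OF assms(2,5)] unfolding transducer_def by simp
qed

text \<open>Paths of S lift, with their labels, to paths from any state above their origin, and
  paths above project down. The components differ only in their final states, and each state above a
  final state of S is final in one of them.\<close>

lemma lifting_realised:
  assumes S: "transducer A B S" and l: "lifting S st tr ini fs" and fin: "finite st" "finite tr"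
  shows "realised S = (\<Union>f\<in>set fs. realised (component st tr ini f))"
proof (intro equalityI subsetI)
  have up: "\<exists>d q'. tpath tr p' d q' \<and> q' \<in> st \<and> pfst q' = q \<and> hom tin d = hom tin c \<and> hom tout d = hom tout c"
    if "tpath (transitions S) (pfst p') c q" "p' \<in> st" for p' c q
    using that
  proof (induction c arbitrary: p')
    case Nil
    then show ?case by (intro exI[of _ "[]"] exI[of _ p']) simp
  next
    case (Cons t c)
    obtain lb r where t: "t = (pfst p', lb, r)" using Cons.prems by (cases t) auto
    then obtain r' where r': "(p', lb, r') \<in> tr" "pfst r' = r"
      using liftingD(9)[OF l, of p' lb r] Cons.prems by auto
    then have "r' \<in> st" using liftingD(4)[OF l] by blast
    moreover have "tpath (transitions S) (pfst r') c q" using Cons.prems(1) t r'(2) by simp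
    ultimately obtain d q' where "tpath tr r' d q'" "q' \<in> st" "pfst q' = q"
      "hom tin d = hom tin c" "hom tout d = hom tout c" using Cons.IH by blast
    then show ?case using t r'(1)
      by (intro exI[of _ "(p', lb, r') # d"] exI[of _ q']) simp
  qed
  fix w assume "w \<in> realised S"
  then obtain c p q where c: "w = (hom tin c, hom tout c)" "p \<in> initial S" "q \<in> final S"
    "tpath (transitions S) p c q" unfolding realised_eq[OF S] accepted_def by blast
  from liftingD(1,8)[OF l] c(2) obtain p' where p': "p' \<in> ini" "pfst p' = p" "p' \<in> st" by blast
  from up[of p' c q] c(4) p' obtain d q' where d: "tpath tr p' d q'" "q' \<in> st" "pfst q' = q"
    "hom tin d = hom tin c" "hom tout d = hom tout c" by auto
  from liftingD(10)[OF l d(2)] d(3) c(3) obtain f where f: "f \<in> set fs" "q' \<in> f" by blast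
  have "d \<in> accepted (component st tr ini f)" unfolding accepted_def using p' d f by auto
  then have "w \<in> realised (component st tr ini f)"
    unfolding realised_eq[OF transducer_component[OF S l fin f(1)]] c(1) using d by (intro image_eqI[where x = d]) simp_all
  then show "w \<in> (\<Union>f\<in>set fs. realised (component st tr ini f))" using f(1) by blast
next
  have down: "\<exists>c. tpath (transitions S) (pfst p') c (pfst q') \<and> hom tin c = hom tin d \<and> hom tout c = hom tout d"
    if "tpath tr p' d q'" for p' d q'
    using that
  proof (induction d arbitrary: p')
    case Nil
    then show ?case by (intro exI[of _ "[]"]) simp
  next
    case (Cons t d)
    obtain lb r where t: "t = (p', lb, r)" using Cons.prems by (cases t) auto
    have "(pfst p', lb, pfst r) \<in> transitions S" using liftingD(5)[OF l] Cons.prems t by auto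
    moreover obtain c where "tpath (transitions S) (pfst r) c (pfst q')" "hom tin c = hom tin d" "hom tout c = hom tout d"
      using Cons t by auto
    ultimately show ?case using t
      by (intro exI[of _ "(pfst p', lb, pfst r) # c"]) simp
  qed
  fix w assume "w \<in> (\<Union>f\<in>set fs. realised (component st tr ini f))"
  then obtain f where f: "f \<in> set fs" "w \<in> realised (component st tr ini f)" by blast
  then obtain d p q where d: "w = (hom tin d, hom tout d)" "p \<in> ini" "q \<in> f" "tpath tr p d q"
    unfolding realised_eq[OF transducer_component[OF S l fin f(1)]] accepted_def by auto
  from down[OF d(4)] obtain c where c: "tpath (transitions S) (pfst p) c (pfst q)"
    "hom tin c = hom tin d" "hom tout c = hom tout d" by blast
  have "pfst p \<in> initial S" "pfst q \<in> final S" using liftingD(6,7)[OF l] d(2,3) f(1) by blast+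
  then have "c \<in> accepted S" unfolding accepted_def using c(1) by blast
  then show "w \<in> realised S" unfolding realised_eq[OF S] d(1) using c by (intro image_eqI[where x = c]) simp_all
qed

section \<open>Functionality of the components and its certificates\<close>

definition functional_paths ::
  "('b \<Rightarrow> 'c list) \<Rightarrow> ('q, 'a, 'b) trans set \<Rightarrow> 'q set \<Rightarrow> 'q set \<Rightarrow> bool" where
  "functional_paths h tr ini f \<longleftrightarrow> (\<forall>p c q p' c' q'. p \<in> ini \<and> p' \<in> ini \<and> q \<in> f \<and> q' \<in> f \<and>
     tpath tr p c q \<and> tpath tr p' c' q' \<and> hom tin c = hom tin c' \<longrightarrow>
     hom h (hom tout c) = hom h (hom tout c'))"

text \<open>The product of S with one automaton that tracks the quotients of all \<open>K j\<close>
  at once. A state thus knows membership in every part, so the components can share states and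
  transitions.\<close>

lemma lifting_exists:
  fixes S :: "(nat, 'a, 'b) transducer" and h :: "'b \<Rightarrow> nat list"
  assumes S: "transducer A B S" and val: "valued k (then_apply (realised S) (hom h))" and "k > 0"
  shows "\<exists>st tr ini fs. finite st \<and> finite tr \<and> length fs = k \<and> lifting S st tr ini fs \<and>
    (\<forall>f\<in>set fs. functional_paths h tr ini f)"
proof -
  let ?E = "transitions S"
  from accepted_decomposition[OF assms] obtain K where K: "\<And>j. j < k \<Longrightarrow> reg (K j)"
    "accepted S = (\<Union>j<k. K j)"
    "\<And>j c c'. j < k \<Longrightarrow> c \<in> K j \<Longrightarrow> c' \<in> K j \<Longrightarrow> hom tin c = hom tin c' \<Longrightarrow> hom h (hom tout c) = hom h (hom tout c')"
    by metis
  define \<delta> where "\<delta> c = map (\<lambda>j. lq c (K j)) [0..<k]" for c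
  have "finite (range \<delta>)"
  proof (rule finite_subset)
    let ?Q = "\<Union>j<k. range (\<lambda>w. lq w (K j))"
    have "lq c (K j) \<in> ?Q" if "j < k" for c j using that by blast
    then have "set (\<delta> c) \<subseteq> ?Q \<and> length (\<delta> c) = k" for c unfolding \<delta>_def by (simp add: image_subset_iff)
    then show "range \<delta> \<subseteq> {xs. set xs \<subseteq> ?Q \<and> length xs = k}" by blast
    show "finite {xs. set xs \<subseteq> ?Q \<and> length xs = k}"
      by (rule finite_lists_length_eq) (use K(1) in \<open>auto simp: reg_def\<close>)
  qed
  \<comment> \<open>The tuples of quotients are numbered so that a state of the product is again a
    natural number.\<close>
  then obtain idx :: "_ \<Rightarrow> nat" where idx: "inj_on idx (range \<delta>)"
    using finite_imp_inj_to_nat_seg by metis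
  define m where "m c = idx (\<delta> c)" for c
  have fin_m: "finite (range m)"
    unfolding m_def using finite_imageI[OF \<open>finite (range \<delta>)\<close>, of idx] by (simp add: image_image)
  have m_lq: "lq c (K j) = lq c' (K j)" if "m c = m c'" "j < k" for c c' j
  proof -
    have "\<delta> c = \<delta> c'" using that(1) idx unfolding m_def by (auto dest: inj_onD)
    then show ?thesis using arg_cong[of "\<delta> c" "\<delta> c'" "\<lambda>xs. xs ! j"] that(2) unfolding \<delta>_def by simp
  qed
  \<comment> \<open>So \<open>m\<close> behaves like a deterministic state, and the targets in
    \<open>tr\<close> do not depend on the path c that represents it.\<close>
  have m_append: "m (c @ d) = m (c' @ d)" if "m c = m c'" for c c' d
  proof -
    have "\<delta> (c @ d) = \<delta> (c' @ d)" unfolding \<delta>_def lq_append using m_lq[OF that] by simp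
    then show ?thesis unfolding m_def by simp
  qed
  define R where "R c p \<longleftrightarrow> (\<exists>i\<in>initial S. tpath ?E i c p)" for c p
  have R_states: "p \<in> states S" if "R c p" for c p
    using that S unfolding R_def transducer_def by (elim bexE tpath_closed) auto
  have R_step: "R (c @ [(p, l, q)]) q" if "R c p" "(p, l, q) \<in> ?E" for c p l q
    using that unfolding R_def tpath_append by auto
  define st where "st = {prod_encode (p, m c) | p c. R c p}"
  define ini where "ini = {prod_encode (p, m []) | p. p \<in> initial S}"
  define tr where "tr = {(prod_encode (p, m c), l, prod_encode (q, m (c @ [(p, l, q)]))) | p c l q.
     R c p \<and> (p, l, q) \<in> ?E}"
  define fin where "fin j = {prod_encode (p, m c) | p c. R c p \<and> p \<in> final S \<and> c \<in> K j}" for j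
  have "finite st"
  proof (rule finite_subset)
    show "st \<subseteq> prod_encode ` (states S \<times> range m)" unfolding st_def using R_states by auto
    show "finite (prod_encode ` (states S \<times> range m))"
      using fin_m S unfolding transducer_def by simp
  qed
  moreover have "finite tr"
  proof (rule finite_subset)
    show "tr \<subseteq> st \<times> (fst \<circ> snd) ` ?E \<times> st"
    proof
      fix e assume "e \<in> tr"
      then obtain p c l q where e: "e = (prod_encode (p, m c), l, prod_encode (q, m (c @ [(p, l, q)])))"
        "R c p" "(p, l, q) \<in> ?E" unfolding tr_def by blast
      have "prod_encode (p, m c) \<in> st" "prod_encode (q, m (c @ [(p, l, q)])) \<in> st"
        unfolding st_def using e(2) R_step[OF e(2,3)] by blast+
      moreover have "l \<in> (fst \<circ> snd) ` ?E" using e(3) by (rule rev_image_eqI) simp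
      ultimately show "e \<in> st \<times> (fst \<circ> snd) ` ?E \<times> st" unfolding e(1) by blast
    qed
    show "finite (st \<times> (fst \<circ> snd) ` ?E \<times> st)"
      using \<open>finite st\<close> S unfolding transducer_def by simp
  qed
  moreover have "lifting S st tr ini (map fin [0..<k])"
    unfolding lifting_def
  proof (intro conjI ballI allI impI)
    have R_Nil: "R [] p" if "p \<in> initial S" for p using that unfolding R_def by auto
    then show "ini \<subseteq> st" unfolding ini_def st_def by blast
    show "f \<subseteq> st" if "f \<in> set (map fin [0..<k])" for f using that unfolding st_def fin_def by auto
    fix p l q assume "(p, l, q) \<in> tr"
    then obtain p0 c q0 where e: "p = prod_encode (p0, m c)" "q = prod_encode (q0, m (c @ [(p0, l, q0)]))"
      "R c p0" "(p0, l, q0) \<in> ?E" unfolding tr_def by blast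
    show "p \<in> st" unfolding st_def using e by blast
    show "q \<in> st" unfolding st_def using e R_step by blast
    show "(pfst p, l, pfst q) \<in> ?E" using e by simp
  next
    show "pfst p \<in> initial S" if "p \<in> ini" for p using that unfolding ini_def by auto
    show "pfst p \<in> final S" if "f \<in> set (map fin [0..<k])" "p \<in> f" for f p
      using that unfolding fin_def by auto
    show "\<exists>p'\<in>ini. pfst p' = p" if "p \<in> initial S" for p
      using that unfolding ini_def by (intro bexI[of _ "prod_encode (p, m [])"]) auto
    fix p' assume "p' \<in> st"
    then obtain p c where p: "p' = prod_encode (p, m c)" "R c p" unfolding st_def by blast
    show "\<exists>q'. (p', l, q') \<in> tr \<and> pfst q' = q" if "(pfst p', l, q) \<in> ?E" for l q
    proof -
      have "(p, l, q) \<in> ?E" using that p(1) by simp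
      then have "(p', l, prod_encode (q, m (c @ [(p, l, q)]))) \<in> tr" unfolding tr_def p(1) using p(2) by blast
      then show ?thesis by (rule exI[where x = "prod_encode (q, m (c @ [(p, l, q)]))", OF conjI]) simp
    qed
    show "\<exists>f\<in>set (map fin [0..<k]). p' \<in> f" if "pfst p' \<in> final S"
    proof -
      have "c \<in> accepted S" using that p unfolding accepted_def R_def by auto
      then obtain j where "j < k" "c \<in> K j" unfolding K(2) by blast
      then show ?thesis using that p by (intro bexI[of _ "fin j"]) (auto simp: fin_def)
    qed
  qed
  moreover have "functional_paths h tr ini f" if "f \<in> set (map fin [0..<k])" for f
  proof -
    from that obtain j where j: "j < k" "f = fin j" by auto
    let ?\<pi> = "map (\<lambda>(p, l, q). (pfst p, l, pfst q))"
    have state: "psnd q = m (?\<pi> c)" if "tpath tr p c q" "psnd p = m []" for p c q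
      using that
    proof (induction c arbitrary: q rule: rev_induct)
      case (snoc t c)
      then obtain r where r: "tpath tr p c r" "tpath tr r [t] q" unfolding tpath_append by blast
      then obtain p0 c0 l q0 where t: "t = (prod_encode (p0, m c0), l, prod_encode (q0, m (c0 @ [(p0, l, q0)])))"
        unfolding tr_def by auto
      have "m (?\<pi> c) = m c0" using snoc.IH[OF r(1) snoc.prems(2)] r(2) t by auto
      then have "m (?\<pi> c @ [(p0, l, q0)]) = m (c0 @ [(p0, l, q0)])" by (rule m_append)
      then show ?case using r(2) t by auto
    qed simp
    have in_K: "?\<pi> c \<in> K j" if "tpath tr p c q" "p \<in> ini" "q \<in> f" for p c q
    proof -
      have "psnd q = m (?\<pi> c)" using that(2) by (intro state[OF that(1)]) (auto simp: ini_def)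
      moreover from that(3) obtain c1 where "psnd q = m c1" "c1 \<in> K j" unfolding j(2) fin_def by auto
      ultimately have "m (?\<pi> c) = m c1" by simp
      \<comment> \<open>A word belongs to \<open>K j\<close> iff its quotient contains the empty
        word, so membership depends on the state only.\<close>
      from m_lq[OF this j(1)] have "[] \<in> lq (?\<pi> c) (K j) \<longleftrightarrow> [] \<in> lq c1 (K j)" by (rule arg_cong)
      then show ?thesis using \<open>c1 \<in> K j\<close> by simp
    qed
    have labels: "hom tin (?\<pi> c) = hom tin c" "hom tout (?\<pi> c) = hom tout c" for c :: "(nat, 'a, 'b) trans list"
      by (induction c) auto
    show ?thesis unfolding functional_paths_def
    proof (intro allI impI, elim conjE)
      fix p c q p' c' q'
      assume "p \<in> ini" "p' \<in> ini" "q \<in> f" "q' \<in> f" "tpath tr p c q" "tpath tr p' c' q'"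
        and eq: "hom tin c = hom tin c'"
      then have "?\<pi> c \<in> K j" "?\<pi> c' \<in> K j" using in_K by simp_all
      from K(3)[OF j(1) this] show "hom h (hom tout c) = hom h (hom tout c')"
        unfolding labels using eq by simp
    qed
  qed
  ultimately show ?thesis by (intro exI[of _ st] exI[of _ tr] exI[of _ ini] exI[of _ "map fin [0..<k]"]) simp
qed

text \<open>A configuration \<open>(p, q, u, u', x, x')\<close> stands for two computations ending in \<open>p\<close> and \<open>q\<close>
  whose inputs and outputs, after removal of common prefixes, leave \<open>u\<close>, \<open>u'\<close> and \<open>x\<close>, \<open>x'\<close>. The
  computation that is not ahead on the input moves next.\<close>

definition dead :: "('q, 'a, 'b) trans set \<Rightarrow> 'q set list \<Rightarrow> ('q \<times> 'q \<times> 'a list \<times> 'a list) set \<Rightarrow> bool" where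
  "dead tr fs X \<longleftrightarrow>
     (\<forall>p q u u'. (p, q, u, u') \<in> X \<longrightarrow> (q, p, u', u) \<in> X) \<and>
     (\<forall>p q z a b y p2. (p, q, [], z @ b) \<in> X \<longrightarrow> (p, (z @ a, y), p2) \<in> tr \<longrightarrow> a = [] \<or> b = [] \<longrightarrow>
        (p2, q, a, b) \<in> X) \<and>
     (\<forall>p q. (p, q, [], []) \<in> X \<longrightarrow> (\<forall>f\<in>set fs. \<not> (p \<in> f \<and> q \<in> f)))"

text \<open>D is an invariant. In the third clause the left side reads \<open>z @ a\<close>, of
  which z is matched with the surplus \<open>z @ b\<close> of the right side; symmetry covers moves
  of the right side. Any common output prefix z' may be dropped, not only the longest, because
  soundness merely prepends it again.\<close>

definition certified :: "('b \<Rightarrow> 'c list) \<Rightarrow> ('q, 'a, 'b) trans set \<Rightarrow> 'q set \<Rightarrow> 'q set list \<Rightarrow>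
    ('q \<times> 'q \<times> 'a list \<times> 'a list \<times> 'c list \<times> 'c list) set \<Rightarrow> ('q \<times> 'q \<times> 'a list \<times> 'a list) set \<Rightarrow> bool" where
  "certified h tr ini fs D X \<longleftrightarrow>
     (\<forall>p\<in>ini. \<forall>q\<in>ini. (p, q, [], [], [], []) \<in> D \<or> (p, q, [], []) \<in> X) \<and>
     (\<forall>p q u u' x x'. (p, q, u, u', x, x') \<in> D \<longrightarrow> (q, p, u', u, x', x) \<in> D) \<and>
     (\<forall>p q z a b x x' y p2. (p, q, [], z @ b, x, x') \<in> D \<longrightarrow> (p, (z @ a, y), p2) \<in> tr \<longrightarrow> a = [] \<or> b = [] \<longrightarrow>
        (p2, q, a, b) \<in> X \<or>
        (\<exists>z' x2 x2'. (p2, q, a, b, x2, x2') \<in> D \<and> x @ hom h y = z' @ x2 \<and> x' = z' @ x2')) \<and>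
     (\<forall>p q x x'. (p, q, [], [], x, x') \<in> D \<longrightarrow> (\<forall>f\<in>set fs. p \<in> f \<and> q \<in> f \<longrightarrow> x = x'))"

lemma deadD:
  assumes "dead tr fs X"
  shows "(p, q, u, u') \<in> X \<Longrightarrow> (q, p, u', u) \<in> X"
    and "(p, q, [], z @ b) \<in> X \<Longrightarrow> (p, (z @ a, y), p2) \<in> tr \<Longrightarrow> a = [] \<or> b = [] \<Longrightarrow> (p2, q, a, b) \<in> X"
    and "(p, q, [], []) \<in> X \<Longrightarrow> f \<in> set fs \<Longrightarrow> p \<in> f \<Longrightarrow> q \<in> f \<Longrightarrow> False"
proof (goal_cases)
  case 1
  then show ?case by (rule assms[unfolded dead_def, THEN conjunct1, rule_format])
next
  case 2
  then show ?case by (rule assms[unfolded dead_def, THEN conjunct2, THEN conjunct1, rule_format])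
next
  case 3
  then show ?case using assms[unfolded dead_def, THEN conjunct2, THEN conjunct2, rule_format] by simp
qed

lemma certifiedD:
  assumes "certified h tr ini fs D X"
  shows "p \<in> ini \<Longrightarrow> q \<in> ini \<Longrightarrow> (p, q, [], [], [], []) \<in> D \<or> (p, q, [], []) \<in> X"
    and "(p, q, u, u', x, x') \<in> D \<Longrightarrow> (q, p, u', u, x', x) \<in> D"
    and "(p, q, [], z @ b, x, x') \<in> D \<Longrightarrow> (p, (z @ a, y), p2) \<in> tr \<Longrightarrow> a = [] \<or> b = [] \<Longrightarrow>
        (p2, q, a, b) \<in> X \<or> (\<exists>z' x2 x2'. (p2, q, a, b, x2, x2') \<in> D \<and> x @ hom h y = z' @ x2 \<and> x' = z' @ x2')"
    and "(p, q, [], [], x, x') \<in> D \<Longrightarrow> f \<in> set fs \<Longrightarrow> p \<in> f \<Longrightarrow> q \<in> f \<Longrightarrow> x = x'"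
proof (goal_cases)
  case 1
  then show ?case by (rule assms[unfolded certified_def, THEN conjunct1, rule_format])
next
  case 2
  then show ?case by (rule assms[unfolded certified_def, THEN conjunct2, THEN conjunct1, rule_format])
next
  case 3
  then show ?case
    by (rule assms[unfolded certified_def, THEN conjunct2, THEN conjunct2, THEN conjunct1, rule_format])
next
  case 4
  then show ?case
    using assms[unfolded certified_def, THEN conjunct2, THEN conjunct2, THEN conjunct2, rule_format] by simp
qed

lemma lag_step:
  assumes "lag U U' = ([], z @ b)" "a = [] \<or> b = []"
  shows "lag (U @ z @ a) U' = (a, b)"
proof -
  obtain w where "U = w" "U' = w @ z @ b" using lag_decomp[of U U'] assms(1) by auto
  then show ?thesis using lag_append_same[of "w @ z" a b] lag_one_Nil[OF assms(2)] by simp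
qed

lemma common_prefix_cases:
  fixes v :: "'a list"
  assumes "v @ w = u @ w'"
  shows "\<exists>z a b. v = z @ a \<and> u = z @ b \<and> (a = [] \<or> b = []) \<and> a @ w = b @ w'"
proof -
  from assms consider (1) us where "v = u @ us" "us @ w = w'" | (2) us where "v @ us = u" "w = us @ w'"
    unfolding append_eq_append_conv2 by blast
  then show ?thesis
  proof cases
    case 1
    then have "v = u @ us \<and> u = u @ [] \<and> (us = [] \<or> ([] :: 'a list) = []) \<and> us @ w = [] @ w'" by simp
    then show ?thesis by blast
  next
    case 2
    then have "v = v @ [] \<and> u = v @ us \<and> (([] :: 'a list) = [] \<or> us = []) \<and> [] @ w = us @ w'" by simp
    then show ?thesis by blast
  qed
qed

text \<open>Dead configurations have no common completion, so they satisfy the claim for all \<open>x\<close> and \<open>x'\<close>.\<close>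

lemma certified_completions:
  assumes D: "certified h tr ini fs D X" and X: "dead tr fs X" and f: "f \<in> set fs"
  shows "(p, q, u, u', x, x') \<in> D \<or> (p, q, u, u') \<in> X \<Longrightarrow> u = [] \<or> u' = [] \<Longrightarrow>
    tpath tr p c r \<Longrightarrow> tpath tr q c' r' \<Longrightarrow> r \<in> f \<Longrightarrow> r' \<in> f \<Longrightarrow> u @ hom tin c = u' @ hom tin c' \<Longrightarrow>
    x @ hom h (hom tout c) = x' @ hom h (hom tout c')"
proof (induction "length c + length c'" arbitrary: p q u u' x x' c c' r r' rule: less_induct)
  case less
  have left: "x @ hom h (hom tout (t # d)) = x' @ hom h (hom tout d')"
    if DX: "(p, q, [], u', x, x') \<in> D \<or> (p, q, [], u') \<in> X"
      and that': "tpath tr p (t # d) r" "tpath tr q d' r'" "r \<in> f" "r' \<in> f"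
      "hom tin (t # d) = u' @ hom tin d'" "length (t # d) + length d' = length c + length c'"
    for p q u' x x' t d d' r r'
  proof -
    from that'(1) obtain v y p2 where t: "t = (p, (v, y), p2)" "(p, (v, y), p2) \<in> tr" "tpath tr p2 d r"
      by (cases t) auto
    have "v @ hom tin d = u' @ hom tin d'" using that'(5) t(1) by simp
    then obtain z a b where z: "v = z @ a" "u' = z @ b" "a = [] \<or> b = []" "a @ hom tin d = b @ hom tin d'"
      using common_prefix_cases by blast
    have "\<exists>z' x2 x2'. ((p2, q, a, b, x2, x2') \<in> D \<or> (p2, q, a, b) \<in> X) \<and> x @ hom h y = z' @ x2 \<and> x' = z' @ x2'"
    proof (cases "(p2, q, a, b) \<in> X")
      case True
      then have "((p2, q, a, b, x @ hom h y, x') \<in> D \<or> (p2, q, a, b) \<in> X) \<and>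
        x @ hom h y = [] @ (x @ hom h y) \<and> x' = [] @ x'" by simp
      then show ?thesis by blast
    next
      case False
      then have "(p, q, [], u') \<notin> X" using deadD(2)[OF X, of p q z b a y p2] t(2) z(1-3) by auto
      then have "(p, q, [], z @ b, x, x') \<in> D" using DX z(2) by simp
      from certifiedD(3)[OF D this t(2)[unfolded z(1)] z(3)] False show ?thesis by blast
    qed
    then obtain z' x2 x2' where
      x2: "(p2, q, a, b, x2, x2') \<in> D \<or> (p2, q, a, b) \<in> X" "x @ hom h y = z' @ x2" "x' = z' @ x2'"
      by blast
    have "length d + length d' < length c + length c'" using that'(6) by simp
    then have "x2 @ hom h (hom tout d) = x2' @ hom h (hom tout d')"
      using less.hyps[OF _ x2(1) z(3) t(3) that'(2-4) z(4)] by blast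
    then have "(x @ hom h y) @ hom h (hom tout d) = x' @ hom h (hom tout d')" unfolding x2(2,3) by simp
    then show ?thesis unfolding t(1) by simp
  qed
  show ?case
  proof (cases "u = [] \<and> c \<noteq> []")
    case True
    then obtain t d where "c = t # d" by (cases c) auto
    then show ?thesis using left[of p q u' x x' t d r c' r'] less.prems True by simp
  next
    case F1: False
    show ?thesis
    proof (cases "u' = [] \<and> c' \<noteq> []")
      case True
      then obtain t d where "c' = t # d" by (cases c') auto
      moreover have "(q, p, u', u, x', x) \<in> D \<or> (q, p, u', u) \<in> X"
        using less.prems(1) certifiedD(2)[OF D] deadD(1)[OF X] by blast
      ultimately show ?thesis using left[of q p u x' x t d r' c r] less.prems True by simp
    next
      case F2: False
      have "u = [] \<and> u' = [] \<and> c = [] \<and> c' = []" using F1 F2 less.prems(2,7) by (cases "u = []") auto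
      then show ?thesis
        using certifiedD(4)[OF D _ f, of p q x x'] deadD(3)[OF X _ f, of p q] less.prems by auto
    qed
  qed
qed

lemma certified_sound:
  assumes D: "certified h tr ini fs D X" and X: "dead tr fs X" and f: "f \<in> set fs"
  shows "functional_paths h tr ini f"
  unfolding functional_paths_def
proof (intro allI impI, elim conjE)
  fix p c q p' c' q'
  assume a: "p \<in> ini" "p' \<in> ini" "q \<in> f" "q' \<in> f" "tpath tr p c q" "tpath tr p' c' q'" "hom tin c = hom tin c'"
  from certified_completions[OF D X f certifiedD(1)[OF D a(1,2)] _ a(5,6,3,4)] a(7)
  show "hom h (hom tout c) = hom h (hom tout c')" by simp
qed

text \<open>X collects the configurations without common completion, D the reached ones that have
  one. A completion turns both computations into successful ones over one input, where functionality
  forces equal outputs; so a fixed completion determines the output delay, and D is finite.\<close>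

lemma certificate_exists:
  fixes st :: "'q set" and tr :: "('q, 'a, 'b) trans set" and h :: "'b \<Rightarrow> 'c list"
  assumes fin: "finite st" "finite tr"
    and tr: "\<And>p l q. (p, l, q) \<in> tr \<Longrightarrow> q \<in> st" and ini: "ini \<subseteq> st"
    and fp: "\<And>f. f \<in> set fs \<Longrightarrow> functional_paths h tr ini f"
  shows "\<exists>D X. finite D \<and> finite X \<and> dead tr fs X \<and> certified h tr ini fs D X"
proof -
  define L where "L = (\<Union>t\<in>tr. set (tin t))"
  \<comment> \<open>The sum bounds the length of each single input label, hence of each pending
    input.\<close>
  define M where "M = (\<Sum>t\<in>tr. length (tin t))"
  define W where "W = {w. set w \<subseteq> L \<and> length w \<le> M}"
  have finW: "finite W" unfolding W_def L_def by (rule finite_lists_length_le) (use fin in simp)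
  have W_Nil: "[] \<in> W" unfolding W_def by simp
  have W_tr: "a \<in> W" if "(p, (z @ a, y), q) \<in> tr" for p z a y q
  proof -
    have "length (z @ a) \<le> M" unfolding M_def
      using member_le_sum[OF that, of "\<lambda>t. length (tin t)"] fin(2) by simp
    moreover have "set (z @ a) \<subseteq> L" unfolding L_def using that by force
    ultimately show ?thesis unfolding W_def by simp
  qed
  have W_suffix: "b \<in> W" if "z @ b \<in> W" for z b using that unfolding W_def by simp
  define comp where "comp p q u u' e e' \<longleftrightarrow> (\<exists>f\<in>set fs. \<exists>r\<in>f. \<exists>r'\<in>f. tpath tr p e r \<and> tpath tr q e' r' \<and>
     u @ hom tin e = u' @ hom tin e')" for p q u u' e e'
  have comp_sym: "comp p q u u' e e' \<Longrightarrow> comp q p u' u e' e" for p q u u' e e'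
    unfolding comp_def by (metis (no_types))
  define live where "live p q u u' \<longleftrightarrow> (\<exists>e e'. comp p q u u' e e')" for p q u u'
  have live_sym: "live p q u u' \<longleftrightarrow> live q p u' u" for p q u u'
    unfolding live_def using comp_sym by blast
  have live_step: "live p q [] (z @ b)"
    if "live p2 q a b" "(p, (z @ a, y), p2) \<in> tr" for p q z a b y p2
  proof -
    from that(1) obtain e e' f r r' where e: "f \<in> set fs" "r \<in> f" "r' \<in> f" "tpath tr p2 e r" "tpath tr q e' r'"
      "a @ hom tin e = b @ hom tin e'" unfolding live_def comp_def by blast
    have "tpath tr p ((p, (z @ a, y), p2) # e) r" using e that(2) by simp
    moreover have "[] @ hom tin ((p, (z @ a, y), p2) # e) = (z @ b) @ hom tin e'" using e(6) by simp
    ultimately show ?thesis unfolding live_def comp_def using e(1-3,5) by blast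
  qed
  define X where "X = {(p, q, u, u'). p \<in> st \<and> q \<in> st \<and> u \<in> W \<and> u' \<in> W \<and> \<not> live p q u u'}"
  define reach where "reach p q U U' Y Y' \<longleftrightarrow> (\<exists>i\<in>ini. \<exists>i'\<in>ini. \<exists>c c'. tpath tr i c p \<and> tpath tr i' c' q \<and>
     U = hom tin c \<and> U' = hom tin c' \<and> Y = hom h (hom tout c) \<and> Y' = hom h (hom tout c'))" for p q U U' Y Y'
  define D where "D = {(p, q, u, u', x, x'). p \<in> st \<and> q \<in> st \<and> u \<in> W \<and> u' \<in> W \<and> live p q u u' \<and>
     (u = [] \<or> u' = []) \<and> (\<exists>U U' Y Y'. reach p q U U' Y Y' \<and> lag U U' = (u, u') \<and> lag Y Y' = (x, x'))}"
  have D_iff: "(p, q, u, u', x, x') \<in> D \<longleftrightarrow> p \<in> st \<and> q \<in> st \<and> u \<in> W \<and> u' \<in> W \<and> live p q u u' \<and>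
     (u = [] \<or> u' = []) \<and> (\<exists>U U' Y Y'. reach p q U U' Y Y' \<and> lag U U' = (u, u') \<and> lag Y Y' = (x, x'))"
    for p q u u' x x' unfolding D_def by simp
  have X_iff: "(p, q, u, u') \<in> X \<longleftrightarrow> p \<in> st \<and> q \<in> st \<and> u \<in> W \<and> u' \<in> W \<and> \<not> live p q u u'" for p q u u'
    unfolding X_def by simp
  have lag_swap: "lag b a = (y, x)" if "lag a b = (x, y)" for a b x y :: "'z list"
    using that by (induction a b rule: lag.induct) (auto split: if_splits)
  have finX: "finite X"
    by (rule finite_subset[of _ "st \<times> st \<times> W \<times> W"]) (use fin(1) finW in \<open>auto simp: X_def\<close>)
  \<comment> \<open>The completion is chosen from p, q, u and u' alone, so the output delay becomes
    a function of these four.\<close>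
  define G where "G p q u u' = (let (e, e') = SOME (e, e'). comp p q u u' e e' in
     let w = hom h (hom tout e); w' = hom h (hom tout e') in
     (take (length w' - length w) w', take (length w - length w') w))" for p q u u'
  have G: "(x, x') = G p q u u'" if D: "(p, q, u, u', x, x') \<in> D" for p q u u' x x'
  proof -
    from D obtain U U' Y Y' where r: "reach p q U U' Y Y'" "lag U U' = (u, u')" "lag Y Y' = (x, x')"
      and "live p q u u'" unfolding D_iff by blast
    then have "\<exists>e. (\<lambda>(e, e'). comp p q u u' e e') e" unfolding live_def by auto
    from someI_ex[OF this] obtain e e' where e: "(SOME (e, e'). comp p q u u' e e') = (e, e')" "comp p q u u' e e'"
      by (metis (mono_tags, lifting) case_prod_conv surj_pair)
    from r(1) obtain i i' c c' where c: "i \<in> ini" "i' \<in> ini" "tpath tr i c p" "tpath tr i' c' q"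
      "U = hom tin c" "U' = hom tin c'" "Y = hom h (hom tout c)" "Y' = hom h (hom tout c')"
      unfolding reach_def by blast
    from e(2) obtain f r r' where f: "f \<in> set fs" "r \<in> f" "r' \<in> f" "tpath tr p e r" "tpath tr q e' r'"
      "u @ hom tin e = u' @ hom tin e'" unfolding comp_def by blast
    have "tpath tr i (c @ e) r" "tpath tr i' (c' @ e') r'" unfolding tpath_append using c f by blast+
    moreover have "hom tin (c @ e) = hom tin (c' @ e')"
    proof -
      obtain z where "U = z @ u" "U' = z @ u'" using lag_decomp[of U U'] r(2) by auto
      then show ?thesis using f(6) c(5,6) by simp
    qed
    ultimately have "hom h (hom tout (c @ e)) = hom h (hom tout (c' @ e'))"
      using fp[OF f(1)] c(1,2) f(2,3) unfolding functional_paths_def by blast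
    then have "Y @ hom h (hom tout e) = Y' @ hom h (hom tout e')" using c(7,8) by simp
    from lag_of_common_completion[OF this] show ?thesis using r(3) unfolding G_def e(1) Let_def by simp
  qed
  have finD: "finite D"
  proof (rule finite_subset)
    show "D \<subseteq> (\<lambda>(p, q, u, u'). (p, q, u, u', G p q u u')) ` (st \<times> st \<times> W \<times> W)"
    proof
      fix d assume d: "d \<in> D"
      obtain p q u u' x x' where e: "d = (p, q, u, u', x, x')" by (metis surj_pair)
      have "d = (\<lambda>(p, q, u, u'). (p, q, u, u', G p q u u')) (p, q, u, u')" using G d unfolding e by auto
      moreover have "(p, q, u, u') \<in> st \<times> st \<times> W \<times> W" using d unfolding e D_iff by simp
      ultimately show "d \<in> (\<lambda>(p, q, u, u'). (p, q, u, u', G p q u u')) ` (st \<times> st \<times> W \<times> W)"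
        by (rule image_eqI)
    qed
  qed (use fin(1) finW in simp)
  have "dead tr fs X"
    unfolding dead_def
  proof (intro conjI allI impI ballI)
    show "(q, p, u', u) \<in> X" if "(p, q, u, u') \<in> X" for p q u u'
      using that live_sym[of p q u u'] unfolding X_iff by blast
    show "(p2, q, a, b) \<in> X" if "(p, q, [], z @ b) \<in> X" "(p, (z @ a, y), p2) \<in> tr" for p q z a b y p2
      using that live_step[OF _ that(2)] tr[OF that(2)] W_tr[OF that(2)] W_suffix unfolding X_iff by blast
    show "\<not> (p \<in> f \<and> q \<in> f)" if "(p, q, [], []) \<in> X" "f \<in> set fs" for p q f
    proof
      assume "p \<in> f \<and> q \<in> f"
      then have "comp p q [] [] [] []" unfolding comp_def using that(2) by auto
      then show False using that(1) unfolding X_iff live_def by blast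
    qed
  qed
  moreover have "certified h tr ini fs D X"
    unfolding certified_def
  proof (intro conjI allI impI ballI)
    show "(p, q, [], [], [], []) \<in> D \<or> (p, q, [], []) \<in> X" if "p \<in> ini" "q \<in> ini" for p q
    proof -
      have "tpath tr p [] p" "tpath tr q [] q" by simp_all
      then have "reach p q [] [] [] []" unfolding reach_def using that
        by (intro bexI[of _ p] bexI[of _ q] exI[of _ "[]"]) simp_all
      moreover have "p \<in> st" "q \<in> st" using that ini by blast+
      moreover have "lag [] [] = ([] :: 'a list, [])" "lag [] [] = ([] :: 'c list, [])" by simp_all
      ultimately show ?thesis unfolding D_iff X_iff using W_Nil by meson
    qed
    show "(q, p, u', u, x', x) \<in> D" if "(p, q, u, u', x, x') \<in> D" for p q u u' x x'
    proof -
      from that obtain U U' Y Y' where r: "reach p q U U' Y Y'" "lag U U' = (u, u')" "lag Y Y' = (x, x')"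
        unfolding D_iff by blast
      have "reach q p U' U Y' Y" using r(1) unfolding reach_def by blast
      then show ?thesis using that live_sym[of p q u u'] lag_swap[OF r(2)] lag_swap[OF r(3)] unfolding D_iff by blast
    qed
    show "(p2, q, a, b) \<in> X \<or>
        (\<exists>z' x2 x2'. (p2, q, a, b, x2, x2') \<in> D \<and> x @ hom h y = z' @ x2 \<and> x' = z' @ x2')"
      if d: "(p, q, [], z @ b, x, x') \<in> D" and t: "(p, (z @ a, y), p2) \<in> tr" and ab: "a = [] \<or> b = []"
      for p q z a b x x' y p2
    proof (cases "live p2 q a b")
      case True
      from d obtain U U' Y Y' where r: "reach p q U U' Y Y'" "lag U U' = ([], z @ b)" "lag Y Y' = (x, x')"
        unfolding D_iff by blast
      from r(1) obtain i i' c c' where c: "i \<in> ini" "i' \<in> ini" "tpath tr i c p" "tpath tr i' c' q"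
        "U = hom tin c" "U' = hom tin c'" "Y = hom h (hom tout c)" "Y' = hom h (hom tout c')"
        unfolding reach_def by blast
      let ?c = "c @ [(p, (z @ a, y), p2)]"
      have "tpath tr i ?c p2" unfolding tpath_append using c(3) t by auto
      moreover have "hom tin ?c = U @ z @ a" "hom h (hom tout ?c) = Y @ hom h y" using c by simp_all
      ultimately have r2: "reach p2 q (U @ z @ a) U' (Y @ hom h y) Y'"
        unfolding reach_def using c(1,2,4,6,8) by metis
      obtain x2 x2' where x2: "lag (Y @ hom h y) Y' = (x2, x2')" by (metis surj_pair)
      have "(p2, q, a, b, x2, x2') \<in> D"
        using r2 lag_step[OF r(2) ab] x2 True ab tr[OF t] W_tr[OF t] W_suffix d unfolding D_iff by blast
      moreover have "lag (x @ hom h y) x' = (x2, x2')" using x2 lag_append[of Y "hom h y" Y' "[]"] r(3) by simp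
      then have "\<exists>z'. x @ hom h y = z' @ x2 \<and> x' = z' @ x2'" using lag_decomp by (metis fst_conv snd_conv)
      ultimately show ?thesis by blast
    next
      case False
      then have "(p2, q, a, b) \<in> X" using d tr[OF t] W_tr[OF t] W_suffix unfolding X_iff D_iff by blast
      then show ?thesis ..
    qed
    show "x = x'" if d: "(p, q, [], [], x, x') \<in> D" and f: "f \<in> set fs" "p \<in> f \<and> q \<in> f" for p q x x' f
    proof -
      from d obtain U U' Y Y' where r: "reach p q U U' Y Y'" "lag U U' = ([], [])" "lag Y Y' = (x, x')"
        unfolding D_iff by blast
      then have "Y = Y'"
        using fp[OF f(1)] f(2) unfolding reach_def functional_paths_def lag_eq_Nil by blast
      then show ?thesis using r(3) lag_eq_Nil[of Y Y'] by simp
    qed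
  qed
  ultimately show ?thesis using finD finX by blast
qed

section \<open>Deciding certificates\<close>

lemma prod_encode_mono: "b \<le> b' \<Longrightarrow> prod_encode (a, b) \<le> prod_encode (a, b')"
  unfolding prod_encode_def by (auto intro: triangle_mono)

lemma list_encode_prefix: "list_encode z \<le> list_encode (z @ b)"
  by (induction z) (auto intro: prod_encode_mono)

lemma list_encode_suffix: "list_encode b \<le> list_encode (z @ b)"
  by (induction z) (auto intro: le_trans le_prod_encode_2 le_SucI)

lemma list_encode_member: "x \<in> set xs \<Longrightarrow> x < list_encode xs"
  by (induction xs) (auto simp: less_Suc_eq_le intro: le_prod_encode_1 less_imp_le le_trans[OF _ le_prod_encode_2])

lemma code_append_bounds: "z \<le> code_append z b" "b \<le> code_append z b"
  unfolding code_append_def using list_encode_prefix[of "list_decode z"] list_encode_suffix[of "list_decode b"]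
  by simp_all

lemma code_append_encode [simp]: "code_append (list_encode u) (list_encode v) = list_encode (u @ v)"
  by (simp add: code_append_def)

text \<open>This is why the checks below may bound each variable by the code of the set from which
  it is taken.\<close>

lemma mem_code_less: "list_encode xs \<in> set_decode n \<Longrightarrow> x \<in> set xs \<Longrightarrow> x < n"
  using list_encode_member mem_set_decode_less by (meson less_trans)

lemma all_words2: "(\<forall>u v. P u v) \<longleftrightarrow> (\<forall>u v. P (list_encode u) (list_encode v))"
  by (metis list_decode_inverse)

lemma list_encode_eq_0: "list_encode u = 0 \<longleftrightarrow> u = []"
  by (cases u) auto

text \<open>Values below H suffice: an element of a coded set is below the code, and a pair is at
  least as large as its components. The default 0 is the code of the empty word.\<close>

definition lookup :: "nat \<Rightarrow> nat \<Rightarrow> nat" where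
  "lookup H b = rec_nat 0 (\<lambda>v y. if prod_encode (b, v) \<in> set_decode H then v else y) H"

definition table :: "nat \<Rightarrow> nat \<Rightarrow> nat list" where
  "table H b = list_decode (lookup H b)"

definition table_code :: "nat \<Rightarrow> nat \<Rightarrow> nat" where
  "table_code H w = fold (\<lambda>b y. code_append y (lookup H b)) (list_decode w) 0"

lemma table_code: "table_code H (list_encode w) = list_encode (hom (table H) w)"
proof -
  have "fold (\<lambda>b y. code_append y (lookup H b)) w (list_encode v) = list_encode (v @ hom (table H) w)" for v
  proof (induction w arbitrary: v)
    case (Cons b w)
    have "code_append (list_encode v) (lookup H b) = list_encode (v @ table H b)"
      by (simp add: code_append_def table_def)
    then show ?case using Cons by simp
  qed simp
  from this[of "[]"] show ?thesis by (simp add: table_code_def)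
qed

lemma lookup_eq:
  assumes "prod_encode (b, v) \<in> set_decode H" "\<And>v'. prod_encode (b, v') \<in> set_decode H \<Longrightarrow> v' = v"
  shows "lookup H b = v"
proof -
  have "rec_nat 0 (\<lambda>v y. if prod_encode (b, v) \<in> set_decode H then v else y) n = v" if "v < n" for n
    using that
  proof (induction n)
    case (Suc n)
    show ?case
    proof (cases "v = n")
      case True
      then show ?thesis using assms(1) by simp
    next
      case False
      then show ?thesis using Suc assms(2) by auto
    qed
  qed simp
  moreover have "v < H"
    using mem_set_decode_less[OF assms(1)] le_prod_encode_2[of v b] by simp
  ultimately show ?thesis unfolding lookup_def by blast
qed

lemma tot_table_code [tot_intros]:
  assumes "tot f" "tot g" shows "tot (\<lambda>x. table_code (f x) (g x))"
  unfolding table_code_def lookup_def by (intro tot_intros assms assms[THEN tot_comp])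

section \<open>Decoding of certificates and bounded forms of their conditions\<close>

definition dec_trans :: "nat \<Rightarrow> (nat, nat, nat) trans set" where
  "dec_trans n = {(p, (u, x), q) | p u x q. list_encode [p, list_encode u, list_encode x, q] \<in> set_decode n}"

definition dec_dead :: "nat \<Rightarrow> (nat \<times> nat \<times> nat list \<times> nat list) set" where
  "dec_dead n = {(p, q, u, u') | p q u u'. list_encode [p, q, list_encode u, list_encode u'] \<in> set_decode n}"

definition dec_cert :: "nat \<Rightarrow> (nat \<times> nat \<times> nat list \<times> nat list \<times> nat list \<times> nat list) set" where
  "dec_cert n = {(p, q, u, u', x, x') | p q u u' x x'.
     list_encode [p, q, list_encode u, list_encode u', list_encode x, list_encode x'] \<in> set_decode n}"

lemma mem_dec_trans [simp]:
  "(p, (u, x), q) \<in> dec_trans n \<longleftrightarrow> list_encode [p, list_encode u, list_encode x, q] \<in> set_decode n"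
  by (simp add: dec_trans_def)

lemma mem_dec_dead [simp]:
  "(p, q, u, u') \<in> dec_dead n \<longleftrightarrow> list_encode [p, q, list_encode u, list_encode u'] \<in> set_decode n"
  by (simp add: dec_dead_def)

lemma mem_dec_cert [simp]:
  "(p, q, u, u', x, x') \<in> dec_cert n \<longleftrightarrow>
     list_encode [p, q, list_encode u, list_encode u', list_encode x, list_encode x'] \<in> set_decode n"
  by (simp add: dec_cert_def)

definition lifting_check :: "nat \<Rightarrow> nat \<Rightarrow> nat \<Rightarrow> nat \<Rightarrow> nat \<Rightarrow> nat \<Rightarrow> nat \<Rightarrow> bool" where
  "lifting_check trS inS fiS st tr ini fs \<longleftrightarrow>
     (\<forall>p\<in>set_decode ini. p \<in> set_decode st) \<and>
     (\<forall>f\<in>set (list_decode fs). \<forall>p\<in>set_decode f. p \<in> set_decode st) \<and>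
     (\<forall>p<tr. \<forall>u<tr. \<forall>x<tr. \<forall>q<tr. list_encode [p, u, x, q] \<in> set_decode tr \<longrightarrow>
        p \<in> set_decode st \<and> q \<in> set_decode st \<and> list_encode [pfst p, u, x, pfst q] \<in> set_decode trS) \<and>
     (\<forall>p\<in>set_decode ini. pfst p \<in> set_decode inS) \<and>
     (\<forall>f\<in>set (list_decode fs). \<forall>p\<in>set_decode f. pfst p \<in> set_decode fiS) \<and>
     (\<forall>p\<in>set_decode inS. \<exists>p'\<in>set_decode ini. pfst p' = p) \<and>
     (\<forall>p'\<in>set_decode st. \<forall>u<trS. \<forall>x<trS. \<forall>q<trS. list_encode [pfst p', u, x, q] \<in> set_decode trS \<longrightarrow>
        (\<exists>q'<tr. list_encode [p', u, x, q'] \<in> set_decode tr \<and> pfst q' = q)) \<and>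
     (\<forall>p'\<in>set_decode st. pfst p' \<in> set_decode fiS \<longrightarrow> (\<exists>f\<in>set (list_decode fs). p' \<in> set_decode f))"

lemma lifting_check_iff:
  assumes "transitions S = dec_trans trS" "initial S = set_decode inS" "final S = set_decode fiS"
  shows "lifting_check trS inS fiS st tr ini fs \<longleftrightarrow>
    lifting S (set_decode st) (dec_trans tr) (set_decode ini) (map set_decode (list_decode fs))"
proof -
  have 1: "(\<forall>p<tr. \<forall>u<tr. \<forall>x<tr. \<forall>q<tr. list_encode [p, u, x, q] \<in> set_decode tr \<longrightarrow> Q p u x q) \<longleftrightarrow>
    (\<forall>p l q. (p, l, q) \<in> dec_trans tr \<longrightarrow> Q p (list_encode (fst l)) (list_encode (snd l)) q)" (is "?l \<longleftrightarrow> _") for Q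
  proof -
    have "?l \<longleftrightarrow>
      (\<forall>p u x q. list_encode [p, u, x, q] \<in> set_decode tr \<longrightarrow> Q p u x q)"
      using mem_code_less[of _ tr] by (meson list.set_intros)
    then show ?thesis by (simp del: list_encode.simps) (metis list_decode_inverse)
  qed
  have 2: "(\<forall>u<trS. \<forall>x<trS. \<forall>q<trS. list_encode [p, u, x, q] \<in> set_decode trS \<longrightarrow>
        (\<exists>q'<tr. list_encode [p', u, x, q'] \<in> set_decode tr \<and> pfst q' = q)) \<longleftrightarrow>
    (\<forall>l q. (p, l, q) \<in> dec_trans trS \<longrightarrow> (\<exists>q'. (p', l, q') \<in> dec_trans tr \<and> pfst q' = q))" (is "?l \<longleftrightarrow> _") for p p'
  proof -
    have "?l \<longleftrightarrow>
      (\<forall>u x q. list_encode [p, u, x, q] \<in> set_decode trS \<longrightarrow>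
        (\<exists>q'. list_encode [p', u, x, q'] \<in> set_decode tr \<and> pfst q' = q))"
      using mem_code_less[of _ tr] mem_code_less[of _ trS] by (meson list.set_intros)
    also have "\<dots> \<longleftrightarrow> (\<forall>u x. \<forall>q. list_encode [p, list_encode u, list_encode x, q] \<in> set_decode trS \<longrightarrow>
        (\<exists>q'. list_encode [p', list_encode u, list_encode x, q'] \<in> set_decode tr \<and> pfst q' = q))"
      by (rule all_words2)
    finally show ?thesis by (simp del: list_encode.simps)
  qed
  have 3: "(p, l, q) \<in> dec_trans n \<longleftrightarrow> list_encode [p, list_encode (fst l), list_encode (snd l), q] \<in> set_decode n"
    for p l q n by (cases l) simp
  show ?thesis unfolding lifting_check_def lifting_def assms 1 2 3
    by (simp add: subset_eq del: list_encode.simps split_paired_All)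
qed

definition dead_check :: "nat \<Rightarrow> nat \<Rightarrow> nat \<Rightarrow> bool" where
  "dead_check tr fs X \<longleftrightarrow>
     (\<forall>p<X. \<forall>q<X. \<forall>u<X. \<forall>u'<X. list_encode [p, q, u, u'] \<in> set_decode X \<longrightarrow>
        list_encode [q, p, u', u] \<in> set_decode X) \<and>
     (\<forall>p<X. \<forall>q<X. \<forall>z<X. \<forall>a<tr. \<forall>b<X. \<forall>y<tr. \<forall>p2<tr.
        list_encode [p, q, 0, code_append z b] \<in> set_decode X \<longrightarrow>
        list_encode [p, code_append z a, y, p2] \<in> set_decode tr \<longrightarrow> a = 0 \<or> b = 0 \<longrightarrow>
        list_encode [p2, q, a, b] \<in> set_decode X) \<and>
     (\<forall>p<X. \<forall>q<X. list_encode [p, q, 0, 0] \<in> set_decode X \<longrightarrow>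
        (\<forall>f\<in>set (list_decode fs). \<not> (p \<in> set_decode f \<and> q \<in> set_decode f)))"

lemma dead_check_iff:
  "dead_check tr fs X \<longleftrightarrow> dead (dec_trans tr) (map set_decode (list_decode fs)) (dec_dead X)"
proof -
  have 1: "(\<forall>p<X. \<forall>q<X. \<forall>u<X. \<forall>u'<X. list_encode [p, q, u, u'] \<in> set_decode X \<longrightarrow>
        list_encode [q, p, u', u] \<in> set_decode X) \<longleftrightarrow>
     (\<forall>p q u u'. (p, q, u, u') \<in> dec_dead X \<longrightarrow> (q, p, u', u) \<in> dec_dead X)"
  proof -
    have "(\<forall>p<X. \<forall>q<X. \<forall>u<X. \<forall>u'<X. list_encode [p, q, u, u'] \<in> set_decode X \<longrightarrow>
        list_encode [q, p, u', u] \<in> set_decode X) \<longleftrightarrow>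
      (\<forall>p q u u'. list_encode [p, q, u, u'] \<in> set_decode X \<longrightarrow> list_encode [q, p, u', u] \<in> set_decode X)"
      using mem_code_less[of _ X] by (meson list.set_intros)
    then show ?thesis by (simp del: list_encode.simps) (metis list_decode_inverse)
  qed
  have 2: "(\<forall>p<X. \<forall>q<X. \<forall>z<X. \<forall>a<tr. \<forall>b<X. \<forall>y<tr. \<forall>p2<tr.
        list_encode [p, q, 0, code_append z b] \<in> set_decode X \<longrightarrow>
        list_encode [p, code_append z a, y, p2] \<in> set_decode tr \<longrightarrow> a = 0 \<or> b = 0 \<longrightarrow>
        list_encode [p2, q, a, b] \<in> set_decode X) \<longleftrightarrow>
     (\<forall>p q z a b y p2. (p, q, [], z @ b) \<in> dec_dead X \<longrightarrow> (p, (z @ a, y), p2) \<in> dec_trans tr \<longrightarrow>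
        a = [] \<or> b = [] \<longrightarrow> (p2, q, a, b) \<in> dec_dead X)" (is "?l \<longleftrightarrow> ?r")
  proof
    assume l: ?l
    show ?r
    proof (intro allI impI)
      fix p q z a b y p2
      assume a: "(p, q, [], z @ b) \<in> dec_dead X" "(p, (z @ a, y), p2) \<in> dec_trans tr" "a = [] \<or> b = []"
      have m: "list_encode [p, q, 0, code_append (list_encode z) (list_encode b)] \<in> set_decode X"
        "list_encode [p, code_append (list_encode z) (list_encode a), list_encode y, p2] \<in> set_decode tr"
        "list_encode a = 0 \<or> list_encode b = 0"
        using a by (simp_all add: list_encode_eq_0)
      \<comment> \<open>The code of a concatenation bounds the codes of both factors, so z, a and b
        are in the range of the bounded quantifiers although they are only parts of coded
        words.\<close>
      have "p < X" "q < X" "list_encode z < X" "list_encode b < X" "list_encode a < tr" "list_encode y < tr" "p2 < tr"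
        using mem_code_less[OF m(1), of p] mem_code_less[OF m(1), of q]
          mem_code_less[OF m(1), of "code_append (list_encode z) (list_encode b)"]
          mem_code_less[OF m(2), of "code_append (list_encode z) (list_encode a)"]
          mem_code_less[OF m(2), of "list_encode y"] mem_code_less[OF m(2), of p2]
          code_append_bounds(1)[of "list_encode z" "list_encode b"]
          code_append_bounds(2)[of "list_encode b" "list_encode z"]
          code_append_bounds(2)[of "list_encode a" "list_encode z"]
        by (simp_all del: code_append_encode)
      from l[rule_format, OF this(1-3,5,4,6,7) m] show "(p2, q, a, b) \<in> dec_dead X" by simp
    qed
  next
    assume r: ?r
    show ?l
    proof (intro allI impI)
      fix p q z a b y p2
      assume "list_encode [p, q, 0, code_append z b] \<in> set_decode X"
        "list_encode [p, code_append z a, y, p2] \<in> set_decode tr" "a = 0 \<or> b = 0"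
      then show "list_encode [p2, q, a, b] \<in> set_decode X"
        using r[rule_format, of p q "list_decode z" "list_decode b" "list_decode a" "list_decode y" p2]
        by (auto simp: code_append_def)
    qed
  qed
  have 3: "(\<forall>p<X. \<forall>q<X. list_encode [p, q, 0, 0] \<in> set_decode X \<longrightarrow> Q p q) \<longleftrightarrow>
    (\<forall>p q. (p, q, [], []) \<in> dec_dead X \<longrightarrow> Q p q)" for Q
  proof -
    have "(\<forall>p<X. \<forall>q<X. list_encode [p, q, 0, 0] \<in> set_decode X \<longrightarrow> Q p q) \<longleftrightarrow>
      (\<forall>p q. list_encode [p, q, 0, 0] \<in> set_decode X \<longrightarrow> Q p q)"
      using mem_code_less[of _ X] by (meson list.set_intros)
    then show ?thesis by simp
  qed
  show ?thesis unfolding dead_check_def dead_def 1 2 3 by simp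
qed

definition cert_check :: "nat \<Rightarrow> nat \<Rightarrow> nat \<Rightarrow> nat \<Rightarrow> nat \<Rightarrow> nat \<Rightarrow> bool" where
  "cert_check H tr ini fs D X \<longleftrightarrow>
     (\<forall>p\<in>set_decode ini. \<forall>q\<in>set_decode ini.
        list_encode [p, q, 0, 0, 0, 0] \<in> set_decode D \<or> list_encode [p, q, 0, 0] \<in> set_decode X) \<and>
     (\<forall>p<D. \<forall>q<D. \<forall>u<D. \<forall>u'<D. \<forall>x<D. \<forall>x'<D. list_encode [p, q, u, u', x, x'] \<in> set_decode D \<longrightarrow>
        list_encode [q, p, u', u, x', x] \<in> set_decode D) \<and>
     (\<forall>p<D. \<forall>q<D. \<forall>z<D. \<forall>a<tr. \<forall>b<D. \<forall>x<D. \<forall>x'<D. \<forall>y<tr. \<forall>p2<tr.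
        list_encode [p, q, 0, code_append z b, x, x'] \<in> set_decode D \<longrightarrow>
        list_encode [p, code_append z a, y, p2] \<in> set_decode tr \<longrightarrow> a = 0 \<or> b = 0 \<longrightarrow>
        list_encode [p2, q, a, b] \<in> set_decode X \<or>
        (\<exists>z'<D. \<exists>x2<D. \<exists>x2'<D. list_encode [p2, q, a, b, x2, x2'] \<in> set_decode D \<and>
           code_append x (table_code H y) = code_append z' x2 \<and> x' = code_append z' x2')) \<and>
     (\<forall>p<D. \<forall>q<D. \<forall>x<D. \<forall>x'<D. list_encode [p, q, 0, 0, x, x'] \<in> set_decode D \<longrightarrow>
        (\<forall>f\<in>set (list_decode fs). p \<in> set_decode f \<and> q \<in> set_decode f \<longrightarrow> x = x'))"

lemma cert_check_iff:
  "cert_check H tr ini fs D X \<longleftrightarrow>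
    certified (table H) (dec_trans tr) (set_decode ini) (map set_decode (list_decode fs)) (dec_cert D) (dec_dead X)"
proof -
  have 1: "(\<forall>p<D. \<forall>q<D. \<forall>u<D. \<forall>u'<D. \<forall>x<D. \<forall>x'<D. list_encode [p, q, u, u', x, x'] \<in> set_decode D \<longrightarrow>
        list_encode [q, p, u', u, x', x] \<in> set_decode D) \<longleftrightarrow>
     (\<forall>p q u u' x x'. (p, q, u, u', x, x') \<in> dec_cert D \<longrightarrow> (q, p, u', u, x', x) \<in> dec_cert D)" (is "?l \<longleftrightarrow> _")
  proof -
    have "?l \<longleftrightarrow>
      (\<forall>p q u u' x x'. list_encode [p, q, u, u', x, x'] \<in> set_decode D \<longrightarrow>
        list_encode [q, p, u', u, x', x] \<in> set_decode D)"
      using mem_code_less[of _ D] by (meson list.set_intros)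
    then show ?thesis by (simp del: list_encode.simps) (metis list_decode_inverse)
  qed
  have 2: "(\<forall>p<D. \<forall>q<D. \<forall>z<D. \<forall>a<tr. \<forall>b<D. \<forall>x<D. \<forall>x'<D. \<forall>y<tr. \<forall>p2<tr.
        list_encode [p, q, 0, code_append z b, x, x'] \<in> set_decode D \<longrightarrow>
        list_encode [p, code_append z a, y, p2] \<in> set_decode tr \<longrightarrow> a = 0 \<or> b = 0 \<longrightarrow>
        list_encode [p2, q, a, b] \<in> set_decode X \<or>
        (\<exists>z'<D. \<exists>x2<D. \<exists>x2'<D. list_encode [p2, q, a, b, x2, x2'] \<in> set_decode D \<and>
           code_append x (table_code H y) = code_append z' x2 \<and> x' = code_append z' x2')) \<longleftrightarrow>
     (\<forall>p q z a b x x' y p2. (p, q, [], z @ b, x, x') \<in> dec_cert D \<longrightarrow> (p, (z @ a, y), p2) \<in> dec_trans tr \<longrightarrow>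
        a = [] \<or> b = [] \<longrightarrow> (p2, q, a, b) \<in> dec_dead X \<or>
        (\<exists>z' x2 x2'. (p2, q, a, b, x2, x2') \<in> dec_cert D \<and>
           x @ hom (table H) y = z' @ x2 \<and> x' = z' @ x2'))" (is "?l \<longleftrightarrow> ?r")
  proof
    assume l: ?l
    show ?r
    proof (intro allI impI)
      fix p q z a b x x' y p2
      assume a: "(p, q, [], z @ b, x, x') \<in> dec_cert D" "(p, (z @ a, y), p2) \<in> dec_trans tr" "a = [] \<or> b = []"
      have m: "list_encode [p, q, 0, code_append (list_encode z) (list_encode b), list_encode x, list_encode x'] \<in> set_decode D"
        "list_encode [p, code_append (list_encode z) (list_encode a), list_encode y, p2] \<in> set_decode tr"
        "list_encode a = 0 \<or> list_encode b = 0"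
        using a by (simp_all add: list_encode_eq_0)
      have "p < D" "q < D" "list_encode z < D" "list_encode b < D" "list_encode a < tr" "list_encode y < tr" "p2 < tr"
        "list_encode x < D" "list_encode x' < D"
        using mem_code_less[OF m(1), of p] mem_code_less[OF m(1), of q]
          mem_code_less[OF m(1), of "list_encode x"] mem_code_less[OF m(1), of "list_encode x'"]
          mem_code_less[OF m(1), of "code_append (list_encode z) (list_encode b)"]
          mem_code_less[OF m(2), of "code_append (list_encode z) (list_encode a)"]
          mem_code_less[OF m(2), of "list_encode y"] mem_code_less[OF m(2), of p2]
          code_append_bounds(1)[of "list_encode z" "list_encode b"]
          code_append_bounds(2)[of "list_encode b" "list_encode z"]
          code_append_bounds(2)[of "list_encode a" "list_encode z"]
        by (simp_all del: code_append_encode)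
      from l[rule_format, OF this(1-3,5,4,8,9,6,7) m]
      show "(p2, q, a, b) \<in> dec_dead X \<or> (\<exists>z' x2 x2'. (p2, q, a, b, x2, x2') \<in> dec_cert D \<and>
           x @ hom (table H) y = z' @ x2 \<and> x' = z' @ x2')"
      proof (elim disjE exE conjE)
        fix z' x2 x2'
        assume e: "list_encode [p2, q, list_encode a, list_encode b, x2, x2'] \<in> set_decode D"
          "code_append (list_encode x) (table_code H (list_encode y)) = code_append z' x2"
          "list_encode x' = code_append z' x2'"
        have "(p2, q, a, b, list_decode x2, list_decode x2') \<in> dec_cert D" using e(1) by simp
        moreover have "x @ hom (table H) y = list_decode z' @ list_decode x2" "x' = list_decode z' @ list_decode x2'"
          using e(2,3) unfolding table_code by (simp_all add: code_append_def list_encode_eq)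
        ultimately show ?thesis by blast
      qed simp
    qed
  next
    assume r: ?r
    show ?l
    proof (intro allI impI)
      fix p q z a b x x' y p2
      assume a: "list_encode [p, q, 0, code_append z b, x, x'] \<in> set_decode D"
        "list_encode [p, code_append z a, y, p2] \<in> set_decode tr" "a = 0 \<or> b = 0"
      have "(p, q, [], list_decode z @ list_decode b, list_decode x, list_decode x') \<in> dec_cert D"
        "(p, (list_decode z @ list_decode a, list_decode y), p2) \<in> dec_trans tr"
        "list_decode a = [] \<or> list_decode b = []"
        using a by (auto simp: code_append_def)
      from r[rule_format, OF this] show "list_encode [p2, q, a, b] \<in> set_decode X \<or>
        (\<exists>z'<D. \<exists>x2<D. \<exists>x2'<D. list_encode [p2, q, a, b, x2, x2'] \<in> set_decode D \<and>
           code_append x (table_code H y) = code_append z' x2 \<and> x' = code_append z' x2')"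
      proof (elim disjE exE conjE)
        fix z' x2 x2'
        assume e: "(p2, q, list_decode a, list_decode b, x2, x2') \<in> dec_cert D"
          "list_decode x @ hom (table H) (list_decode y) = z' @ x2" "list_decode x' = z' @ x2'"
        have m: "list_encode [p2, q, a, b, list_encode x2, list_encode x2'] \<in> set_decode D" using e(1) by simp
        have 4: "code_append x (table_code H y) = code_append (list_encode z') (list_encode x2)"
          using e(2) table_code[of H "list_decode y"] by (simp add: code_append_def)
        have 5: "x' = code_append (list_encode z') (list_encode x2')"
          using e(3) by (metis code_append_encode list_decode_inverse)
        \<comment> \<open>The common prefix z' is a prefix of x', which occurs in an element of D,
          so searching below D loses nothing.\<close>
        have "list_encode z' < D" "list_encode x2 < D" "list_encode x2' < D"
          using mem_code_less[OF a(1), of x'] mem_code_less[OF m, of "list_encode x2"]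
            mem_code_less[OF m, of "list_encode x2'"] code_append_bounds(1)[of "list_encode z'" "list_encode x2'"]
          unfolding 5[symmetric] by simp_all
        then show ?thesis using m 4 5 by blast
      qed simp
    qed
  qed
  have 3: "(\<forall>p<D. \<forall>q<D. \<forall>x<D. \<forall>x'<D. list_encode [p, q, 0, 0, x, x'] \<in> set_decode D \<longrightarrow>
        (\<forall>f\<in>set (list_decode fs). p \<in> set_decode f \<and> q \<in> set_decode f \<longrightarrow> x = x')) \<longleftrightarrow>
    (\<forall>p q x x'. (p, q, [], [], x, x') \<in> dec_cert D \<longrightarrow>
        (\<forall>f\<in>set (map set_decode (list_decode fs)). p \<in> f \<and> q \<in> f \<longrightarrow> x = x'))"
  proof -
    have "(\<forall>p<D. \<forall>q<D. \<forall>x<D. \<forall>x'<D. list_encode [p, q, 0, 0, x, x'] \<in> set_decode D \<longrightarrow>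
        (\<forall>f\<in>set (list_decode fs). p \<in> set_decode f \<and> q \<in> set_decode f \<longrightarrow> x = x')) \<longleftrightarrow>
      (\<forall>p q x x'. list_encode [p, q, 0, 0, x, x'] \<in> set_decode D \<longrightarrow>
        (\<forall>f\<in>set (list_decode fs). p \<in> set_decode f \<and> q \<in> set_decode f \<longrightarrow> x = x'))"
      using mem_code_less[of _ D] by (meson list.set_intros)
    also have "\<dots> \<longleftrightarrow> (\<forall>p q x x'. list_encode [p, q, 0, 0, list_encode x, list_encode x'] \<in> set_decode D \<longrightarrow>
        (\<forall>f\<in>set (list_decode fs). p \<in> set_decode f \<and> q \<in> set_decode f \<longrightarrow> list_encode x = list_encode x'))"
      by (metis list_decode_inverse)
    finally show ?thesis by (simp add: list_encode_eq)
  qed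
  show ?thesis unfolding cert_check_def certified_def 1 2 3 by simp
qed

lemma dec_lifting_check [tot_intros]:
  assumes "tot trS" "tot inS" "tot fiS" "tot st" "tot tr" "tot ini" "tot fs"
  shows "dec (\<lambda>x. lifting_check (trS x) (inS x) (fiS x) (st x) (tr x) (ini x) (fs x))"
  \<comment> \<open>Under a quantifier the environment grows, and the parameters appear composed
    with projections of it; hence the second form of the assumptions.\<close>
  unfolding lifting_check_def by (intro tot_intros assms assms[THEN tot_comp])

lemma dec_dead_check [tot_intros]:
  assumes "tot tr" "tot fs" "tot X"
  shows "dec (\<lambda>x. dead_check (tr x) (fs x) (X x))"
  unfolding dead_check_def by (intro tot_intros assms assms[THEN tot_comp])

lemma dec_cert_check [tot_intros]:
  assumes "tot H" "tot tr" "tot ini" "tot fs" "tot D" "tot X"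
  shows "dec (\<lambda>x. cert_check (H x) (tr x) (ini x) (fs x) (D x) (X x))"
  unfolding cert_check_def by (intro tot_intros assms assms[THEN tot_comp])

section \<open>The algorithm on codes\<close>

text \<open>The fold computes the length of the list. The second clause forbids numbers in
  \<open>tr\<close> that code no transition: \<open>dec_trans\<close> would ignore them, while
  \<open>result_code\<close> would pass them on, and the result would not be the code of the
  transducers.\<close>

definition certificate_check ::
  "nat \<Rightarrow> nat \<Rightarrow> nat \<Rightarrow> nat \<Rightarrow> nat \<Rightarrow> nat \<Rightarrow> nat \<Rightarrow> nat \<Rightarrow> nat \<Rightarrow> nat \<Rightarrow> nat \<Rightarrow> bool" where
  "certificate_check k H trS inS fiS st tr ini fs D X \<longleftrightarrow>
     fold (\<lambda>f n. Suc n) (list_decode fs) 0 = k \<and>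
     (\<forall>t\<in>set_decode tr. \<exists>p<tr. \<exists>u<tr. \<exists>x<tr. \<exists>q<tr. t = list_encode [p, u, x, q]) \<and>
     lifting_check trS inS fiS st tr ini fs \<and> dead_check tr fs X \<and> cert_check H tr ini fs D X"

lemma dec_certificate_check [tot_intros]:
  assumes "tot k" "tot H" "tot trS" "tot inS" "tot fiS" "tot st" "tot tr" "tot ini" "tot fs" "tot D" "tot X"
  shows "dec (\<lambda>x. certificate_check (k x) (H x) (trS x) (inS x) (fiS x)
    (st x) (tr x) (ini x) (fs x) (D x) (X x))"
  unfolding certificate_check_def by (intro tot_intros assms assms[THEN tot_comp])

definition result_code :: "nat \<Rightarrow> nat \<Rightarrow> nat \<Rightarrow> nat \<Rightarrow> nat" where
  "result_code st tr ini fs = fold (\<lambda>f y. Suc (prod_encode (list_encode [st, tr, ini, f], y))) (list_decode fs) 0"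

lemma tot_result_code [tot_intros]:
  assumes "tot st" "tot tr" "tot ini" "tot fs"
  shows "tot (\<lambda>x. result_code (st x) (tr x) (ini x) (fs x))"
  unfolding result_code_def by (intro tot_intros assms assms[THEN tot_comp])

text \<open>The fold reverses the order of the components, which is harmless for a union of
  functional parts.\<close>

lemma result_code_eq: "result_code st tr ini fs = list_encode (map (\<lambda>f. list_encode [st, tr, ini, f]) (rev (list_decode fs)))"
proof -
  have "fold (\<lambda>f y. Suc (prod_encode (g f, y))) xs (list_encode ys) = list_encode (map g (rev xs) @ ys)"
    for g :: "nat \<Rightarrow> nat" and xs ys
  proof (induction xs arbitrary: ys)
    case (Cons x xs)
    have "Suc (prod_encode (g x, list_encode ys)) = list_encode (g x # ys)" by simp
    then show ?case using Cons[of "g x # ys"] by simp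
  qed simp
  from this[of "\<lambda>f. list_encode [st, tr, ini, f]" "list_decode fs" "[]"] show ?thesis unfolding result_code_def by simp
qed

abbreviation hd_code :: "nat \<Rightarrow> nat" where "hd_code n \<equiv> pfst (n - 1)"
abbreviation tl_code :: "nat \<Rightarrow> nat" where "tl_code n \<equiv> psnd (n - 1)"

section \<open>Correctness of the search\<close>

lemma transition_code_id:
  "transition_code id id id (p, (u, x), q) = list_encode [p, list_encode u, list_encode x, q]"
  by (simp add: transition_code_def word_code_def)

lemma inj_transition_code: "inj (transition_code id id id)"
  by (rule injI) (auto simp: transition_code_id list_encode_eq)

lemma dec_trans_encode:
  assumes "finite E" shows "dec_trans (set_encode (transition_code id id id ` E)) = E"
proof -
  have "t \<in> dec_trans (set_encode (transition_code id id id ` E)) \<longleftrightarrow> t \<in> E" for t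
  proof -
    obtain p u x q where t: "t = (p, (u, x), q)" by (metis surj_pair)
    have "t \<in> dec_trans (set_encode (transition_code id id id ` E)) \<longleftrightarrow>
      transition_code id id id t \<in> transition_code id id id ` E"
      using assms unfolding t transition_code_id by (simp del: list_encode.simps)
    then show ?thesis using inj_image_mem_iff[OF inj_transition_code] by simp
  qed
  then show ?thesis by blast
qed

lemma transition_code_dec_trans:
  assumes "\<forall>t\<in>set_decode n. \<exists>p<n. \<exists>u<n. \<exists>x<n. \<exists>q<n. t = list_encode [p, u, x, q]"
  shows "transition_code id id id ` dec_trans n = set_decode n"
proof (intro equalityI subsetI)
  fix t assume t: "t \<in> set_decode n"
  with assms obtain p u x q where e: "t = list_encode [p, u, x, q]" by blast
  have "(p, (list_decode u, list_decode x), q) \<in> dec_trans n" using t e by simp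
  moreover have "transition_code id id id (p, (list_decode u, list_decode x), q) = t"
    unfolding transition_code_id e by simp
  ultimately show "t \<in> transition_code id id id ` dec_trans n" by blast
next
  fix t assume "t \<in> transition_code id id id ` dec_trans n"
  then obtain p u x q where "(p, (u, x), q) \<in> dec_trans n" "t = transition_code id id id (p, (u, x), q)" by auto
  then show "t \<in> set_decode n" unfolding transition_code_id by simp
qed

lemma finite_dec_trans: "finite (dec_trans n)"
proof (rule finite_imageD)
  show "finite (transition_code id id id ` dec_trans n)"
    by (rule finite_subset[of _ "set_decode n"]) (auto simp: dec_trans_def transition_code_id)
  show "inj_on (transition_code id id id) (dec_trans n)"
    using inj_transition_code by (rule inj_on_subset) simp
qed

lemma fold_Suc_length: "fold (\<lambda>f n. Suc n) xs m = m + length xs"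
  by (induction xs arbitrary: m) auto

lemma certificate_check_complete:
  fixes S :: "(nat, nat, nat) transducer"
  assumes S: "transducer A B S" and val: "valued k (then_apply (realised S) (hom (table H)))" and "k > 0"
  shows "\<exists>st tr ini fs D X. certificate_check k H (set_encode (transition_code id id id ` transitions S))
     (set_encode (initial S)) (set_encode (final S)) st tr ini fs D X"
proof -
  from lifting_exists[OF assms] obtain st tr ini fs where l: "finite st" "finite tr" "length fs = k"
    "lifting S st tr ini fs" "\<And>f. f \<in> set fs \<Longrightarrow> functional_paths (table H) tr ini f" by blast
  have "\<exists>D X. finite D \<and> finite X \<and> dead tr fs X \<and> certified (table H) tr ini fs D X"
  proof (rule certificate_exists[OF l(1,2)])
    show "q \<in> st" if "(p, lb, q) \<in> tr" for p lb q using l(4) that by (rule liftingD(4))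
    show "ini \<subseteq> st" using l(4) by (rule liftingD(1))
    show "functional_paths (table H) tr ini f" if "f \<in> set fs" for f using that by (rule l(5))
  qed
  then obtain D X where c: "finite D" "finite X" "dead tr fs X" "certified (table H) tr ini fs D X"
    by (elim exE conjE)
  let ?tr = "set_encode (transition_code id id id ` tr)"
  let ?fs = "list_encode (map set_encode fs)"
  let ?D = "set_encode ((\<lambda>(p, q, u, u', x, x').
     list_encode [p, q, list_encode u, list_encode u', list_encode x, list_encode x']) ` D)"
  let ?X = "set_encode ((\<lambda>(p, q, u, u'). list_encode [p, q, list_encode u, list_encode u']) ` X)"
  have tr: "dec_trans ?tr = tr" by (rule dec_trans_encode[OF l(2)])
  have "finite ini" using liftingD(1)[OF l(4)] l(1) by (rule finite_subset)
  then have ini: "set_decode (set_encode ini) = ini" by (rule set_encode_inverse)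
  have "set_decode (set_encode f) = f" if "f \<in> set fs" for f
    using finite_subset[OF liftingD(2)[OF l(4) that] l(1)] by (rule set_encode_inverse)
  then have fs: "map set_decode (list_decode ?fs) = fs" by (simp add: map_idI)
  have D: "dec_cert ?D = D"
  proof -
    let ?c = "\<lambda>(p, q, u, u', x, x').
      list_encode [p, q, list_encode u, list_encode u', list_encode x, list_encode x']"
    have "inj ?c" by (rule injI) (auto simp: list_encode_eq)
    then have "?c d \<in> set_decode ?D \<longleftrightarrow> d \<in> D" for d
      using c(1) inj_image_mem_iff[of ?c d D] by simp
    then have "(p, q, u, u', x, x') \<in> dec_cert ?D \<longleftrightarrow> (p, q, u, u', x, x') \<in> D" for p q u u' x x'
      unfolding mem_dec_cert by (metis (mono_tags, lifting) case_prod_conv)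
    then show ?thesis by (intro set_eqI) (metis surj_pair)
  qed
  have X: "dec_dead ?X = X"
  proof -
    let ?c = "\<lambda>(p, q, u, u'). list_encode [p, q, list_encode u, list_encode u']"
    have "inj ?c" by (rule injI) (auto simp: list_encode_eq)
    then have "?c d \<in> set_decode ?X \<longleftrightarrow> d \<in> X" for d
      using c(2) inj_image_mem_iff[of ?c d X] by simp
    then have "(p, q, u, u') \<in> dec_dead ?X \<longleftrightarrow> (p, q, u, u') \<in> X" for p q u u'
      unfolding mem_dec_dead by (metis (mono_tags, lifting) case_prod_conv)
    then show ?thesis by (intro set_eqI) (metis surj_pair)
  qed
  have fin: "finite (transitions S)" "finite (initial S)" "finite (final S)"
    using S unfolding transducer_def by (auto intro: finite_subset)
  have "certificate_check k H (set_encode (transition_code id id id ` transitions S))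
     (set_encode (initial S)) (set_encode (final S)) (set_encode st) ?tr (set_encode ini) ?fs ?D ?X"
    unfolding certificate_check_def
  proof (intro conjI)
    show "fold (\<lambda>f n. Suc n) (list_decode ?fs) 0 = k" using l(3) by (simp add: fold_Suc_length)
    show "\<forall>t\<in>set_decode ?tr. \<exists>p<?tr. \<exists>u<?tr. \<exists>x<?tr. \<exists>q<?tr. t = list_encode [p, u, x, q]"
    proof
      fix t assume t: "t \<in> set_decode ?tr"
      then obtain p u x q where "t = transition_code id id id (p, (u, x), q)" using l(2) by auto
      then have e: "t = list_encode [p, list_encode u, list_encode x, q]" by (simp only: transition_code_id)
      have "p < ?tr" "list_encode u < ?tr" "list_encode x < ?tr" "q < ?tr"
        using mem_code_less[OF t[unfolded e]] by simp_all
      then show "\<exists>p<?tr. \<exists>u<?tr. \<exists>x<?tr. \<exists>q<?tr. t = list_encode [p, u, x, q]" using e by blast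
    qed
    show "lifting_check (set_encode (transition_code id id id ` transitions S))
     (set_encode (initial S)) (set_encode (final S)) (set_encode st) ?tr (set_encode ini) ?fs"
      using l(4) by (subst lifting_check_iff[of S]) (simp_all only: dec_trans_encode fin tr ini fs set_encode_inverse l(1))
    show "dead_check ?tr ?fs ?X" unfolding dead_check_iff tr fs X by (rule c(3))
    show "cert_check H ?tr (set_encode ini) ?fs ?D ?X" unfolding cert_check_iff tr fs X D ini by (rule c(4))
  qed
  then show ?thesis by blast
qed

definition functional_under :: "('b list \<Rightarrow> 'c list) \<Rightarrow> ('a list \<times> 'b list) set \<Rightarrow> bool" where
  "functional_under \<theta> R \<longleftrightarrow> (\<forall>u y y'. (u, y) \<in> R \<longrightarrow> (u, y') \<in> R \<longrightarrow> \<theta> y = \<theta> y')"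

lemma certificate_check_sound:
  fixes S :: "(nat, nat, nat) transducer"
  assumes S: "transducer A B S"
    and c: "certificate_check k H (set_encode (transition_code id id id ` transitions S))
     (set_encode (initial S)) (set_encode (final S)) st tr ini fs D X"
  shows "\<exists>Ss. result_code st tr ini fs = output_code id id Ss \<and> length Ss = k \<and> (\<forall>j<k. transducer A B (Ss ! j)) \<and>
    decomposed S Ss \<and> (\<forall>j<k. functional_under (hom (table H)) (realised (Ss ! j)))"
proof -
  let ?fs = "map set_decode (list_decode fs)"
  let ?T = "\<lambda>f. component (set_decode st) (dec_trans tr) (set_decode ini) (set_decode f)"
  let ?Ss = "map ?T (rev (list_decode fs))"
  have fin: "finite (transitions S)" "finite (initial S)" "finite (final S)"
    using S unfolding transducer_def by (auto intro: finite_subset)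
  have len: "length (list_decode fs) = k" using c unfolding certificate_check_def by (simp add: fold_Suc_length)
  have tr: "transition_code id id id ` dec_trans tr = set_decode tr"
    using c unfolding certificate_check_def by (intro transition_code_dec_trans) blast
  have "lifting_check (set_encode (transition_code id id id ` transitions S))
     (set_encode (initial S)) (set_encode (final S)) st tr ini fs"
    using c unfolding certificate_check_def by blast
  then have l: "lifting S (set_decode st) (dec_trans tr) (set_decode ini) ?fs"
    by (subst (asm) lifting_check_iff[of S]) (simp_all add: dec_trans_encode fin)
  have dead: "dead (dec_trans tr) ?fs (dec_dead X)"
    and cert: "certified (table H) (dec_trans tr) (set_decode ini) ?fs (dec_cert D) (dec_dead X)"
    using c unfolding certificate_check_def dead_check_iff cert_check_iff by blast+
  have T: "transducer A B (?T f)" if "f \<in> set (list_decode fs)" for f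
    using transducer_component[OF S l _ finite_dec_trans] that by simp
  have "result_code st tr ini fs = output_code id id ?Ss"
    unfolding result_code_eq output_code_def transducer_code_def finset_code_def component_simps map_map comp_def tr
    by (simp del: list_encode.simps)
  moreover have "\<forall>j<k. ?Ss ! j \<in> ?T ` set (list_decode fs)" using len nth_mem[of _ ?Ss] by simp
  then have "\<forall>j<k. transducer A B (?Ss ! j)" using T by fastforce
  moreover have "decomposed S ?Ss"
  proof -
    have "(\<Union>j<length ?Ss. realised (?Ss ! j)) = (\<Union>T\<in>set ?Ss. realised T)"
      unfolding set_conv_nth[of ?Ss] by blast
    also have "\<dots> = (\<Union>f\<in>set ?fs. realised (component (set_decode st) (dec_trans tr) (set_decode ini) f))" by simp
    also have "\<dots> = realised S" using lifting_realised[OF S l _ finite_dec_trans] by simp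
    finally show ?thesis unfolding decomposed_def by simp
  qed
  moreover have "functional_under (hom (table H)) (realised (?T f))" if f: "f \<in> set (list_decode fs)" for f
  proof -
    have "functional_paths (table H) (dec_trans tr) (set_decode ini) (set_decode f)"
      by (rule certified_sound[OF cert dead]) (use f in simp)
    then show ?thesis
      unfolding functional_under_def functional_paths_def realised_eq[OF T[OF f]] accepted_def component_simps
      by (auto simp: image_iff) metis
  qed
  then have "\<forall>j<k. functional_under (hom (table H)) (realised (?Ss ! j))"
    using \<open>\<forall>j<k. ?Ss ! j \<in> ?T ` set (list_decode fs)\<close> by fastforce
  ultimately show ?thesis using len by (intro exI[of _ ?Ss]) simp
qed

text \<open>The candidate w codes the six entries of a certificate by nested pairs. Completeness
  guarantees that the search succeeds, and soundness applies to whichever certificate it meets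
  first.\<close>

lemma nat_decomposition:
  "\<exists>F. \<forall>A B k H a b c (S :: (nat, nat, nat) transducer).
     transducer A B S \<longrightarrow> valued k (then_apply (realised S) (hom (table H))) \<longrightarrow> k > 0 \<longrightarrow>
     (\<exists>Ss. computes F [list_encode [a, b, c, k, H, transducer_code id id id S]] (output_code id id Ss) \<and>
       length Ss = k \<and> (\<forall>j<k. transducer A B (Ss ! j)) \<and> decomposed S Ss \<and>
       (\<forall>j<k. functional_under (hom (table H)) (realised (Ss ! j))))"
proof -
  \<comment> \<open>The transducer is the sixth entry of the input code; k is the fourth and the
    table of the morphism the fifth.\<close>
  let ?s = "\<lambda>x. hd_code (tl_code (tl_code (tl_code (tl_code (tl_code x)))))"
  define P where "P w x \<longleftrightarrow> certificate_check (hd_code (tl_code (tl_code (tl_code x))))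
     (hd_code (tl_code (tl_code (tl_code (tl_code x)))))
     (hd_code (tl_code (?s x))) (hd_code (tl_code (tl_code (?s x)))) (hd_code (tl_code (tl_code (tl_code (?s x)))))
     (pfst w) (pfst (psnd w)) (pfst (psnd (psnd w))) (pfst (psnd (psnd (psnd w))))
     (pfst (psnd (psnd (psnd (psnd w))))) (psnd (psnd (psnd (psnd (psnd w)))))" for w x
  have "dec (\<lambda>z. P (pfst z) (psnd z))" unfolding P_def by (intro tot_intros)
  moreover have "tot (\<lambda>w. result_code (pfst w) (pfst (psnd w)) (pfst (psnd (psnd w))) (pfst (psnd (psnd (psnd w)))))"
    by (intro tot_intros)
  ultimately have "\<exists>F. \<forall>x. (\<exists>w. P w x) \<longrightarrow> computes F [x]
     ((\<lambda>w. result_code (pfst w) (pfst (psnd w)) (pfst (psnd (psnd w))) (pfst (psnd (psnd (psnd w))))) (LEAST w. P w x))"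
    by (rule search_recf)
  then obtain F where F: "\<And>x. \<exists>w. P w x \<Longrightarrow> computes F [x]
     ((\<lambda>w. result_code (pfst w) (pfst (psnd w)) (pfst (psnd (psnd w))) (pfst (psnd (psnd (psnd w))))) (LEAST w. P w x))"
    by blast
  show ?thesis
  proof (intro exI[of _ F] allI impI)
    fix A B k H a b c and S :: "(nat, nat, nat) transducer"
    assume S: "transducer A B S" "valued k (then_apply (realised S) (hom (table H)))" "k > 0"
    let ?x = "list_encode [a, b, c, k, H, transducer_code id id id S]"
    have P: "P w ?x \<longleftrightarrow> certificate_check k H (set_encode (transition_code id id id ` transitions S))
     (set_encode (initial S)) (set_encode (final S))
     (pfst w) (pfst (psnd w)) (pfst (psnd (psnd w))) (pfst (psnd (psnd (psnd w))))
     (pfst (psnd (psnd (psnd (psnd w))))) (psnd (psnd (psnd (psnd (psnd w)))))" for w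
      unfolding P_def transducer_code_def finset_code_def by simp
    from certificate_check_complete[OF S] obtain st tr ini fs D X where
      "certificate_check k H (set_encode (transition_code id id id ` transitions S))
       (set_encode (initial S)) (set_encode (final S)) st tr ini fs D X" by blast
    then have "P (prod_encode (st, prod_encode (tr, prod_encode (ini, prod_encode (fs, prod_encode (D, X)))))) ?x"
      unfolding P by simp
    then have ex: "\<exists>w. P w ?x" by blast
    from certificate_check_sound[OF S(1) LeastI_ex[OF ex, unfolded P]] F[OF ex]
    show "\<exists>Ss. computes F [?x] (output_code id id Ss) \<and> length Ss = k \<and> (\<forall>j<k. transducer A B (Ss ! j)) \<and>
       decomposed S Ss \<and> (\<forall>j<k. functional_under (hom (table H)) (realised (Ss ! j)))"
      unfolding P by (metis (no_types, lifting))
  qed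
qed


section \<open>Renaming states and letters\<close>

definition relabel :: "('q \<Rightarrow> 'r) \<Rightarrow> ('a \<Rightarrow> 'c) \<Rightarrow> ('b \<Rightarrow> 'd) \<Rightarrow> ('q, 'a, 'b) transducer \<Rightarrow> ('r, 'c, 'd) transducer" where
  "relabel f g e S = \<lparr>states = f ` states S,
     transitions = (\<lambda>(p, (u, x), q). (f p, (map g u, map e x), f q)) ` transitions S,
     initial = f ` initial S, final = f ` final S\<rparr>"

lemma relabel_simps [simp]:
  "states (relabel f g e S) = f ` states S"
  "transitions (relabel f g e S) = (\<lambda>(p, (u, x), q). (f p, (map g u, map e x), f q)) ` transitions S"
  "initial (relabel f g e S) = f ` initial S" "final (relabel f g e S) = f ` final S"
  by (simp_all add: relabel_def)

lemma transducer_relabel: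
  assumes "transducer A B S" "g ` A \<subseteq> A'" "e ` B \<subseteq> B'"
  shows "transducer A' B' (relabel f g e S)"
proof -
  have "transitions (relabel f g e S) \<subseteq> f ` states S \<times> (lists A' \<times> lists B') \<times> f ` states S"
  proof
    fix t assume "t \<in> transitions (relabel f g e S)"
    then obtain p u x q where t: "t = (f p, (map g u, map e x), f q)" "(p, (u, x), q) \<in> transitions S" by auto
    then have "p \<in> states S" "u \<in> lists A" "x \<in> lists B" "q \<in> states S"
      using assms(1) unfolding transducer_def by auto
    then show "t \<in> f ` states S \<times> (lists A' \<times> lists B') \<times> f ` states S"
      unfolding t(1) using assms(2,3)[unfolded image_subset_iff] by auto
  qed
  then show ?thesis using assms(1) unfolding transducer_def by (simp add: image_mono)
qed

lemma computation_relabel: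
  "computation S p w q \<Longrightarrow> computation (relabel f g e S) (f p) (map g (fst w), map e (snd w)) (f q)"
proof (induction rule: computation.induct)
  case (empty p)
  then show ?case by (auto intro: computation.empty)
next
  case (step p u x q v y r)
  have "(f p, (map g u, map e x), f q) \<in> transitions (relabel f g e S)"
    using step.hyps(1) by (auto intro!: image_eqI)
  from computation.step[OF this step.IH] show ?case by simp
qed

lemma computation_relabelD:
  assumes "transducer A B S" "inj_on f (states S)"
  shows "computation (relabel f g e S) P W Q \<Longrightarrow> p \<in> states S \<Longrightarrow> P = f p \<Longrightarrow>
    \<exists>q u x. q \<in> states S \<and> Q = f q \<and> W = (map g u, map e x) \<and> computation S p (u, x) q"
proof (induction arbitrary: p rule: computation.induct)
  case (empty P)
  then show ?case by (intro exI[of _ p] exI[of _ "[]"]) (auto intro: computation.empty)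
next
  case (step P U X R V Y Q)
  from step.hyps(1) obtain p' u x r where t: "P = f p'" "U = map g u" "X = map e x" "R = f r"
    "(p', (u, x), r) \<in> transitions S" by auto
  then have "p' \<in> states S" "r \<in> states S" using assms(1) unfolding transducer_def by auto
  then have "p' = p" using assms(2) t(1) step.prems by (auto dest: inj_onD)
  from step.IH[OF \<open>r \<in> states S\<close> t(4)] obtain q v y where
    "q \<in> states S" "Q = f q" "(V, Y) = (map g v, map e y)" "computation S r (v, y) q" by blast
  then show ?case using t \<open>p' = p\<close>
    by (intro exI[of _ q] exI[of _ "u @ v"] exI[of _ "x @ y"]) (auto intro: computation.step)
qed

text \<open>Injectivity is asked of the states only: merging states could create new paths, whereas
  merging letters merely maps the labels.\<close>

lemma realised_relabel:
  assumes "transducer A B S" "inj_on f (states S)"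
  shows "realised (relabel f g e S) = (\<lambda>(u, x). (map g u, map e x)) ` realised S"
proof (intro equalityI subsetI)
  have I: "initial S \<subseteq> states S" "final S \<subseteq> states S" using assms(1) unfolding transducer_def by auto
  fix W assume "W \<in> realised (relabel f g e S)"
  then obtain p Q where p: "p \<in> initial S" "Q \<in> f ` final S" "computation (relabel f g e S) (f p) W Q"
    unfolding realised_def by auto
  from computation_relabelD[OF assms p(3) _ refl] p(1) I obtain q u x where
    q: "q \<in> states S" "Q = f q" "W = (map g u, map e x)" "computation S p (u, x) q" by blast
  have "q \<in> final S" using p(2) q(1,2) I assms(2) by (auto dest: inj_onD)
  then have "(u, x) \<in> realised S" unfolding realised_def using p(1) q(4) by blast
  then show "W \<in> (\<lambda>(u, x). (map g u, map e x)) ` realised S" using q(3) by (intro image_eqI) auto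
next
  fix W assume "W \<in> (\<lambda>(u, x). (map g u, map e x)) ` realised S"
  then obtain u x p q where "W = (map g u, map e x)" "p \<in> initial S" "q \<in> final S" "computation S p (u, x) q"
    unfolding realised_def by auto
  then show "W \<in> realised (relabel f g e S)"
    unfolding realised_def using computation_relabel[of S p "(u, x)" q f g e] by auto
qed

lemma realised_in_lists:
  assumes "transducer A B S" "(u, x) \<in> realised S"
  shows "u \<in> lists A" "x \<in> lists B"
proof -
  from assms(2) obtain c where c: "c \<in> accepted S" "u = hom tin c" "x = hom tout c"
    unfolding realised_eq[OF assms(1)] by blast
  from c(1) obtain p q where "tpath (transitions S) p c q" unfolding accepted_def by blast
  then have "c \<in> lists (transitions S)" by (rule tpath_in_lists)
  moreover have "tin t \<in> lists A \<and> tout t \<in> lists B" if "t \<in> transitions S" for t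
  proof -
    have "t \<in> states S \<times> (lists A \<times> lists B) \<times> states S" using assms(1) that unfolding transducer_def by blast
    then show ?thesis by (cases t) auto
  qed
  ultimately have "hom tin c \<in> lists A \<and> hom tout c \<in> lists B"
    by (induction c) (auto simp: append_in_lists_conv)
  then show "u \<in> lists A" "x \<in> lists B" using c by simp_all
qed

lemma transducer_code_relabel:
  "transducer_code \<nu>Q \<nu>A \<nu>B S = transducer_code id id id (relabel \<nu>Q \<nu>A \<nu>B S)"
proof -
  have "transition_code \<nu>Q \<nu>A \<nu>B t = transition_code id id id ((\<lambda>(p, (u, x), q). (\<nu>Q p, (map \<nu>A u, map \<nu>B x), \<nu>Q q)) t)"
    for t by (cases t) (auto simp: transition_code_def word_code_def)
  then show ?thesis unfolding transducer_code_def finset_code_def by (simp add: image_image)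
qed

lemma map_inv_into: "u \<in> lists (\<nu> ` A) \<Longrightarrow> map \<nu> (map (inv_into A \<nu>) u) = u"
  by (induction u) (auto simp: f_inv_into_f)

lemma inv_into_map: "inj_on \<nu> A \<Longrightarrow> u \<in> lists A \<Longrightarrow> map (inv_into A \<nu>) (map \<nu> u) = u"
  by (induction u) auto

text \<open>All letters of T are values of the numberings, so going back and numbering again changes
  nothing. The number returned by the search is therefore also the code of the transducer over the
  original alphabets.\<close>

lemma transducer_code_unrelabel:
  assumes "transducer (\<nu>A ` A) (\<nu>B ` B) T"
  shows "transducer_code id \<nu>A \<nu>B (relabel id (inv_into A \<nu>A) (inv_into B \<nu>B) T) = transducer_code id id id T"
proof -
  have "(\<lambda>(p, (u, x), q). (id p, (map \<nu>A u, map \<nu>B x), id q)) `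
    (\<lambda>(p, (u, x), q). (id p, (map (inv_into A \<nu>A) u, map (inv_into B \<nu>B) x), id q)) ` transitions T = (\<lambda>t. t) ` transitions T"
    unfolding image_image
  proof (rule image_cong[OF refl])
    fix t assume t: "t \<in> transitions T"
    obtain p u x q where e: "t = (p, (u, x), q)" by (metis surj_pair)
    have l: "u \<in> lists (\<nu>A ` A)" "x \<in> lists (\<nu>B ` B)" using assms t unfolding transducer_def e by auto
    show "(\<lambda>(p, (u, x), q). (id p, (map \<nu>A u, map \<nu>B x), id q))
      ((\<lambda>(p, (u, x), q). (id p, (map (inv_into A \<nu>A) u, map (inv_into B \<nu>B) x), id q)) t) = t"
      unfolding e prod.case id_apply map_inv_into[OF l(1)] map_inv_into[OF l(2)] by (rule refl)
  qed
  then have "relabel id \<nu>A \<nu>B (relabel id (inv_into A \<nu>A) (inv_into B \<nu>B) T) = T" by (simp add: relabel_def)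
  then show ?thesis unfolding transducer_code_relabel[of id \<nu>A \<nu>B] by simp
qed

text \<open>Injectivity of \<open>\<nu>B\<close> on B makes the coded table single-valued, so the
  lookup finds the value on each letter; multiplicativity of \<theta> extends this to words.\<close>

lemma table_morphism:
  assumes "morphism B C \<theta>" "finite B" "inj_on \<nu>B B" "y \<in> lists B"
  shows "hom (table (morphism_code \<nu>B \<nu>C B \<theta>)) (map \<nu>B y) = map \<nu>C (\<theta> y)"
  using assms(4)
proof (induction y)
  case Nil
  then show ?case using assms(1) by (simp add: morphism_def)
next
  case (Cons b y)
  let ?H = "morphism_code \<nu>B \<nu>C B \<theta>"
  have H: "set_decode ?H = (\<lambda>b. prod_encode (\<nu>B b, word_code \<nu>C (\<theta> [b]))) ` B"
    unfolding morphism_code_def finset_code_def using assms(2) by simp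
  have "lookup ?H (\<nu>B b) = word_code \<nu>C (\<theta> [b])"
    by (rule lookup_eq) (use Cons assms(3) in \<open>auto simp: H dest: inj_onD\<close>)
  then have "table ?H (\<nu>B b) = map \<nu>C (\<theta> [b])" unfolding table_def word_code_def by simp
  moreover have "\<theta> (b # y) = \<theta> [b] @ \<theta> y"
  proof -
    have "[b] \<in> lists B" "y \<in> lists B" using Cons by auto
    then show ?thesis using assms(1) unfolding morphism_def by (metis append_Cons append_Nil)
  qed
  ultimately show ?case using Cons by simp
qed

lemma functional_if_functional_under:
  assumes "functional_under \<theta> R" shows "functional (then_apply R \<theta>)"
proof -
  have "\<exists>z. then_apply R \<theta> `` {u} \<subseteq> {z}" for u
  proof (cases "\<exists>y. (u, y) \<in> R")
    case True
    then obtain y where "(u, y) \<in> R" ..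
    have "z = \<theta> y" if "z \<in> then_apply R \<theta> `` {u}" for z
    proof -
      from that obtain y' where "(u, y') \<in> R" "z = \<theta> y'" unfolding then_apply_def by blast
      then show ?thesis using assms[unfolded functional_under_def, rule_format, OF _ \<open>(u, y) \<in> R\<close>] by blast
    qed
    then show ?thesis by blast
  next
    case False
    then show ?thesis unfolding then_apply_def by auto
  qed
  note sub = this
  show ?thesis unfolding valued_def
  proof
    fix u
    from sub[of u] obtain z where z: "then_apply R \<theta> `` {u} \<subseteq> {z}" by blast
    show "finite (then_apply R \<theta> `` {u}) \<and> card (then_apply R \<theta> `` {u}) \<le> 1"
      using finite_subset[OF z] card_mono[OF _ z] by simp
  qed
qed

text \<open>F is fixed before all data: it works on transducers over natural numbers, and the
  numberings translate to and from these without changing any code.\<close>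

theorem theorem1p2:
  "\<exists>F :: recf.
     \<forall>(A :: 'a set) (B :: 'b set) (C :: 'c set) (k :: nat) (\<tau> :: ('a list \<times> 'b list) set)
      (\<theta> :: 'b list \<Rightarrow> 'c list) (S :: ('q, 'a, 'b) transducer)
      (\<nu>A :: 'a \<Rightarrow> nat) (\<nu>B :: 'b \<Rightarrow> nat) (\<nu>C :: 'c \<Rightarrow> nat) (\<nu>Q :: 'q \<Rightarrow> nat).
       finite A \<and> finite B \<and> finite C \<and> k > 0 \<and>
       rational A B \<tau> \<and> finite_image \<tau> \<and>
       morphism B C \<theta> \<and> valued k (then_apply \<tau> \<theta>) \<and>
       transducer A B S \<and> realised S = \<tau> \<and>
       inj_on \<nu>A A \<and> inj_on \<nu>B B \<and> inj_on \<nu>C C \<and> inj_on \<nu>Q (states S)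
       \<longrightarrow>
       (\<exists>Ss :: (nat, 'a, 'b) transducer list.
          computes F [input_code \<nu>Q \<nu>A \<nu>B \<nu>C A B C k \<theta> S] (output_code \<nu>A \<nu>B Ss) \<and>
          length Ss = k \<and>
          (\<forall>j < k. transducer A B (Ss ! j)) \<and>
          decomposed S Ss \<and>
          (\<forall>j < k. functional (then_apply (realised (Ss ! j)) \<theta>)))"
proof -
  from nat_decomposition obtain F where F: "\<And>A B k H a b c (S :: (nat, nat, nat) transducer).
     transducer A B S \<Longrightarrow> valued k (then_apply (realised S) (hom (table H))) \<Longrightarrow> k > 0 \<Longrightarrow>
     \<exists>Ss. computes F [list_encode [a, b, c, k, H, transducer_code id id id S]] (output_code id id Ss) \<and>
       length Ss = k \<and> (\<forall>j<k. transducer A B (Ss ! j)) \<and> decomposed S Ss \<and>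
       (\<forall>j<k. functional_under (hom (table H)) (realised (Ss ! j)))" by blast
  show ?thesis
  proof (intro exI[of _ F] allI impI, elim conjE)
    fix A :: "'a set" and B :: "'b set" and C :: "'c set" and k and \<tau> :: "('a list \<times> 'b list) set"
      and \<theta> :: "'b list \<Rightarrow> 'c list" and S :: "('q, 'a, 'b) transducer"
      and \<nu>A :: "'a \<Rightarrow> nat" and \<nu>B :: "'b \<Rightarrow> nat" and \<nu>C :: "'c \<Rightarrow> nat" and \<nu>Q :: "'q \<Rightarrow> nat"
    assume fin: "finite A" "finite B" "finite C" and "k > 0" and \<theta>: "morphism B C \<theta>"
      and val: "valued k (then_apply \<tau> \<theta>)" and S: "transducer A B S" and \<tau>: "realised S = \<tau>"
      and inj: "inj_on \<nu>A A" "inj_on \<nu>B B" "inj_on \<nu>C C" "inj_on \<nu>Q (states S)"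
    let ?H = "morphism_code \<nu>B \<nu>C B \<theta>"
    let ?S = "relabel \<nu>Q \<nu>A \<nu>B S"
    have S': "transducer (\<nu>A ` A) (\<nu>B ` B) ?S" by (rule transducer_relabel[OF S]) auto
    have rS: "realised ?S = (\<lambda>(u, x). (map \<nu>A u, map \<nu>B x)) ` \<tau>"
      using realised_relabel[OF S inj(4)] \<tau> by simp
    have table: "hom (table ?H) (map \<nu>B y) = map \<nu>C (\<theta> y)" if "y \<in> lists B" for y
      using table_morphism[OF \<theta> fin(2) inj(2) that] .
    have \<tau>_lists: "u \<in> lists A" "y \<in> lists B" if "(u, y) \<in> \<tau>" for u y
      using realised_in_lists[OF S] that \<tau> by blast+
    have "valued k (then_apply (realised ?S) (hom (table ?H)))"
      unfolding valued_def
    proof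
      fix u'
      \<comment> \<open>If u' is not the numbering of an input of \<tau>, its image is empty and the
        choice of \<open>?u\<close> is immaterial.\<close>
      let ?u = "map (inv_into A \<nu>A) u'"
      have sub: "then_apply (realised ?S) (hom (table ?H)) `` {u'} \<subseteq> map \<nu>C ` (then_apply \<tau> \<theta> `` {?u})"
      proof
        fix z assume "z \<in> then_apply (realised ?S) (hom (table ?H)) `` {u'}"
        then obtain u y where uy: "u' = map \<nu>A u" "z = hom (table ?H) (map \<nu>B y)" "(u, y) \<in> \<tau>"
          unfolding then_apply_def rS by auto
        have "?u = u" unfolding uy(1) using inv_into_map[OF inj(1) \<tau>_lists(1)[OF uy(3)]] .
        then have "\<theta> y \<in> then_apply \<tau> \<theta> `` {?u}" unfolding then_apply_def using uy(3) by auto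
        then show "z \<in> map \<nu>C ` (then_apply \<tau> \<theta> `` {?u})"
          using table[OF \<tau>_lists(2)[OF uy(3)]] uy(2) by simp
      qed
      have v: "finite (then_apply \<tau> \<theta> `` {?u})" "card (then_apply \<tau> \<theta> `` {?u}) \<le> k"
        using val unfolding valued_def by blast+
      show "finite (then_apply (realised ?S) (hom (table ?H)) `` {u'}) \<and>
          card (then_apply (realised ?S) (hom (table ?H)) `` {u'}) \<le> k"
        using finite_subset[OF sub] card_mono[OF _ sub] card_image_le[OF v(1), of "map \<nu>C"] v by auto
    qed
    from F[OF S' this \<open>k > 0\<close>, of "finset_code \<nu>A A" "finset_code \<nu>B B" "finset_code \<nu>C C"] obtain Ts where
      Ts: "computes F [list_encode [finset_code \<nu>A A, finset_code \<nu>B B, finset_code \<nu>C C, k, ?H,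
         transducer_code id id id ?S]] (output_code id id Ts)" "length Ts = k"
      "\<And>j. j < k \<Longrightarrow> transducer (\<nu>A ` A) (\<nu>B ` B) (Ts ! j)" "decomposed ?S Ts"
      "\<And>j. j < k \<Longrightarrow> functional_under (hom (table ?H)) (realised (Ts ! j))" by blast
    \<comment> \<open>The answer is pulled back along the inverse numberings of letters; its states
      are natural numbers already.\<close>
    let ?r = "relabel id (inv_into A \<nu>A) (inv_into B \<nu>B) :: (nat, nat, nat) transducer \<Rightarrow> (nat, 'a, 'b) transducer"
    let ?m = "\<lambda>(u, x). (map (inv_into A \<nu>A) u, map (inv_into B \<nu>B) x)"
    have real: "realised (?r (Ts ! j)) = ?m ` realised (Ts ! j)" if "j < k" for j
      by (rule realised_relabel[OF Ts(3)[OF that]]) simp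
    have "output_code \<nu>A \<nu>B (map ?r Ts) = output_code id id Ts"
    proof -
      have "transducer_code id \<nu>A \<nu>B (?r T) = transducer_code id id id T" if "T \<in> set Ts" for T
        using that Ts(2,3) by (intro transducer_code_unrelabel) (auto simp: in_set_conv_nth)
      then have "map (transducer_code id \<nu>A \<nu>B) (map ?r Ts) = map (transducer_code id id id) Ts" by simp
      then show ?thesis unfolding output_code_def by (rule arg_cong)
    qed
    moreover have "input_code \<nu>Q \<nu>A \<nu>B \<nu>C A B C k \<theta> S = list_encode [finset_code \<nu>A A, finset_code \<nu>B B,
        finset_code \<nu>C C, k, ?H, transducer_code id id id ?S]"
      unfolding input_code_def transducer_code_relabel[of \<nu>Q] ..
    ultimately have "computes F [input_code \<nu>Q \<nu>A \<nu>B \<nu>C A B C k \<theta> S] (output_code \<nu>A \<nu>B (map ?r Ts))"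
      using Ts(1) by simp
    moreover have "transducer A B (map ?r Ts ! j)" if "j < k" for j
      using transducer_relabel[OF Ts(3)[OF that], of "inv_into A \<nu>A" A "inv_into B \<nu>B" B id] Ts(2) that inj(1,2)
      by (simp add: inv_into_into image_subset_iff)
    moreover have "decomposed S (map ?r Ts)"
    proof -
      have "?m (map \<nu>A u, map \<nu>B x) = (u, x)" if "(u, x) \<in> \<tau>" for u x
        using inv_into_map[OF inj(1) \<tau>_lists(1)[OF that]] inv_into_map[OF inj(2) \<tau>_lists(2)[OF that]]
        by (simp del: map_map)
      then have "?m ` realised ?S = (\<lambda>w. w) ` \<tau>"
        unfolding rS image_image by (intro image_cong) auto
      moreover have "?m ` realised ?S = (\<Union>j<k. realised (?r (Ts ! j)))"
        using Ts(2,4) real unfolding decomposed_def by (simp add: image_UN)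
      ultimately show ?thesis unfolding decomposed_def using Ts(2) \<tau> by simp
    qed
    moreover have "functional (then_apply (realised (map ?r Ts ! j)) \<theta>)" if j: "j < k" for j
    proof (rule functional_if_functional_under, unfold functional_under_def, intro allI impI)
      have nth: "map ?r Ts ! j = ?r (Ts ! j)" using Ts(2) j by simp
      have orig: "(map \<nu>A u, map \<nu>B y) \<in> realised (Ts ! j) \<and> y \<in> lists B" if uy: "(u, y) \<in> realised (?r (Ts ! j))" for u y
      proof -
        from uy obtain v z where v: "u = map (inv_into A \<nu>A) v" "y = map (inv_into B \<nu>B) z" "(v, z) \<in> realised (Ts ! j)"
          unfolding real[OF j] by auto
        note l = realised_in_lists[OF Ts(3)[OF j] v(3)]
        have "(map \<nu>A u, map \<nu>B y) \<in> realised (Ts ! j)"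
          unfolding v(1,2) map_inv_into[OF l(1)] map_inv_into[OF l(2)] by (rule v(3))
        moreover have "y \<in> lists B" unfolding v(2) using l(2) by (induction z) (auto intro: inv_into_into)
        ultimately show ?thesis ..
      qed
      fix u y y' assume "(u, y) \<in> realised (map ?r Ts ! j)" "(u, y') \<in> realised (map ?r Ts ! j)"
      then have uy: "(u, y) \<in> realised (?r (Ts ! j))" "(u, y') \<in> realised (?r (Ts ! j))" unfolding nth .
      have "hom (table ?H) (map \<nu>B y) = hom (table ?H) (map \<nu>B y')"
        using Ts(5)[OF j] orig[OF uy(1)] orig[OF uy(2)] unfolding functional_under_def by blast
      then have "map \<nu>C (\<theta> y) = map \<nu>C (\<theta> y')" using table orig[OF uy(1)] orig[OF uy(2)] by simp
      moreover have "\<theta> y \<in> lists C" "\<theta> y' \<in> lists C"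
        using \<theta> orig[OF uy(1)] orig[OF uy(2)] unfolding morphism_def by blast+
      \<comment> \<open>\<open>\<nu>C\<close> is injective on C only, so both values must first be
        known to be words over C.\<close>
      ultimately show "\<theta> y = \<theta> y'" using inv_into_map[OF inj(3)] by metis
    qed
    ultimately show "\<exists>Ss :: (nat, 'a, 'b) transducer list.
          computes F [input_code \<nu>Q \<nu>A \<nu>B \<nu>C A B C k \<theta> S] (output_code \<nu>A \<nu>B Ss) \<and>
          length Ss = k \<and> (\<forall>j < k. transducer A B (Ss ! j)) \<and> decomposed S Ss \<and>
          (\<forall>j < k. functional (then_apply (realised (Ss ! j)) \<theta>))"
      using Ts(2) by (intro exI[of _ "map ?r Ts"] conjI allI impI) simp_all
  qed
qed

end
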